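(* Let $\psi_1,\psi_2\in H^{2}(\mathbb{R})\cap H^{1,1}(\mathbb{R})$ be $\mathbb{C}$-valued functions independent of $\varepsilon$. For sufficiently small $\varepsilon>0$, let $u=(u_1,u_2)\in C([0,\infty);H^2\cap H^{1,1})$ be the global solution of $$i\partial_t u_1+\tfrac12\partial_x^2u_1=-i|u_2|^2u_1,\qquad i\partial_t u_2+\tfrac12\partial_x^2u_2=-i|u_1|^2u_2,\qquad (t,x)\in(0,\infty)\times\mathbb{R},$$ $$u_j(0,x)=\varepsilon\psi_j(x),\quad x\in\mathbb{R},\ j=1,2,$$ and let $\varphi_j^+=\lim_{t\to+\infty}\mathcal{U}(-t)u_j(t)$ in $L^2(\mathbb{R})$, $j=1,2$, be its scattering state. Assume that there exist points $\xi^*\in\mathbb{R}$ and $\xi_*\in\mathbb{R}$ such that $$|\hat\psi_1(\xi^* )|>|\hat\psi_2(\xi^* )|\qquad\text{and}\qquad|\hat\psi_1(\xi_* )|<|\hat\psi_2(\xi_* )|.$$ Then, for sufficiently small $\varepsilon>0$ (i.e. there is $\varepsilon_0>0$ such that for all $0<\varepsilon<\varepsilon_0$), we have $\|\varphi_1^+\|_{L^2}>0$ and $\|\varphi_2^+\|_{L^2}>0$.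
   Context: Notation. $H^{s,\sigma}=H^{s,\sigma}(\mathbb{R})$ is the $L^2$-based weighted Sobolev space of order $(s,\sigma)$, i.e. the space of $\phi$ with $(1+x^2)^{\sigma/2}(1-\partial_x^2)^{s/2}\phi\in L^2(\mathbb{R})$, and $H^s=H^{s,0}$. $\hat\phi=\mathcal{F}\phi$ is the Fourier transform, $\hat\phi(\xi)=\frac{1}{\sqrt{2\pi}}\int_{\mathbb{R}}e^{-ix\xi}\phi(x)\,dx$, and $\mathcal{U}(t)=\exp(i\frac t2\partial_x^2)$ is the free Schrödinger group. Since $\psi_j\in H^{1,1}$, $\hat\psi_j$ is a continuous function, so its pointwise values make sense. Known result (assumed): if the initial data $\varphi^0=(\varphi_1^0,\varphi_2^0)$ have sufficiently small norm in $H^2\cap H^{1,1}$, the Cauchy problem for the system with $u_j(0)=\varphi_j^0$ has a unique global solution $u\in C([0,\infty);H^2\cap H^{1,1})$, and the limits $\varphi_j^+=\lim_{t\to+\infty}\mathcal{U}(-t)u_j(t)$ exist in $L^2$, $j=1,2$. In particular this applies to $\varphi^0_j=\varepsilon\psi_j$ for small $\varepsilon>0$; $\varphi_j^+$ depends on $\varepsilon$. *)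

theory Defs
  imports "HOL-Analysis.Analysis"
begin

text \<open>
  Elements of \<open>L\<^sup>2(\<real>)\<close> are represented by Borel functions \<open>real \<Rightarrow> complex\<close> (every a.e.-class has a
  Borel representative), and equality of such elements is equality almost everywhere.
\<close>

definition L2 :: "(real \<Rightarrow> complex) set" where
  "L2 = {f \<in> borel_measurable lborel. integrable lborel (\<lambda>x. (cmod (f x))\<^sup>2)}"

definition L2_norm :: "(real \<Rightarrow> complex) \<Rightarrow> real" where
  "L2_norm f = sqrt (LINT x|lborel. (cmod (f x))\<^sup>2)"

text \<open>
  The membership conditions are needed because \<^const>\<open>L2_norm\<close> takes the value \<open>0\<close> outside
  \<^const>\<open>L2\<close>.
\<close>

definition tendsto_L2 :: "('a \<Rightarrow> real \<Rightarrow> complex) \<Rightarrow> (real \<Rightarrow> complex) \<Rightarrow> 'a filter \<Rightarrow> bool" where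
  "tendsto_L2 f g F \<longleftrightarrow> g \<in> L2 \<and> (\<forall>\<^sub>F a in F. f a \<in> L2) \<and>
     ((\<lambda>a. L2_norm (\<lambda>x. f a x - g x)) \<longlongrightarrow> 0) F"

text \<open>The Fourier integral, meaningful pointwise for integrable functions.\<close>

definition fourier :: "(real \<Rightarrow> complex) \<Rightarrow> real \<Rightarrow> complex" where
  "fourier f \<xi> = of_real (1 / sqrt (2 * pi)) *
     (LINT x|lborel. exp (- \<i> * of_real x * of_real \<xi>) * f x)"

text \<open>
  \<open>g\<close> is the Fourier--Plancherel transform of \<open>f\<close>: the limit in \<open>L\<^sup>2\<close> of the Fourier integrals of
  the truncations of \<open>f\<close> to \<open>[-R, R]\<close>.
\<close>

definition is_fourier_L2 :: "(real \<Rightarrow> complex) \<Rightarrow> (real \<Rightarrow> complex) \<Rightarrow> bool" where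
  "is_fourier_L2 f g \<longleftrightarrow> f \<in> L2 \<and>
     tendsto_L2 (\<lambda>R::real. fourier (\<lambda>x. indicator {-R..R} x * f x)) g at_top"

text \<open>
  \<open>g = m(D) f\<close> in \<open>L\<^sup>2\<close>, for the Fourier multiplier with symbol \<open>m\<close>. For a given \<open>f\<close>, such a
  \<open>g\<close> is unique up to null sets, and it exists iff \<open>m\<close> times the transform of \<open>f\<close> lies in \<open>L\<^sup>2\<close>.
\<close>

definition is_multiplier :: "(real \<Rightarrow> complex) \<Rightarrow> (real \<Rightarrow> complex) \<Rightarrow> (real \<Rightarrow> complex) \<Rightarrow> bool" where
  "is_multiplier m f g \<longleftrightarrow> (\<exists>F G. is_fourier_L2 f F \<and> is_fourier_L2 g G \<and>
     (AE \<xi> in lborel. G \<xi> = m \<xi> * F \<xi>))"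

definition multiplier :: "(real \<Rightarrow> complex) \<Rightarrow> (real \<Rightarrow> complex) \<Rightarrow> real \<Rightarrow> complex" where
  "multiplier m f = (SOME g. is_multiplier m f g)"

text \<open>Symbol of \<open>(1 - \<partial>\<^sub>x\<^sup>2)\<^bsup>s/2\<^esup>\<close>.\<close>

definition bessel_symbol :: "real \<Rightarrow> real \<Rightarrow> complex" where
  "bessel_symbol s \<xi> = of_real ((1 + \<xi>\<^sup>2) powr (s / 2))"

definition weight :: "real \<Rightarrow> (real \<Rightarrow> complex) \<Rightarrow> real \<Rightarrow> complex" where
  "weight \<sigma> f x = of_real ((1 + x\<^sup>2) powr (\<sigma> / 2)) * f x"

text \<open>
  The weighted Sobolev space of order \<open>(s, \<sigma>)\<close>. Realising it inside \<^const>\<open>L2\<close> (instead of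
  the tempered distributions) loses nothing provided \<open>s \<ge> 0\<close> and \<open>\<sigma> \<ge> 0\<close>; it is only meant
  for such orders.
\<close>

definition sobolev :: "real \<Rightarrow> real \<Rightarrow> (real \<Rightarrow> complex) set" where
  "sobolev s \<sigma> = {f. \<exists>g. is_multiplier (bessel_symbol s) f g \<and> weight \<sigma> g \<in> L2}"

definition sobolev_norm :: "real \<Rightarrow> real \<Rightarrow> (real \<Rightarrow> complex) \<Rightarrow> real" where
  "sobolev_norm s \<sigma> f = L2_norm (weight \<sigma> (multiplier (bessel_symbol s) f))"

text \<open>\<open>\<partial>\<^sub>x\<^sup>2\<close>, on functions in \<open>H\<^sup>2\<close>.\<close>

definition dxx :: "(real \<Rightarrow> complex) \<Rightarrow> real \<Rightarrow> complex" where
  "dxx = multiplier (\<lambda>\<xi>. - of_real (\<xi>\<^sup>2))"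

text \<open>The free group \<open>exp (i t/2 \<partial>\<^sub>x\<^sup>2)\<close> on \<open>L\<^sup>2\<close>.\<close>

definition schroedinger :: "real \<Rightarrow> (real \<Rightarrow> complex) \<Rightarrow> real \<Rightarrow> complex" where
  "schroedinger t = multiplier (\<lambda>\<xi>. exp (- \<i> * of_real (t / 2) * of_real (\<xi>\<^sup>2)))"

text \<open>Continuity \<open>[0, \<infinity>) \<rightarrow> H\<^sup>2 \<inter> H\<^bsup>1,1\<^esup>\<close>; the values of \<open>u\<close> at negative times are irrelevant.\<close>

definition continuous_H2_H11 :: "(real \<Rightarrow> real \<Rightarrow> complex) \<Rightarrow> bool" where
  "continuous_H2_H11 u \<longleftrightarrow>
     (\<forall>t\<ge>0. u t \<in> sobolev 2 0 \<inter> sobolev 1 1) \<and>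
     (\<forall>t\<ge>0. ((\<lambda>\<tau>. sobolev_norm 2 0 (\<lambda>x. u \<tau> x - u t x) + sobolev_norm 1 1 (\<lambda>x. u \<tau> x - u t x))
        \<longlongrightarrow> 0) (at t within {0..}))"

definition has_L2_derivative ::
    "(real \<Rightarrow> real \<Rightarrow> complex) \<Rightarrow> (real \<Rightarrow> complex) \<Rightarrow> real \<Rightarrow> bool" where
  "has_L2_derivative u v t \<longleftrightarrow> tendsto_L2 (\<lambda>h x. (u (t + h) x - u t x) / of_real h) v (at 0)"

text \<open>
  The equation \<open>i \<partial>\<^sub>t u + 1/2 \<partial>\<^sub>x\<^sup>2 u = - i |v|\<^sup>2 u\<close> on \<open>(0, \<infinity>) \<times> \<real>\<close>, as an identity in
  \<open>L\<^sup>2\<close> for every \<open>t > 0\<close>. For functions continuous with values in \<open>H\<^sup>2\<close> this is equivalent to the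
  equation in the sense of distributions, since then \<open>\<partial>\<^sub>x\<^sup>2 u\<close> and the right-hand side are
  continuous in time with values in \<open>L\<^sup>2\<close>.
\<close>

definition solves_equation ::
    "(real \<Rightarrow> real \<Rightarrow> complex) \<Rightarrow> (real \<Rightarrow> real \<Rightarrow> complex) \<Rightarrow> bool" where
  "solves_equation u v \<longleftrightarrow> (\<forall>t>0. \<exists>du. has_L2_derivative u du t \<and>
     (AE x in lborel. \<i> * du x + 1 / 2 * dxx (u t) x
        = - \<i> * of_real ((cmod (v t x))\<^sup>2) * u t x))"

definition global_solution ::
    "(real \<Rightarrow> complex) \<Rightarrow> (real \<Rightarrow> complex) \<Rightarrow>
     (real \<Rightarrow> real \<Rightarrow> complex) \<Rightarrow> (real \<Rightarrow> real \<Rightarrow> complex) \<Rightarrow> bool" where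
  "global_solution \<phi>1 \<phi>2 u1 u2 \<longleftrightarrow>
     continuous_H2_H11 u1 \<and> continuous_H2_H11 u2 \<and>
     solves_equation u1 u2 \<and> solves_equation u2 u1 \<and>
     (AE x in lborel. u1 0 x = \<phi>1 x) \<and> (AE x in lborel. u2 0 x = \<phi>2 x)"

definition scattering_state :: "(real \<Rightarrow> real \<Rightarrow> complex) \<Rightarrow> (real \<Rightarrow> complex) \<Rightarrow> bool" where
  "scattering_state u \<phi> \<longleftrightarrow> tendsto_L2 (\<lambda>t. schroedinger (- t) (u t)) \<phi> at_top"

end

theory Submission
  imports Defs "HOL-Probability.Sinc_Integral" "HOL-Probability.Characteristic_Functions"
begin

text \<open>
  Write \<open>\<alpha>\<^sub>j(t, \<xi>)\<close> for the Fourier transform of \<open>\<U>(-t) u\<^sub>j(t)\<close>. The factorisation of \<open>\<U>(t)\<close> turns the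
  system into \<open>\<partial>\<^sub>t \<alpha>\<^sub>1 = - |\<alpha>\<^sub>2|\<^sup>2 \<alpha>\<^sub>1 / t + R\<^sub>1 / t\<close> and symmetrically for \<open>\<alpha>\<^sub>2\<close>, with
  \<open>R\<^sub>j = O(\<epsilon>\<^sup>3 t powr (- 1/8))\<close>. The leading terms cancel in \<open>|\<alpha>\<^sub>1|\<^sup>2 - |\<alpha>\<^sub>2|\<^sup>2\<close>, whose integral over
  an interval therefore changes by \<open>O(\<epsilon>\<^sup>4)\<close> only, whereas initially it has size \<open>\<epsilon>\<^sup>2\<close> near \<open>\<xi>\<^sup>*\<close>; so
  \<open>\<alpha>\<^sub>1\<close> cannot tend to \<open>0\<close> in \<open>L\<^sup>2\<close>.

  The bound on \<open>R\<^sub>j\<close> needs slow growth of \<open>\<xi> \<alpha>\<^sub>j\<close> and \<open>\<partial>\<^sub>\<xi> \<alpha>\<^sub>j\<close> in \<open>L\<^sup>2\<close>. To avoid differentiating the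
  equation, one estimates the \<open>L\<^sup>2\<close> distance of the solution to its translates and Galilean boosts,
  which solve the same system; a bootstrap on \<open>sup |u\<^sub>j(t)| = O(\<epsilon> (1 + t) powr (- 1/2))\<close> closes the
  argument.
\<close>

section \<open>The space of square integrable functions\<close>

text \<open>The profile equation holds for derivatives in L2, so at a fixed frequency there is no
  ordinary differential equation in \<open>t\<close>. Integrals of
  \<open>|\<alpha>\<^sub>j|\<^sup>2\<close> over intervals take its place: they are differentiable
  in time, and the leading term only decreases them. Bounds for the averages over all intervals give
  a pointwise bound for a continuous representative. This bound does not grow in time, and it is
  what improves the sup bound in the bootstrap; the moments alone would lose a power of
  \<open>t\<close>. The exponents have two sources. Dropping the chirp from a function with a first
  moment costs \<open>t powr (- 1/4)\<close>, by Cauchy-Schwarz against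
  \<open>(chirp s x - 1) / x\<close> at \<open>s = 1 / t\<close>. The moments grow at most like
  \<open>(1 + t) powr (1/32)\<close> and enter four times in the rate of a local mass, which leaves
  \<open>t powr (- 1/8)\<close>; divided by \<open>t\<close> this is integrable at infinity. The
  factor \<open>1 / t\<close> is not integrable at \<open>0\<close>, so before time \<open>1\<close>
  the rate is bounded directly, without splitting off a leading term.\<close>

definition L2_inner :: "(real \<Rightarrow> complex) \<Rightarrow> (real \<Rightarrow> complex) \<Rightarrow> complex" where
  "L2_inner f g = (LINT x|lborel. cnj (f x) * g x)"

lemma measurable_cnj [measurable]: "cnj \<in> borel_measurable borel"
  by (intro borel_measurable_continuous_onI continuous_intros)

lemma L2_measurable: "f \<in> L2 \<Longrightarrow> f \<in> borel_measurable borel"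
  by (simp add: L2_def)

lemma L2_integrable: "f \<in> L2 \<Longrightarrow> integrable lborel (\<lambda>x. (cmod (f x))\<^sup>2)"
  by (simp add: L2_def)

lemma L2_norm_power2: "(L2_norm f)\<^sup>2 = (LINT x|lborel. (cmod (f x))\<^sup>2)"
  by (simp add: L2_norm_def)

lemma L2_norm_nonneg [simp]: "0 \<le> L2_norm f"
  by (simp add: L2_norm_def)

lemma L2_dominated:
  assumes g: "g \<in> L2" and f [measurable]: "f \<in> borel_measurable borel"
    and le: "AE x in lborel. cmod (f x) \<le> C * cmod (g x)" and C: "0 \<le> C"
  shows "f \<in> L2" and "L2_norm f \<le> C * L2_norm g"
proof -
  have le': "AE x in lborel. (cmod (f x))\<^sup>2 \<le> C\<^sup>2 * (cmod (g x))\<^sup>2"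
    using le by eventually_elim (metis norm_ge_zero power_mono power_mult_distrib)
  have int: "integrable lborel (\<lambda>x. (cmod (f x))\<^sup>2)"
    by (rule Bochner_Integration.integrable_bound[OF integrable_mult_right[OF L2_integrable[OF g], of "C\<^sup>2"]])
      (use le' in \<open>auto elim!: eventually_mono\<close>)
  then show "f \<in> L2"
    by (simp add: L2_def)
  have "(LINT x|lborel. (cmod (f x))\<^sup>2) \<le> (LINT x|lborel. C\<^sup>2 * (cmod (g x))\<^sup>2)"
    by (rule integral_mono_AE[OF int _ le']) (use L2_integrable[OF g] in simp)
  then have "(L2_norm f)\<^sup>2 \<le> (C * L2_norm g)\<^sup>2"
    by (simp add: L2_norm_power2 power_mult_distrib)
  then show "L2_norm f \<le> C * L2_norm g"
    by (rule power2_le_imp_le) (simp add: C)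
qed

lemma L2_cong_AE:
  assumes "g \<in> L2" "f \<in> borel_measurable borel" "AE x in lborel. f x = g x"
  shows "f \<in> L2" and "L2_norm f = L2_norm g"
proof -
  show f: "f \<in> L2"
    by (rule L2_dominated(1)[OF assms(1,2), of 1]) (use assms(3) in \<open>auto elim!: eventually_mono\<close>)
  have "L2_norm f \<le> 1 * L2_norm g"
    by (rule L2_dominated(2)[OF assms(1,2), of 1]) (use assms(3) in \<open>auto elim!: eventually_mono\<close>)
  moreover have "L2_norm g \<le> 1 * L2_norm f"
    by (rule L2_dominated(2)[OF f, of g 1])
      (use assms in \<open>auto elim!: eventually_mono simp: L2_def\<close>)
  ultimately show "L2_norm f = L2_norm g" by simp
qed

lemma L2_norm_cong_AE:
  assumes "AE x in lborel. f x = g x" and [measurable]: "f \<in> borel_measurable borel"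
    "g \<in> borel_measurable borel"
  shows "L2_norm f = L2_norm g"
proof -
  have "(LINT x|lborel. (cmod (f x))\<^sup>2) = (LINT x|lborel. (cmod (g x))\<^sup>2)"
  proof (rule integral_cong_AE)
    show "AE x in lborel. (cmod (f x))\<^sup>2 = (cmod (g x))\<^sup>2"
      using assms(1) by eventually_elim simp
  qed measurable
  then show ?thesis by (simp add: L2_norm_def)
qed

lemma L2_cmult:
  assumes "f \<in> L2" shows "(\<lambda>x. c * f x) \<in> L2"
proof -
  note [measurable] = assms[THEN L2_measurable]
  have "(\<lambda>x. (cmod (c * f x))\<^sup>2) = (\<lambda>x. (cmod c)\<^sup>2 * (cmod (f x))\<^sup>2)"
    by (simp add: norm_mult power_mult_distrib)
  then have "integrable lborel (\<lambda>x. (cmod (c * f x))\<^sup>2)"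
    using L2_integrable[OF assms] by simp
  then show ?thesis by (simp add: L2_def)
qed

lemma L2_norm_cmult: "L2_norm (\<lambda>x. c * f x) = cmod c * L2_norm f"
  unfolding L2_norm_def by (simp add: norm_mult power_mult_distrib real_sqrt_mult)

lemma L2_add:
  assumes "f \<in> L2" "g \<in> L2" shows "(\<lambda>x. f x + g x) \<in> L2"
proof -
  note [measurable] = assms[THEN L2_measurable]
  have "(cmod (f x + g x))\<^sup>2 \<le> 2 * (cmod (f x))\<^sup>2 + 2 * (cmod (g x))\<^sup>2" for x
  proof -
    have "(cmod (f x + g x))\<^sup>2 \<le> (cmod (f x) + cmod (g x))\<^sup>2"
      by (intro power_mono norm_triangle_ineq) auto
    then show ?thesis
      using sum_squares_bound[of "cmod (f x)" "cmod (g x)"] by (simp add: power2_sum)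
  qed
  note le = this
  have int: "integrable lborel (\<lambda>x. 2 * (cmod (f x))\<^sup>2 + 2 * (cmod (g x))\<^sup>2)"
    using assms[THEN L2_integrable] by simp
  have "integrable lborel (\<lambda>x. (cmod (f x + g x))\<^sup>2)"
    by (rule Bochner_Integration.integrable_bound[OF int]) (use le in simp_all)
  then show ?thesis by (simp add: L2_def)
qed

lemma L2_diff: "f \<in> L2 \<Longrightarrow> g \<in> L2 \<Longrightarrow> (\<lambda>x. f x - g x) \<in> L2"
  using L2_add[of f "\<lambda>x. - 1 * g x"] L2_cmult[of g "-1"] by simp

lemma L2_mult_integrable:
  assumes "f \<in> L2" "g \<in> L2"
  shows "integrable lborel (\<lambda>x. f x * g x)" and "integrable lborel (\<lambda>x. cmod (f x) * cmod (g x))"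
    and "integrable lborel (\<lambda>x. cnj (f x) * g x)"
proof -
  note [measurable] = assms[THEN L2_measurable]
  have le: "cmod (f x) * cmod (g x) \<le> (cmod (f x))\<^sup>2 + (cmod (g x))\<^sup>2" for x
    using sum_squares_bound[of "cmod (f x)" "cmod (g x)"] mult_nonneg_nonneg[OF norm_ge_zero norm_ge_zero, of "f x" "g x"]
    by linarith
  have int: "integrable lborel (\<lambda>x. (cmod (f x))\<^sup>2 + (cmod (g x))\<^sup>2)"
    using assms[THEN L2_integrable] by simp
  show "integrable lborel (\<lambda>x. f x * g x)" "integrable lborel (\<lambda>x. cmod (f x) * cmod (g x))"
    "integrable lborel (\<lambda>x. cnj (f x) * g x)"
    by (rule Bochner_Integration.integrable_bound[OF int]; use le in \<open>simp add: norm_mult\<close>)+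
qed

text \<open>The integral of \<open>(s * cmod (f x) - cmod (g x))\<^sup>2\<close> is a nonnegative
  quadratic in \<open>s\<close>; evaluating it at its minimiser \<open>c / a\<close> gives the
  inequality.\<close>

lemma L2_Cauchy_Schwarz_abs:
  assumes "f \<in> L2" "g \<in> L2"
  shows "(LINT x|lborel. cmod (f x) * cmod (g x)) \<le> L2_norm f * L2_norm g"
proof -
  note [measurable] = assms[THEN L2_measurable]
  define a b c where "a = (L2_norm f)\<^sup>2" and "b = (L2_norm g)\<^sup>2"
    and "c = (LINT x|lborel. cmod (f x) * cmod (g x))"
  note ints = assms[THEN L2_integrable] L2_mult_integrable(2)[OF assms]
  have q: "0 \<le> s\<^sup>2 * a - 2 * s * c + b" for s :: real
  proof -
    have "0 \<le> (LINT x|lborel. (s * cmod (f x) - cmod (g x))\<^sup>2)" by simp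
    also have "\<dots> = (LINT x|lborel. s\<^sup>2 * (cmod (f x))\<^sup>2 - 2 * s * (cmod (f x) * cmod (g x)) + (cmod (g x))\<^sup>2)"
      by (intro Bochner_Integration.integral_cong) (auto simp: power2_eq_square algebra_simps)
    also have "\<dots> = s\<^sup>2 * a - 2 * s * c + b"
      using ints by (simp add: a_def b_def c_def L2_norm_power2)
    finally show ?thesis .
  qed
  have c0: "0 \<le> c" by (simp add: c_def)
  have "c\<^sup>2 \<le> a * b"
  proof (cases "a = 0")
    case True
    have "c = 0"
    proof (rule ccontr)
      assume "c \<noteq> 0"
      \<comment> \<open>For \<open>a = 0\<close> the quadratic is affine in \<open>s\<close>, and
        this \<open>s\<close> gives it the value \<open>- 1\<close>.\<close>
      then show False using q[of "(b + 1) / (2 * c)"] True by (simp add: field_simps)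
    qed
    then show ?thesis by (simp add: True)
  next
    case False
    then have "a > 0" by (simp add: a_def)
    then show ?thesis using q[of "c / a"] by (simp add: field_simps power2_eq_square)
  qed
  then have "c\<^sup>2 \<le> (L2_norm f * L2_norm g)\<^sup>2" by (simp add: a_def b_def power_mult_distrib)
  then show ?thesis unfolding c_def by (rule power2_le_imp_le) simp
qed

lemma L2_Cauchy_Schwarz:
  assumes "f \<in> L2" "g \<in> L2"
  shows "cmod (L2_inner f g) \<le> L2_norm f * L2_norm g"
proof -
  have "cmod (L2_inner f g) \<le> (LINT x|lborel. cmod (cnj (f x) * g x))"
    unfolding L2_inner_def by (rule integral_norm_bound)
  also have "\<dots> \<le> L2_norm f * L2_norm g"
    using L2_Cauchy_Schwarz_abs[OF assms] by (simp add: norm_mult)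
  finally show ?thesis .
qed

lemma L2_inner_self: "L2_inner f f = of_real ((L2_norm f)\<^sup>2)"
  unfolding L2_inner_def L2_norm_power2
  by (subst integral_complex_of_real[symmetric])
    (simp add: complex_norm_square mult.commute flip: of_real_power)

lemma L2_norm_add_power2:
  assumes "f \<in> L2" "g \<in> L2"
  shows "(L2_norm (\<lambda>x. f x + g x))\<^sup>2 = (L2_norm f)\<^sup>2 + 2 * Re (L2_inner f g) + (L2_norm g)\<^sup>2"
proof -
  note [measurable] = assms[THEN L2_measurable]
  note ints = assms[THEN L2_integrable] L2_mult_integrable(2,3)[OF assms]
  have "(L2_norm (\<lambda>x. f x + g x))\<^sup>2
      = (LINT x|lborel. (cmod (f x))\<^sup>2 + 2 * Re (cnj (f x) * g x) + (cmod (g x))\<^sup>2)"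
    unfolding L2_norm_power2
    by (intro Bochner_Integration.integral_cong) (simp_all only: cmod_power2, simp_all add: algebra_simps power2_eq_square)
  also have "\<dots> = (L2_norm f)\<^sup>2 + 2 * (LINT x|lborel. Re (cnj (f x) * g x)) + (L2_norm g)\<^sup>2"
    unfolding L2_norm_power2 using ints(1,2) integrable_Re[OF ints(4)]
    by (simp del: times_complex.sel)
  also have "(LINT x|lborel. Re (cnj (f x) * g x)) = Re (L2_inner f g)"
    unfolding L2_inner_def by (rule integral_Re[OF ints(4)])
  finally show ?thesis .
qed

lemma L2_norm_diff_power2:
  assumes "f \<in> L2" "g \<in> L2"
  shows "(L2_norm (\<lambda>x. f x - g x))\<^sup>2 = (L2_norm f)\<^sup>2 - 2 * Re (L2_inner f g) + (L2_norm g)\<^sup>2"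
  using L2_norm_add_power2[OF assms(1) L2_cmult[OF assms(2), of "-1"]] L2_norm_cmult[of "-1" g]
  by (simp add: L2_inner_def)

lemma L2_norm_triangle:
  assumes "f \<in> L2" "g \<in> L2"
  shows "L2_norm (\<lambda>x. f x + g x) \<le> L2_norm f + L2_norm g"
proof (rule power2_le_imp_le)
  have "Re (L2_inner f g) \<le> L2_norm f * L2_norm g"
    using L2_Cauchy_Schwarz[OF assms] complex_Re_le_cmod order_trans by blast
  then show "(L2_norm (\<lambda>x. f x + g x))\<^sup>2 \<le> (L2_norm f + L2_norm g)\<^sup>2"
    by (simp add: L2_norm_add_power2[OF assms] power2_sum)
qed simp

lemma L2_norm_uminus [simp]: "L2_norm (\<lambda>x. - f x) = L2_norm f"
  by (simp add: L2_norm_def)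

lemma L2_norm_minus_commute: "L2_norm (\<lambda>x. f x - g x) = L2_norm (\<lambda>x. g x - f x)"
  by (simp add: L2_norm_def norm_minus_commute)

lemma L2_norm_diff_le:
  assumes "f \<in> L2" "g \<in> L2"
  shows "\<bar>L2_norm f - L2_norm g\<bar> \<le> L2_norm (\<lambda>x. f x - g x)"
proof -
  have "L2_norm f \<le> L2_norm (\<lambda>x. f x - g x) + L2_norm g"
    using L2_norm_triangle[of "\<lambda>x. f x - g x" g] assms L2_diff by simp
  moreover have "L2_norm g \<le> L2_norm (\<lambda>x. f x - g x) + L2_norm f"
    using L2_norm_triangle[of "\<lambda>x. g x - f x" f] assms L2_diff
    by (simp add: L2_norm_minus_commute[of f g])
  ultimately show ?thesis by linarith
qed

lemma L2_norm_eq_0: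
  assumes "f \<in> L2" "L2_norm f = 0"
  shows "AE x in lborel. f x = 0"
proof -
  have "(LINT x|lborel. (cmod (f x))\<^sup>2) = 0"
    using assms(2) L2_norm_power2[of f] by simp
  then have "AE x in lborel. (cmod (f x))\<^sup>2 = 0"
    using integral_nonneg_eq_0_iff_AE[OF L2_integrable[OF assms(1)]] by simp
  then show ?thesis by simp
qed

lemma L2_translate:
  assumes "f \<in> L2"
  shows "(\<lambda>x. f (x + c)) \<in> L2" and "L2_norm (\<lambda>x. f (x + c)) = L2_norm f"
  using measurable_compose[OF _ L2_measurable[OF assms], of "\<lambda>x. x + c" borel] lborel_integrable_real_affine[OF L2_integrable[OF assms], of 1 c]
    lborel_integral_real_affine[of 1 "\<lambda>x. (cmod (f x))\<^sup>2" c] assms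
  by (auto simp: L2_def L2_norm_def add.commute)

lemma L2_reflect:
  assumes "f \<in> L2"
  shows "(\<lambda>x. f (- x)) \<in> L2" and "L2_norm (\<lambda>x. f (- x)) = L2_norm f"
  using measurable_compose[OF _ L2_measurable[OF assms], of uminus borel] lborel_integrable_real_affine[OF L2_integrable[OF assms], of "-1" 0]
    lborel_integral_real_affine[of "-1" "\<lambda>x. (cmod (f x))\<^sup>2" 0] assms
  by (auto simp: L2_def L2_norm_def)

lemma L2_integrable_bounded:
  assumes f: "integrable lborel f" and C: "\<And>x. cmod (f x) \<le> C"
  shows "f \<in> L2"
proof -
  have [measurable]: "f \<in> borel_measurable borel" using f by auto
  have "integrable lborel (\<lambda>x. (cmod (f x))\<^sup>2)"
    by (rule Bochner_Integration.integrable_bound[OF integrable_mult_right[OF integrable_norm[OF f], of C]])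
      (auto simp: power2_eq_square abs_mult intro!: mult_right_mono order_trans[OF C abs_ge_self])
  then show ?thesis by (simp add: L2_def)
qed

lemma L2_norm_dominated_convergence_seq:
  fixes F :: "nat \<Rightarrow> real \<Rightarrow> complex"
  assumes [measurable]: "\<And>n. F n \<in> borel_measurable borel" and w: "w \<in> L2"
    and le: "\<And>n. AE x in lborel. cmod (F n x) \<le> cmod (w x)"
    and lim: "AE x in lborel. (\<lambda>n. F n x) \<longlonglongrightarrow> 0"
  shows "(\<lambda>n. L2_norm (F n)) \<longlonglongrightarrow> 0"
proof -
  have "(\<lambda>n. LINT x|lborel. (cmod (F n x))\<^sup>2) \<longlonglongrightarrow> (LINT x::real|lborel. 0)"
  proof (rule integral_dominated_convergence[where w="\<lambda>x. (cmod (w x))\<^sup>2"])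
    show "AE x in lborel. (\<lambda>n. (cmod (F n x))\<^sup>2) \<longlonglongrightarrow> 0"
      using lim by eventually_elim (auto intro!: tendsto_eq_intros)
    show "AE x in lborel. norm ((cmod (F n x))\<^sup>2) \<le> (cmod (w x))\<^sup>2" for n
      using le[of n] by eventually_elim auto
  qed (use L2_integrable[OF w] in auto)
  then have "(\<lambda>n. sqrt (LINT x|lborel. (cmod (F n x))\<^sup>2)) \<longlonglongrightarrow> sqrt 0"
    by (intro tendsto_real_sqrt) simp
  then show ?thesis by (simp add: L2_norm_def)
qed

lemma L2_norm_dominated_convergence_at:
  fixes F :: "real \<Rightarrow> real \<Rightarrow> complex"
  assumes "\<And>h. F h \<in> borel_measurable borel" and "w \<in> L2"
    and "\<And>h. h \<noteq> a \<Longrightarrow> AE x in lborel. cmod (F h x) \<le> cmod (w x)"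
    and lim: "AE x in lborel. ((\<lambda>h. F h x) \<longlongrightarrow> 0) (at a)"
  shows "((\<lambda>h. L2_norm (F h)) \<longlongrightarrow> 0) (at a)"
  unfolding tendsto_at_iff_sequentially
proof (intro allI impI)
  fix X :: "nat \<Rightarrow> real"
  assume X: "\<forall>i. X i \<in> UNIV - {a}" "X \<longlonglongrightarrow> a"
  have "(\<lambda>n. L2_norm (F (X n))) \<longlonglongrightarrow> 0"
  proof (rule L2_norm_dominated_convergence_seq[of _ w])
    show "AE x in lborel. (\<lambda>n. F (X n) x) \<longlonglongrightarrow> 0"
      using lim
    proof eventually_elim
      case (elim x)
      then show ?case
        using X unfolding tendsto_at_iff_sequentially comp_def by blast
    qed
  qed (use assms X in auto)
  then show "((\<lambda>h. L2_norm (F h)) \<circ> X) \<longlonglongrightarrow> 0"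
    by (simp add: comp_def)
qed

lemma L2_norm_dominated_convergence_at_top:
  fixes F :: "real \<Rightarrow> real \<Rightarrow> complex"
  assumes [measurable]: "\<And>h. F h \<in> borel_measurable borel" and w: "w \<in> L2"
    and le: "\<And>h. AE x in lborel. cmod (F h x) \<le> cmod (w x)"
    and lim: "AE x in lborel. ((\<lambda>h. F h x) \<longlongrightarrow> 0) at_top"
  shows "((\<lambda>h. L2_norm (F h)) \<longlongrightarrow> 0) at_top"
proof -
  have "((\<lambda>h. LINT x|lborel. (cmod (F h x))\<^sup>2) \<longlongrightarrow> (LINT x::real|lborel. 0)) at_top"
  proof (rule integral_dominated_convergence_at_top[where w="\<lambda>x. (cmod (w x))\<^sup>2"])
    show "AE x in lborel. ((\<lambda>n. (cmod (F n x))\<^sup>2) \<longlongrightarrow> 0) at_top"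
      using lim by eventually_elim (auto intro!: tendsto_eq_intros)
    show "\<forall>\<^sub>F n in at_top. AE x in lborel. norm ((cmod (F n x))\<^sup>2) \<le> (cmod (w x))\<^sup>2"
      using le by (auto elim!: eventually_mono)
  qed (use L2_integrable[OF w] in auto)
  then have "((\<lambda>n. sqrt (LINT x|lborel. (cmod (F n x))\<^sup>2)) \<longlongrightarrow> sqrt 0) at_top"
    by (intro tendsto_real_sqrt) simp
  then show ?thesis by (simp add: L2_norm_def)
qed

lemma tendsto_L2_norm:
  assumes "((\<lambda>a. L2_norm (\<lambda>x. f a x - g x)) \<longlongrightarrow> 0) F" "\<forall>\<^sub>F a in F. f a \<in> L2" "g \<in> L2"
  shows "((\<lambda>a. L2_norm (f a)) \<longlongrightarrow> L2_norm g) F"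
proof -
  have "((\<lambda>a. L2_norm (f a) - L2_norm g) \<longlongrightarrow> 0) F"
  proof (rule Lim_null_comparison[OF _ assms(1)])
    show "\<forall>\<^sub>F a in F. norm (L2_norm (f a) - L2_norm g) \<le> L2_norm (\<lambda>x. f a x - g x)"
      using assms(2) by eventually_elim (use L2_norm_diff_le[OF _ assms(3)] in auto)
  qed
  then show ?thesis by (simp add: LIM_zero_cancel)
qed

section \<open>Weighted square integrable functions are integrable\<close>

lemma inverse_sqrt_weight_L2: "(\<lambda>x. of_real (1 / sqrt (1 + x\<^sup>2))) \<in> L2"
proof -
  have "integrable lborel (\<lambda>x::real. inverse (1 + x\<^sup>2))"
    using integrable_inverse_1_plus_square by (simp add: set_integrable_def einterval_def)
  moreover have "(cmod (of_real (1 / sqrt (1 + x\<^sup>2))))\<^sup>2 = inverse (1 + x\<^sup>2)" for x :: real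
    by (simp add: norm_divide power_divide inverse_eq_divide add_nonneg_nonneg)
  ultimately show ?thesis by (simp add: L2_def)
qed

text \<open>Its value is the square root of pi, since \<open>1 / (1 + x\<^sup>2)\<close> has
  integral pi; it is the Cauchy-Schwarz constant in the embedding of weighted L2 into L1.\<close>

definition weight_const :: real where
  "weight_const = L2_norm (\<lambda>x. of_real (1 / sqrt (1 + x\<^sup>2)))"

lemma weight_const_nonneg: "0 \<le> weight_const" by (simp add: weight_const_def)

text \<open>\<open>(1 + t) powr (1 / 32)\<close> is the growth factor of the moments in the
  bootstrap; up to time \<open>1\<close> it is absorbed into a constant.\<close>

lemma powr_small: fixes t :: real assumes t: "0 \<le> t" "t \<le> 1" shows "(1 + t) powr (1 / 32) \<le> 2"
proof -
  have "(1 + t) powr (1 / 32) \<le> 2 powr (1 / 32)" using t by (intro powr_mono2) auto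
  also have "\<dots> \<le> 2 powr 1" by (intro powr_mono) auto
  finally show ?thesis by simp
qed

text \<open>From time \<open>1\<close> on the growth factor is traded for a pure power of
  \<open>t\<close>, which can be combined with the decay \<open>t powr (- 1 / 4)\<close>.\<close>

lemma powr_large: fixes t :: real assumes t: "1 \<le> t" shows "((1 + t) powr (1 / 32)) ^ k \<le> 2 ^ k * t powr (k / 32)"
proof -
  have "(1 + t) powr (1 / 32) \<le> (2 * t) powr (1 / 32)" using t by (intro powr_mono2) auto
  also have "\<dots> = 2 powr (1 / 32) * t powr (1 / 32)" using t by (simp add: powr_mult)
  also have "\<dots> \<le> 2 * t powr (1 / 32)" using powr_mono[of "1 / 32" 1 "2 :: real"] by (intro mult_right_mono) auto
  finally have "((1 + t) powr (1 / 32)) ^ k \<le> (2 * t powr (1 / 32)) ^ k" by (intro power_mono) auto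
  also have "\<dots> = 2 ^ k * t powr (k / 32)" using t by (simp add: power_mult_distrib powr_power mult.commute)
  finally show ?thesis .
qed

text \<open>Cauchy-Schwarz against \<open>1 / sqrt (1 + x\<^sup>2)\<close>, using
  \<open>sqrt (1 + x\<^sup>2) \<le> 1 + \<bar>x\<bar>\<close>. Applied on either side of the Fourier
  transform, it turns moment bounds into sup bounds.\<close>

lemma weighted_L2_imp_L1:
  assumes f: "f \<in> L2" and xf: "(\<lambda>x. of_real x * f x) \<in> L2"
  shows "integrable lborel f"
    and "(LINT x|lborel. cmod (f x)) \<le> weight_const * (L2_norm f + L2_norm (\<lambda>x. of_real x * f x))"
proof -
  have [measurable]: "f \<in> borel_measurable borel" using f by (simp add: L2_def)
  define g where "g = (\<lambda>x. cmod (f x) + cmod (of_real x * f x))"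
  \<comment> \<open>Adding moduli avoids cancellation, so \<open>cmod (G x)\<close> is exactly
    \<open>(1 + \<bar>x\<bar>) * cmod (f x)\<close>, while the triangle inequality in L2 still
    bounds the norm.\<close>
  define G :: "real \<Rightarrow> complex" where "G = (\<lambda>x. of_real (cmod (f x)) + of_real (cmod (of_real x * f x)))"
  have a: "(\<lambda>x. of_real (cmod (f x)) :: complex) \<in> L2" "(\<lambda>x. of_real (cmod (of_real x * f x)) :: complex) \<in> L2"
    "L2_norm (\<lambda>x. of_real (cmod (f x)) :: complex) = L2_norm f"
    "L2_norm (\<lambda>x. of_real (cmod (of_real x * f x)) :: complex) = L2_norm (\<lambda>x. of_real x * f x)"
    using f xf by (auto simp: L2_def L2_norm_def)
  have G: "G \<in> L2" unfolding G_def by (rule L2_add) fact+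
  have GN: "L2_norm G \<le> L2_norm f + L2_norm (\<lambda>x. of_real x * f x)"
    using L2_norm_triangle[OF a(1,2)] a(3,4) by (simp add: G_def)
  let ?w = "\<lambda>x. of_real (1 / sqrt (1 + x\<^sup>2)) :: complex"
  have le: "cmod (f x) \<le> cmod (?w x) * cmod (G x)" for x
  proof -
    have s: "sqrt (1 + x\<^sup>2) \<le> 1 + \<bar>x\<bar>"
      by (rule real_le_lsqrt) (auto simp: power2_sum)
    have "cmod (G x) = (1 + \<bar>x\<bar>) * cmod (f x)"
      unfolding G_def by (simp add: norm_mult algebra_simps flip: of_real_add of_real_mult)
    moreover have "cmod (?w x) = 1 / sqrt (1 + x\<^sup>2)"
      unfolding norm_of_real by (simp add: add_nonneg_nonneg)
    moreover have "0 < sqrt (1 + x\<^sup>2)" by (simp add: add_pos_nonneg)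
    moreover have "sqrt (1 + x\<^sup>2) * cmod (f x) \<le> (1 + \<bar>x\<bar>) * cmod (f x)"
      using s by (intro mult_right_mono) auto
    ultimately show ?thesis by (simp add: pos_le_divide_eq mult.commute)
  qed
  have i: "integrable lborel (\<lambda>x. cmod (?w x) * cmod (G x))"
    by (rule L2_mult_integrable(2)[OF inverse_sqrt_weight_L2 G])
  show int: "integrable lborel f"
    by (rule Bochner_Integration.integrable_bound[OF i]) (use le in auto)
  have "(LINT x|lborel. cmod (f x)) \<le> (LINT x|lborel. cmod (?w x) * cmod (G x))"
    by (rule integral_mono) (use int i le in auto)
  also have "\<dots> \<le> weight_const * L2_norm G"
    unfolding weight_const_def by (rule L2_Cauchy_Schwarz_abs[OF inverse_sqrt_weight_L2 G])
  also have "\<dots> \<le> weight_const * (L2_norm f + L2_norm (\<lambda>x. of_real x * f x))"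
    by (rule mult_left_mono[OF GN]) (simp add: weight_const_def)
  finally show "(LINT x|lborel. cmod (f x)) \<le> weight_const * (L2_norm f + L2_norm (\<lambda>x. of_real x * f x))" .
qed

section \<open>Gaussian integrals with complex parameter\<close>

lemma integral_derivative_UNIV:
  fixes F :: "real \<Rightarrow> complex"
  assumes F: "\<And>x. (F has_vector_derivative f x) (at x)" and f: "continuous_on UNIV f"
    and int: "integrable lborel f" and top: "(F \<longlongrightarrow> 0) at_top" and bot: "(F \<longlongrightarrow> 0) at_bot"
  shows "(LINT x|lborel. f x) = 0"
proof -
  have "(LBINT x=-\<infinity>..\<infinity>. f x) = 0 - 0"
  proof (rule interval_integral_FTC_integrable[where F=F])
    show "((F \<circ> real_of_ereal) \<longlongrightarrow> 0) (at_right (- \<infinity>))" "((F \<circ> real_of_ereal) \<longlongrightarrow> 0) (at_left \<infinity>)"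
      using top bot by (simp_all add: ereal_tendsto_simps)
    show "set_integrable lborel (einterval (- \<infinity>) \<infinity>) f"
      using int by (simp add: set_integrable_def einterval_def)
    show "isCont f x" for x
      using f by (simp add: continuous_on_eq_continuous_at)
  qed (use F in auto)
  then show ?thesis
    by (simp add: interval_lebesgue_integral_def set_lebesgue_integral_def einterval_def)
qed

lemma gaussian_moment_integrable:
  assumes r: "0 < r"
  shows "integrable lborel (\<lambda>\<xi>::real. \<xi> ^ k * exp (- (r * \<xi>\<^sup>2 / 2)))"
proof -
  have int: "integrable lborel (\<lambda>\<xi>. sqrt (2 * pi / r) * (normal_density 0 (1 / sqrt r) \<xi> * (\<xi> - 0) ^ k))"
    using r by (intro integrable_mult_right integrable_normal_moment) simp
  have eq: "sqrt (2 * pi / r) * (normal_density 0 (1 / sqrt r) \<xi> * (\<xi> - 0) ^ k)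
      = \<xi> ^ k * exp (- (r * \<xi>\<^sup>2 / 2))" for \<xi>
    using r by (simp add: normal_density_def power_divide real_sqrt_divide field_simps)
  show ?thesis using int unfolding eq .
qed

text \<open>A Gaussian of complex width times a plane wave. It is integrable for
  \<open>Re z > 0\<close>; at imaginary \<open>z\<close> it becomes the oscillating factor of the
  free evolution.\<close>

definition gauss_wave :: "complex \<Rightarrow> real \<Rightarrow> real \<Rightarrow> complex" where
  "gauss_wave z x \<xi> = exp (- z * of_real (\<xi>\<^sup>2) / 2 + \<i> * of_real (x * \<xi>))"

lemma cmod_gauss_wave: "cmod (gauss_wave z x \<xi>) = exp (- (Re z * \<xi>\<^sup>2 / 2))"
  by (simp add: gauss_wave_def norm_exp_eq_Re)

lemma gauss_wave_measurable [measurable]: "gauss_wave z x \<in> borel_measurable borel"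
  unfolding gauss_wave_def by (intro borel_measurable_continuous_onI continuous_intros) auto

lemma gauss_wave_moment_integrable:
  assumes "0 < Re z"
  shows "integrable lborel (\<lambda>\<xi>. of_real (\<xi> ^ k) * gauss_wave z x \<xi>)"
proof (rule Bochner_Integration.integrable_bound[OF gaussian_moment_integrable[OF assms, of k]])
  show "AE \<xi> in lborel. norm (of_real (\<xi> ^ k) * gauss_wave z x \<xi>) \<le> norm (\<xi> ^ k * exp (- (Re z * \<xi>\<^sup>2 / 2)))"
    by (simp add: norm_mult norm_power cmod_gauss_wave abs_mult power_abs)
qed measurable

text \<open>These are the boundary terms when the derivatives of \<open>gauss_wave z x\<close> and
  of its product with \<open>\<xi>\<close> are integrated over the line. For
  \<open>k \<le> 1\<close> both reduce to \<open>exp (- u) \<le> 1 / u\<close>.\<close>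

lemma gauss_wave_tendsto_0:
  assumes z: "0 < Re z" and k: "k \<le> (1::nat)"
  shows "((\<lambda>\<xi>. of_real (\<xi> ^ k) * gauss_wave z x \<xi>) \<longlongrightarrow> 0) at_infinity"
proof (rule Lim_null_comparison)
  have "filterlim (\<lambda>\<xi>::real. \<bar>\<xi>\<bar>) at_top at_infinity"
    unfolding real_norm_def[symmetric] by (rule filterlim_at_infinity_imp_norm_at_top[OF filterlim_ident])
  then show "((\<lambda>\<xi>::real. 2 / (Re z * \<bar>\<xi>\<bar>)) \<longlongrightarrow> 0) at_infinity"
    by (intro tendsto_divide_0[OF tendsto_const] filterlim_at_top_imp_at_infinity
        filterlim_tendsto_pos_mult_at_top[OF tendsto_const z])
  have "norm (of_real (\<xi> ^ k) * gauss_wave z x \<xi>) \<le> 2 / (Re z * \<bar>\<xi>\<bar>)" if \<xi>: "1 \<le> norm \<xi>" for \<xi> :: real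
  proof -
    define u where "u = Re z * \<xi>\<^sup>2 / 2"
    have "\<xi> \<noteq> 0" using \<xi> by auto
    then have u: "0 < u" using z by (simp add: u_def)
    have "u \<le> exp u" using exp_ge_add_one_self[of u] by linarith
    then have "exp (- u) \<le> 1 / u" using u by (simp add: exp_minus field_simps)
    moreover have "k = 0 \<or> k = 1" using k by linarith
    then have "\<bar>\<xi>\<bar> ^ k \<le> \<bar>\<xi>\<bar>" using \<xi> by (elim disjE) simp_all
    ultimately have "\<bar>\<xi>\<bar> ^ k * exp (- u) \<le> \<bar>\<xi>\<bar> * (1 / u)"
      using u by (intro mult_mono) simp_all
    also have "\<dots> = 2 / (Re z * \<bar>\<xi>\<bar>)"
      using z \<open>\<xi> \<noteq> 0\<close> unfolding u_def power2_abs[of \<xi>, symmetric]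
      by (simp add: divide_simps power2_eq_square)
    finally show ?thesis by (simp add: norm_mult cmod_gauss_wave u_def norm_power)
  qed
  then show "\<forall>\<^sub>F \<xi> in at_infinity. norm (of_real (\<xi> ^ k) * gauss_wave z x \<xi>) \<le> 2 / (Re z * \<bar>\<xi>\<bar>)"
    unfolding eventually_at_infinity by blast
qed

lemma gauss_wave_derivative:
  "(gauss_wave z x has_vector_derivative
     (- z * of_real \<xi> + \<i> * of_real x) * gauss_wave z x \<xi>) (at \<xi>)"
proof -
  have "((\<lambda>w. exp (- z * w\<^sup>2 / 2 + \<i> * (of_real x * w))) has_field_derivative
     (- z * of_real \<xi> + \<i> * of_real x) * gauss_wave z x \<xi>) (at (of_real \<xi>))"
    unfolding gauss_wave_def by (auto intro!: derivative_eq_intros simp: algebra_simps)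
  from has_vector_derivative_real_field[OF this] show ?thesis
    by (simp add: gauss_wave_def[abs_def])
qed

text \<open>The derivative of \<open>gauss_wave z x\<close> integrates to \<open>0\<close> over the
  line.\<close>

lemma gauss_wave_moment_1:
  assumes z: "0 < Re z"
  shows "(LINT \<xi>|lborel. of_real \<xi> * gauss_wave z x \<xi>)
      = (\<i> * of_real x / z) * (LINT \<xi>|lborel. gauss_wave z x \<xi>)"
proof -
  have int: "integrable lborel (\<lambda>\<xi>. of_real \<xi> * gauss_wave z x \<xi>)" "integrable lborel (gauss_wave z x)"
    using gauss_wave_moment_integrable[OF z, of 1] gauss_wave_moment_integrable[OF z, of 0] by simp_all
  have lim: "(gauss_wave z x \<longlongrightarrow> 0) at_infinity"
    using gauss_wave_tendsto_0[OF z, of 0] by simp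
  have "(LINT \<xi>|lborel. - z * (of_real \<xi> * gauss_wave z x \<xi>) + \<i> * of_real x * gauss_wave z x \<xi>) = 0"
  proof (rule integral_derivative_UNIV[where F="gauss_wave z x"])
    show "(gauss_wave z x has_vector_derivative
        - z * (of_real \<xi> * gauss_wave z x \<xi>) + \<i> * of_real x * gauss_wave z x \<xi>) (at \<xi>)" for \<xi>
      using gauss_wave_derivative[of z x \<xi>] by (simp add: algebra_simps)
    show "continuous_on UNIV (\<lambda>\<xi>. - z * (of_real \<xi> * gauss_wave z x \<xi>) + \<i> * of_real x * gauss_wave z x \<xi>)"
      unfolding gauss_wave_def by (intro continuous_intros) auto
  qed (intro Bochner_Integration.integrable_add integrable_mult_right int
      tendsto_mono[OF at_top_le_at_infinity lim] tendsto_mono[OF at_bot_le_at_infinity lim])+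
  then have "- z * (LINT \<xi>|lborel. of_real \<xi> * gauss_wave z x \<xi>)
      + \<i> * of_real x * (LINT \<xi>|lborel. gauss_wave z x \<xi>) = 0"
    using int by simp
  moreover have "z \<noteq> 0" using z by auto
  ultimately show ?thesis by (simp add: field_simps)
qed

text \<open>The same argument for \<open>\<xi> * gauss_wave z x \<xi>\<close>, whose derivative
  contains the second moment; the first moment is then eliminated.\<close>

lemma gauss_wave_moment_2:
  assumes z: "0 < Re z"
  shows "(LINT \<xi>|lborel. of_real (\<xi>\<^sup>2) * gauss_wave z x \<xi>)
      = (1 / z - of_real (x\<^sup>2) / z\<^sup>2) * (LINT \<xi>|lborel. gauss_wave z x \<xi>)"
proof -
  have int: "integrable lborel (\<lambda>\<xi>. of_real (\<xi>\<^sup>2) * gauss_wave z x \<xi>)"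
    "integrable lborel (\<lambda>\<xi>. of_real \<xi> * gauss_wave z x \<xi>)" "integrable lborel (gauss_wave z x)"
    using gauss_wave_moment_integrable[OF z, of 2] gauss_wave_moment_integrable[OF z, of 1]
      gauss_wave_moment_integrable[OF z, of 0] by simp_all
  have lim: "((\<lambda>\<xi>. of_real \<xi> * gauss_wave z x \<xi>) \<longlongrightarrow> 0) at_infinity"
    using gauss_wave_tendsto_0[OF z, of 1] by simp
  let ?f = "\<lambda>\<xi>. gauss_wave z x \<xi> + (- z * (of_real (\<xi>\<^sup>2) * gauss_wave z x \<xi>)
      + \<i> * of_real x * (of_real \<xi> * gauss_wave z x \<xi>))"
  have "(LINT \<xi>|lborel. ?f \<xi>) = 0"
  proof (rule integral_derivative_UNIV[where F="\<lambda>\<xi>. of_real \<xi> * gauss_wave z x \<xi>"])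
    show "((\<lambda>\<xi>. of_real \<xi> * gauss_wave z x \<xi>) has_vector_derivative ?f \<xi>) (at \<xi>)" for \<xi>
      by (rule has_vector_derivative_eq_rhs[OF has_vector_derivative_mult[OF
          has_vector_derivative_of_real[OF DERIV_ident] gauss_wave_derivative]])
        (simp add: algebra_simps power2_eq_square)
    show "continuous_on UNIV ?f"
      unfolding gauss_wave_def by (intro continuous_intros) auto
  qed (intro Bochner_Integration.integrable_add integrable_mult_right int
      tendsto_mono[OF at_top_le_at_infinity lim] tendsto_mono[OF at_bot_le_at_infinity lim])+
  then have "(LINT \<xi>|lborel. gauss_wave z x \<xi>)
      + (- z * (LINT \<xi>|lborel. of_real (\<xi>\<^sup>2) * gauss_wave z x \<xi>)
      + \<i> * of_real x * (LINT \<xi>|lborel. of_real \<xi> * gauss_wave z x \<xi>)) = 0"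
    using int by simp
  then have "z * (LINT \<xi>|lborel. of_real (\<xi>\<^sup>2) * gauss_wave z x \<xi>)
      = (1 + \<i> * of_real x * (\<i> * of_real x / z)) * (LINT \<xi>|lborel. gauss_wave z x \<xi>)"
    unfolding gauss_wave_moment_1[OF z] by (simp add: algebra_simps)
  moreover have "z \<noteq> 0" using z by auto
  ultimately show ?thesis by (simp add: field_simps power2_eq_square)
qed

lemma cmod_exp_diff_le:
  assumes "Re a \<le> m" "Re b \<le> m"
  shows "cmod (exp a - exp b) \<le> exp m * cmod (a - b)"
proof (rule field_differentiable_bound[of "{w. Re w \<le> m}" exp exp])
  show "convex {w. Re w \<le> m}" by (rule convex_halfspace_Re_le)
  show "(exp has_field_derivative exp w) (at w within {w. Re w \<le> m})" for w :: complex
    by (rule DERIV_subset[OF DERIV_exp]) simp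
qed (use assms in \<open>auto simp: norm_exp_eq_Re\<close>)

text \<open>Differentiation under the integral sign. Close to \<open>z\<close> all real parts exceed
  \<open>r = Re z / 2\<close>, so a single Gaussian with parameter \<open>r\<close>, times
  \<open>\<xi>\<^sup>2\<close>, dominates every difference quotient.\<close>

lemma gauss_integral_derivative:
  assumes z: "0 < Re z"
  shows "((\<lambda>w. LINT \<xi>|lborel. gauss_wave w x \<xi>) has_field_derivative
      (LINT \<xi>|lborel. - of_real (\<xi>\<^sup>2) / 2 * gauss_wave z x \<xi>)) (at z)"
  unfolding has_field_derivative_iff tendsto_at_iff_sequentially
proof (intro allI impI)
  fix X :: "nat \<Rightarrow> complex"
  assume X: "\<forall>i. X i \<in> UNIV - {z}" and lim: "X \<longlonglongrightarrow> z"
  let ?q = "\<lambda>w \<xi>. (gauss_wave w x \<xi> - gauss_wave z x \<xi>) / (w - z)"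
  define r where "r = Re z / 2"
  have r: "0 < r" using z by (simp add: r_def)
  have "\<forall>\<^sub>F n in sequentially. r < Re (X n)"
    using order_tendstoD(1)[OF tendsto_Re[OF lim], of r] z by (simp add: r_def)
  then obtain N where N: "\<And>n. N \<le> n \<Longrightarrow> r < Re (X n)"
    by (auto simp: eventually_sequentially)
  have "(\<lambda>n. LINT \<xi>|lborel. ?q (X (n + N)) \<xi>) \<longlonglongrightarrow> (LINT \<xi>|lborel. - of_real (\<xi>\<^sup>2) / 2 * gauss_wave z x \<xi>)"
  proof (rule integral_dominated_convergence[where w="\<lambda>\<xi>. \<xi>\<^sup>2 * exp (- (r * \<xi>\<^sup>2 / 2))"])
    show "integrable lborel (\<lambda>\<xi>. \<xi>\<^sup>2 * exp (- (r * \<xi>\<^sup>2 / 2)))"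
      by (rule gaussian_moment_integrable[OF r])
    show "AE \<xi> in lborel. (\<lambda>n. ?q (X (n + N)) \<xi>) \<longlonglongrightarrow> - of_real (\<xi>\<^sup>2) / 2 * gauss_wave z x \<xi>"
    proof (rule AE_I2)
      fix \<xi> :: real
      have "((\<lambda>w. gauss_wave w x \<xi>) has_field_derivative - of_real (\<xi>\<^sup>2) / 2 * gauss_wave z x \<xi>) (at z)"
        unfolding gauss_wave_def by (auto intro!: derivative_eq_intros)
      then have "(\<lambda>n. ?q (X n) \<xi>) \<longlonglongrightarrow> - of_real (\<xi>\<^sup>2) / 2 * gauss_wave z x \<xi>"
        using X lim unfolding has_field_derivative_iff tendsto_at_iff_sequentially comp_def by blast
      then show "(\<lambda>n. ?q (X (n + N)) \<xi>) \<longlonglongrightarrow> - of_real (\<xi>\<^sup>2) / 2 * gauss_wave z x \<xi>"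
        by (rule LIMSEQ_ignore_initial_segment)
    qed
    show "AE \<xi> in lborel. norm (?q (X (n + N)) \<xi>) \<le> \<xi>\<^sup>2 * exp (- (r * \<xi>\<^sup>2 / 2))" for n
    proof (rule AE_I2)
      fix \<xi> :: real
      let ?w = "X (n + N)"
      have w: "r < Re ?w" "?w \<noteq> z" using N[of "n + N"] X by auto
      have "cmod (gauss_wave ?w x \<xi> - gauss_wave z x \<xi>)
          \<le> exp (- (r * \<xi>\<^sup>2 / 2)) * cmod ((- ?w * of_real (\<xi>\<^sup>2) / 2 + \<i> * of_real (x * \<xi>)) - (- z * of_real (\<xi>\<^sup>2) / 2 + \<i> * of_real (x * \<xi>)))"
        unfolding gauss_wave_def
        by (rule cmod_exp_diff_le) (use w z mult_right_mono[of r "Re ?w" "\<xi>\<^sup>2"] in \<open>auto simp: r_def\<close>)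
      also have "(- ?w * of_real (\<xi>\<^sup>2) / 2 + \<i> * of_real (x * \<xi>)) - (- z * of_real (\<xi>\<^sup>2) / 2 + \<i> * of_real (x * \<xi>))
          = - (of_real (\<xi>\<^sup>2 / 2) * (?w - z))" by (simp add: field_simps)
      also have "cmod \<dots> = \<xi>\<^sup>2 / 2 * cmod (?w - z)"
        by (simp only: norm_minus_cancel norm_mult norm_of_real) simp
      finally have "norm (?q ?w \<xi>) \<le> exp (- (r * \<xi>\<^sup>2 / 2)) * (\<xi>\<^sup>2 / 2)"
        using w by (simp add: norm_divide divide_le_eq mult_ac)
      also have "\<dots> \<le> \<xi>\<^sup>2 * exp (- (r * \<xi>\<^sup>2 / 2))" by simp
      finally show "norm (?q ?w \<xi>) \<le> \<xi>\<^sup>2 * exp (- (r * \<xi>\<^sup>2 / 2))" .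
    qed
  qed simp_all
  moreover have "(LINT \<xi>|lborel. ?q (X (n + N)) \<xi>)
      = ((LINT \<xi>|lborel. gauss_wave (X (n + N)) x \<xi>) - (LINT \<xi>|lborel. gauss_wave z x \<xi>)) / (X (n + N) - z)" for n
    using gauss_wave_moment_integrable[of "X (n + N)" 0 x] gauss_wave_moment_integrable[OF z, of 0 x]
      N[of "n + N"] r by simp
  ultimately have "(\<lambda>n. ((LINT \<xi>|lborel. gauss_wave (X (n + N)) x \<xi>) - (LINT \<xi>|lborel. gauss_wave z x \<xi>)) / (X (n + N) - z))
      \<longlonglongrightarrow> (LINT \<xi>|lborel. - of_real (\<xi>\<^sup>2) / 2 * gauss_wave z x \<xi>)" by (simp only:)
  then show "((\<lambda>w. ((LINT \<xi>|lborel. gauss_wave w x \<xi>) - (LINT \<xi>|lborel. gauss_wave z x \<xi>)) / (w - z)) \<circ> X)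
      \<longlonglongrightarrow> (LINT \<xi>|lborel. - of_real (\<xi>\<^sup>2) / 2 * gauss_wave z x \<xi>)"
    unfolding comp_def by (rule LIMSEQ_offset)
qed

lemma gauss_integral_1: "(LINT \<xi>|lborel. gauss_wave 1 x \<xi>) = of_real (sqrt (2 * pi) * exp (- x\<^sup>2 / 2))"
proof -
  have "complex_of_real (exp (- x\<^sup>2 / 2)) = char std_normal_distribution x"
    by (simp add: char_std_normal_distribution)
  also have "\<dots> = (LINT \<xi>|lborel. std_normal_density \<xi> *\<^sub>R iexp (x * \<xi>))"
    unfolding char_def by (subst integral_density) auto
  also have "\<dots> = (LINT \<xi>|lborel. of_real (1 / sqrt (2 * pi)) * gauss_wave 1 x \<xi>)"
    by (intro Bochner_Integration.integral_cong)
      (auto simp: std_normal_density_def gauss_wave_def exp_of_real[symmetric] mult_exp_exp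
        scaleR_conv_of_real algebra_simps)
  finally have *: "complex_of_real (exp (- x\<^sup>2 / 2)) = of_real (1 / sqrt (2 * pi)) * (LINT \<xi>|lborel. gauss_wave 1 x \<xi>)"
    by (simp only: integral_mult_right_zero)
  have "(LINT \<xi>|lborel. gauss_wave 1 x \<xi>)
      = of_real (sqrt (2 * pi)) * (of_real (1 / sqrt (2 * pi)) * (LINT \<xi>|lborel. gauss_wave 1 x \<xi>))"
    by (simp only: mult.assoc[symmetric] of_real_mult[symmetric]) simp
  then show ?thesis unfolding *[symmetric] by simp
qed

text \<open>The second moment identity makes the derivative of the integral in \<open>w\<close> a
  multiple of the integral itself, so the product \<open>K\<close> has derivative \<open>0\<close>
  on the right half-plane. Its value at \<open>1\<close> comes from the characteristic function of
  the standard normal distribution.\<close>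

lemma gauss_integral:
  assumes z: "0 < Re z"
  shows "(LINT \<xi>|lborel. gauss_wave z x \<xi>)
      = of_real (sqrt (2 * pi)) / csqrt z * exp (- of_real (x\<^sup>2) / (2 * z))"
proof -
  define K where "K = (\<lambda>w. (LINT \<xi>|lborel. gauss_wave w x \<xi>) * (csqrt w * exp (of_real (x\<^sup>2) / (2 * w))))"
  have "\<exists>c. \<forall>w \<in> {w. 0 < Re w}. K w = c"
  proof (rule has_field_derivative_zero_constant)
    show "convex {w. 0 < Re w}" by (rule convex_halfspace_Re_gt)
    fix w assume "w \<in> {w. 0 < Re w}"
    then have w: "0 < Re w" "w \<noteq> 0" "w \<notin> \<real>\<^sub>\<le>\<^sub>0" by (auto simp: complex_nonpos_Reals_iff)
    let ?J = "LINT \<xi>|lborel. gauss_wave w x \<xi>"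
    have J': "(LINT \<xi>|lborel. - of_real (\<xi>\<^sup>2) / 2 * gauss_wave w x \<xi>)
        = - (1 / 2) * ((1 / w - of_real (x\<^sup>2) / w\<^sup>2) * ?J)"
      unfolding gauss_wave_moment_2[OF w(1), symmetric]
      by (subst integral_mult_right_zero[symmetric], rule Bochner_Integration.integral_cong) auto
    have "(K has_field_derivative
       (- (1 / 2) * ((1 / w - of_real (x\<^sup>2) / w\<^sup>2) * ?J)) * (csqrt w * exp (of_real (x\<^sup>2) / (2 * w)))
       + (1 / (2 * csqrt w) * exp (of_real (x\<^sup>2) / (2 * w))
          + (- of_real (x\<^sup>2) / (2 * w\<^sup>2)) * exp (of_real (x\<^sup>2) / (2 * w)) * csqrt w) * ?J) (at w)"
      unfolding K_def using w(2,3)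
      by (intro DERIV_mult gauss_integral_derivative[OF w(1), of x, unfolded J'])
        (auto intro!: derivative_eq_intros simp: power2_eq_square)
    moreover have "1 / (2 * csqrt w) = csqrt w / (2 * w)"
      using w(2) power2_csqrt[of w] by (simp add: divide_simps power2_eq_square)
    then have "(- (1 / 2) * ((1 / w - of_real (x\<^sup>2) / w\<^sup>2) * ?J)) * (csqrt w * exp (of_real (x\<^sup>2) / (2 * w)))
       + (1 / (2 * csqrt w) * exp (of_real (x\<^sup>2) / (2 * w))
          + (- of_real (x\<^sup>2) / (2 * w\<^sup>2)) * exp (of_real (x\<^sup>2) / (2 * w)) * csqrt w) * ?J = 0"
      using w(2) by (simp add: field_simps)
    ultimately have "(K has_field_derivative 0) (at w)" by metis
    then show "(K has_field_derivative 0) (at w within {w. 0 < Re w})"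
      by (rule has_field_derivative_at_within)
  qed
  then obtain c where c: "\<And>w. 0 < Re w \<Longrightarrow> K w = c" by auto
  have "K z = K 1" using c[of z] c[of 1] z by simp
  also have "K 1 = of_real (sqrt (2 * pi))"
    unfolding K_def gauss_integral_1
    by (simp add: exp_of_real[symmetric] exp_minus field_simps)
  finally have "(LINT \<xi>|lborel. gauss_wave z x \<xi>) * (csqrt z * exp (of_real (x\<^sup>2) / (2 * z)))
      = of_real (sqrt (2 * pi))" by (simp add: K_def)
  moreover have "z \<noteq> 0" using z by auto
  ultimately show ?thesis
    by (simp add: exp_minus field_simps)
qed

section \<open>The Fourier integral\<close>

lemma fourier_integrable:
  assumes "integrable lborel f"
  shows "integrable lborel (\<lambda>x. exp (- \<i> * of_real x * of_real \<xi>) * f x)"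
proof (rule Bochner_Integration.integrable_bound[OF assms])
  have [measurable]: "f \<in> borel_measurable borel" using assms by auto
  have [measurable]: "(\<lambda>x. exp (- \<i> * of_real x * of_real \<xi>)) \<in> borel_measurable borel"
    by (intro borel_measurable_continuous_onI continuous_intros)
  show "(\<lambda>x. exp (- \<i> * of_real x * of_real \<xi>) * f x) \<in> borel_measurable lborel" by measurable
  show "AE x in lborel. norm (exp (- \<i> * of_real x * of_real \<xi>) * f x) \<le> norm (f x)"
    by (simp add: norm_mult norm_exp_eq_Re)
qed

lemma cmod_fourier_le: "cmod (fourier f \<xi>) \<le> (LINT x|lborel. cmod (f x)) / sqrt (2 * pi)"
proof -
  have "cmod (LINT x|lborel. exp (- \<i> * of_real x * of_real \<xi>) * f x)
      \<le> (LINT x|lborel. cmod (exp (- \<i> * of_real x * of_real \<xi>) * f x))"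
    by (rule integral_norm_bound)
  also have "\<dots> = (LINT x|lborel. cmod (f x))"
    by (simp add: norm_mult norm_exp_eq_Re)
  finally show ?thesis
    by (simp add: fourier_def norm_mult norm_divide divide_right_mono)
qed

lemma isCont_fourier:
  assumes f: "integrable lborel f"
  shows "isCont (fourier f) \<xi>"
proof -
  have [measurable]: "f \<in> borel_measurable borel" using f by auto
  have "isCont (\<lambda>\<xi>. LINT x|lborel. exp (- \<i> * of_real x * of_real \<xi>) * f x) \<xi>"
    unfolding continuous_at_sequentially comp_def
  proof (intro allI impI)
    fix X assume X: "X \<longlonglongrightarrow> \<xi>"
    show "(\<lambda>n. LINT x|lborel. exp (- \<i> * of_real x * of_real (X n)) * f x)
        \<longlonglongrightarrow> (LINT x|lborel. exp (- \<i> * of_real x * of_real \<xi>) * f x)"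
    proof (rule integral_dominated_convergence[where w="\<lambda>x. norm (f x)"])
      show "AE x in lborel. (\<lambda>n. exp (- \<i> * of_real x * of_real (X n)) * f x)
          \<longlonglongrightarrow> exp (- \<i> * of_real x * of_real \<xi>) * f x"
        by (intro AE_I2 tendsto_intros X)
    qed (use f fourier_integrable[OF f] in \<open>auto simp: norm_mult norm_exp_eq_Re\<close>)
  qed
  then show ?thesis unfolding fourier_def[abs_def] by (intro continuous_intros)
qed

lemma continuous_on_fourier: "integrable lborel f \<Longrightarrow> continuous_on A (fourier f)"
  using isCont_fourier continuous_at_imp_continuous_on by blast

lemma fourier_measurable [measurable]:
  assumes "integrable lborel f" shows "fourier f \<in> borel_measurable borel"
  by (intro borel_measurable_continuous_onI continuous_on_fourier assms)

lemma fourier_add: "integrable lborel f \<Longrightarrow> integrable lborel g \<Longrightarrow>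
    fourier (\<lambda>x. f x + g x) \<xi> = fourier f \<xi> + fourier g \<xi>"
  using fourier_integrable[of f \<xi>] fourier_integrable[of g \<xi>] by (simp add: fourier_def algebra_simps)

lemma fourier_diff: "integrable lborel f \<Longrightarrow> integrable lborel g \<Longrightarrow>
    fourier (\<lambda>x. f x - g x) \<xi> = fourier f \<xi> - fourier g \<xi>"
  using fourier_integrable[of f \<xi>] fourier_integrable[of g \<xi>] by (simp add: fourier_def algebra_simps)

lemma fourier_cmult: "fourier (\<lambda>x. c * f x) \<xi> = c * fourier f \<xi>"
  by (simp add: fourier_def mult.left_commute[of _ c])

lemma fourier_cong_AE:
  assumes "AE x in lborel. f x = g x" and [measurable]: "f \<in> borel_measurable borel" "g \<in> borel_measurable borel"
  shows "fourier f \<xi> = fourier g \<xi>"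
proof -
  have [measurable]: "(\<lambda>x. exp (- \<i> * of_real x * of_real \<xi>)) \<in> borel_measurable borel"
    by (intro borel_measurable_continuous_onI continuous_intros)
  have "(LINT x|lborel. exp (- \<i> * of_real x * of_real \<xi>) * f x)
      = (LINT x|lborel. exp (- \<i> * of_real x * of_real \<xi>) * g x)"
  proof (rule integral_cong_AE)
    show "AE x in lborel. exp (- \<i> * of_real x * of_real \<xi>) * f x = exp (- \<i> * of_real x * of_real \<xi>) * g x"
      using assms(1) by eventually_elim simp
  qed measurable
  then show ?thesis by (simp add: fourier_def)
qed

lemma fourier_cnj: "cnj (fourier f \<xi>) = fourier (\<lambda>x. cnj (f x)) (- \<xi>)"
proof -
  have "cnj (LINT x|lborel. exp (- \<i> * of_real x * of_real \<xi>) * f x)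
      = (LINT x|lborel. cnj (exp (- \<i> * of_real x * of_real \<xi>) * f x))"
    by (rule Bochner_Integration.integral_cnj[symmetric])
  also have "\<dots> = (LINT x|lborel. exp (- \<i> * of_real x * of_real (- \<xi>)) * cnj (f x))"
    by (rule Bochner_Integration.integral_cong) (simp_all add: exp_cnj)
  finally show ?thesis by (simp add: fourier_def)
qed

lemma fourier_translate:
  "fourier (\<lambda>x. f (x + c)) \<xi> = exp (\<i> * of_real (c * \<xi>)) * fourier f \<xi>"
proof -
  have "(LINT x|lborel. exp (- \<i> * of_real x * of_real \<xi>) * f x)
      = (LINT x|lborel. exp (- \<i> * of_real (c + x) * of_real \<xi>) * f (c + x))"
    using lborel_integral_real_affine[of 1 "\<lambda>x. exp (- \<i> * of_real x * of_real \<xi>) * f x" c] by simp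
  also have "\<dots> = (LINT x|lborel. exp (- \<i> * of_real (c * \<xi>)) * (exp (- \<i> * of_real x * of_real \<xi>) * f (x + c)))"
    by (intro Bochner_Integration.integral_cong)
      (auto simp: algebra_simps mult_exp_exp[symmetric] exp_diff exp_minus field_simps)
  also have "\<dots> = exp (- \<i> * of_real (c * \<xi>)) * (LINT x|lborel. exp (- \<i> * of_real x * of_real \<xi>) * f (x + c))"
    by (rule integral_mult_right_zero)
  finally show ?thesis by (simp add: fourier_def exp_minus)
qed

lemma fourier_modulate:
  "fourier (\<lambda>x. exp (\<i> * of_real (c * x)) * f x) \<xi> = fourier f (\<xi> - c)"
  unfolding fourier_def mult.assoc[symmetric] mult_exp_exp
  by (auto intro!: arg_cong[of _ _ "\<lambda>x. _ * x"] Bochner_Integration.integral_cong simp: algebra_simps)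

lemma integrable_reflect:
  fixes f :: "real \<Rightarrow> complex"
  assumes "integrable lborel f" shows "integrable lborel (\<lambda>x. f (- x))"
  using lborel_integrable_real_affine[OF assms, of "-1" 0] by simp

lemma fourier_reflect: "fourier (\<lambda>x. f (- x)) \<xi> = fourier f (- \<xi>)"
  using lborel_integral_real_affine[of "-1" "\<lambda>x. exp (- \<i> * of_real x * of_real (- \<xi>)) * f x" 0]
  by (simp add: fourier_def)

lemma integrable_mult_bounded:
  fixes f g :: "real \<Rightarrow> complex"
  assumes f: "integrable lborel f" and [measurable]: "g \<in> borel_measurable borel"
    and le: "\<And>x. cmod (g x) \<le> C"
  shows "integrable lborel (\<lambda>x. g x * f x)"
proof (rule Bochner_Integration.integrable_bound[OF integrable_mult_right[OF integrable_norm[OF f], of C]])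
  have [measurable]: "f \<in> borel_measurable borel" using f by auto
  show "(\<lambda>x. g x * f x) \<in> borel_measurable lborel" by measurable
  show "AE x in lborel. norm (g x * f x) \<le> norm (C * norm (f x))"
    using order_trans[OF le abs_ge_self] by (auto simp: norm_mult abs_mult intro!: mult_right_mono)
qed

text \<open>Fubini for a kernel that is symmetric in its two variables. Plancherel's identity and
  the inversion formula both rest on this duality.\<close>

lemma fourier_swap:
  assumes f: "integrable lborel f" and g: "integrable lborel g"
  shows "(LINT \<xi>|lborel. fourier f \<xi> * g \<xi>) = (LINT x|lborel. f x * fourier g x)"
proof -
  have [measurable]: "f \<in> borel_measurable borel" "g \<in> borel_measurable borel" using f g by auto
  let ?K = "\<lambda>x \<xi>. exp (- \<i> * of_real x * of_real \<xi>) * f x * g \<xi>"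
  have [measurable]: "(\<lambda>p. exp (- \<i> * of_real (fst p) * of_real (snd p))) \<in> borel_measurable (borel \<Otimes>\<^sub>M (borel :: real measure))"
    by (rule borel_measurable_exp[THEN measurable_compose_rev]) measurable
  have int: "integrable (lborel \<Otimes>\<^sub>M lborel) (case_prod ?K)"
  proof (rule lborel_pair.Fubini_integrable)
    show "case_prod ?K \<in> borel_measurable (lborel \<Otimes>\<^sub>M lborel)"
      unfolding split_beta' by measurable
    show "integrable lborel (\<lambda>x. LINT \<xi>|lborel. norm (case (x, \<xi>) of (x, \<xi>) \<Rightarrow> ?K x \<xi>))"
      using f by (simp add: norm_mult norm_exp_eq_Re)
    show "AE x in lborel. integrable lborel (\<lambda>\<xi>. case (x, \<xi>) of (x, \<xi>) \<Rightarrow> ?K x \<xi>)"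
    proof (rule AE_I2)
      fix x
      show "integrable lborel (\<lambda>\<xi>. case (x, \<xi>) of (x, \<xi>) \<Rightarrow> ?K x \<xi>)"
        using integrable_mult_right[OF fourier_integrable[OF g, of x], of "f x"] by (simp add: mult_ac)
    qed
  qed
  have "(LINT \<xi>|lborel. (LINT x|lborel. ?K x \<xi>)) = (LINT x|lborel. (LINT \<xi>|lborel. ?K x \<xi>))"
    by (rule lborel_pair.Fubini_integral[OF int])
  moreover have "(LINT x|lborel. ?K x \<xi>) = (LINT x|lborel. exp (- \<i> * of_real x * of_real \<xi>) * f x) * g \<xi>" for \<xi>
    by (rule integral_mult_left_zero)
  moreover have "(LINT \<xi>|lborel. ?K x \<xi>) = f x * (LINT \<xi>|lborel. exp (- \<i> * of_real \<xi> * of_real x) * g \<xi>)" for x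
    by (subst integral_mult_right_zero[symmetric]) (auto intro!: Bochner_Integration.integral_cong simp: mult_ac)
  ultimately have "(LINT \<xi>|lborel. (LINT x|lborel. exp (- \<i> * of_real x * of_real \<xi>) * f x) * g \<xi>)
      = (LINT x|lborel. f x * (LINT \<xi>|lborel. exp (- \<i> * of_real \<xi> * of_real x) * g \<xi>))"
    by (simp only:)
  then show ?thesis unfolding fourier_def
    by (simp only: mult.assoc mult.left_commute[of "f _"] integral_mult_right_zero)
qed

lemma fourier_gauss_wave:
  assumes "0 < Re z"
  shows "fourier (gauss_wave z x) y = exp (- of_real ((x - y)\<^sup>2) / (2 * z)) / csqrt z"
proof -
  have "exp (- \<i> * of_real \<xi> * of_real y) * gauss_wave z x \<xi> = gauss_wave z (x - y) \<xi>" for \<xi>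
    by (simp add: gauss_wave_def mult_exp_exp algebra_simps)
  then show ?thesis
    using gauss_integral[OF assms, of "x - y"] by (simp add: fourier_def)
qed

text \<open>A Gaussian factor makes the inversion integral absolutely convergent; by duality the
  result is a convolution of \<open>f\<close> with a Gaussian.\<close>

lemma fourier_gauss_regularised:
  assumes f: "integrable lborel f" and z: "0 < Re z"
  shows "(LINT \<xi>|lborel. fourier f \<xi> * gauss_wave z x \<xi>)
      = (LINT y|lborel. f y * exp (- of_real ((x - y)\<^sup>2) / (2 * z))) / csqrt z"
  using fourier_swap[OF f, of "gauss_wave z x"] gauss_wave_moment_integrable[OF z, of 0 x]
  by (simp add: fourier_gauss_wave[OF z])

text \<open>The boundary case \<open>Re z = 0\<close> of the previous formula, which gives the kernel of the free Schroedinger group.\<close>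

lemma fourier_fresnel:
  assumes f: "integrable lborel f" and ff: "integrable lborel (fourier f)" and s: "0 < s"
  shows "(LINT \<xi>|lborel. fourier f \<xi> * gauss_wave (\<i> * of_real s) x \<xi>)
      = (LINT y|lborel. f y * exp (- of_real ((x - y)\<^sup>2) / (2 * (\<i> * of_real s)))) / csqrt (\<i> * of_real s)"
proof -
  have [measurable]: "f \<in> borel_measurable borel" using f by auto
  \<comment> \<open>The points \<open>z n\<close> approach the imaginary axis from the half-plane in
    which the Gaussian formula holds.\<close>
  define z where "z n = Complex (inverse (real (Suc n))) s" for n
  have z: "0 < Re (z n)" "z n \<noteq> 0" for n using s by (auto simp: z_def complex_eq_iff)
  have "z \<longlonglongrightarrow> Complex 0 s"
    unfolding z_def by (intro tendsto_Complex LIMSEQ_inverse_real_of_nat tendsto_const)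
  then have lim: "z \<longlonglongrightarrow> \<i> * of_real s"
    by (simp add: complex_eq_iff Complex_eq)
  have nz: "\<i> * of_real s \<notin> \<real>\<^sub>\<le>\<^sub>0" "\<i> * of_real s \<noteq> 0" using s by (auto simp: complex_nonpos_Reals_iff)
  have L: "(\<lambda>n. LINT \<xi>|lborel. fourier f \<xi> * gauss_wave (z n) x \<xi>)
      \<longlonglongrightarrow> (LINT \<xi>|lborel. fourier f \<xi> * gauss_wave (\<i> * of_real s) x \<xi>)"
  proof (rule integral_dominated_convergence[where w="\<lambda>\<xi>. norm (fourier f \<xi>)"])
    have "(\<lambda>n. fourier f \<xi> * gauss_wave (z n) x \<xi>) \<longlonglongrightarrow> fourier f \<xi> * gauss_wave (\<i> * of_real s) x \<xi>" for \<xi>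
      unfolding gauss_wave_def by (intro tendsto_intros lim) simp
    then show "AE \<xi> in lborel. (\<lambda>n. fourier f \<xi> * gauss_wave (z n) x \<xi>) \<longlonglongrightarrow> fourier f \<xi> * gauss_wave (\<i> * of_real s) x \<xi>"
      by simp
    show "AE \<xi> in lborel. norm (fourier f \<xi> * gauss_wave (z n) x \<xi>) \<le> norm (fourier f \<xi>)" for n
      using z(1)[of n] by (auto simp: norm_mult cmod_gauss_wave intro!: AE_I2 mult_left_le)
  qed (use ff fourier_measurable[OF f] in \<open>measurable; simp\<close>)+
  have Rint: "(\<lambda>n. LINT y|lborel. f y * exp (- of_real ((x - y)\<^sup>2) / (2 * z n)))
      \<longlonglongrightarrow> (LINT y|lborel. f y * exp (- of_real ((x - y)\<^sup>2) / (2 * (\<i> * of_real s))))"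
  proof (rule integral_dominated_convergence[where w="\<lambda>\<xi>. norm (f \<xi>)"])
    have "(\<lambda>n. f y * exp (- of_real ((x - y)\<^sup>2) / (2 * z n)))
        \<longlonglongrightarrow> f y * exp (- of_real ((x - y)\<^sup>2) / (2 * (\<i> * of_real s)))" for y
      using nz by (intro tendsto_intros lim) auto
    then show "AE y in lborel. (\<lambda>n. f y * exp (- of_real ((x - y)\<^sup>2) / (2 * z n)))
        \<longlonglongrightarrow> f y * exp (- of_real ((x - y)\<^sup>2) / (2 * (\<i> * of_real s)))" by simp
    \<comment> \<open>Reciprocals of numbers with positive real part have nonnegative real part, so
      the kernel is bounded by \<open>1\<close> uniformly in \<open>n\<close>.\<close>
    have "Re (of_real (r\<^sup>2) / (2 * z n)) \<ge> 0" for r :: real and n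
    proof -
      have "of_real (r\<^sup>2) / (2 * z n) = of_real (r\<^sup>2 / 2) * (1 / z n)" by simp
      then have "Re (of_real (r\<^sup>2) / (2 * z n)) = r\<^sup>2 / 2 * Re (1 / z n)"
        by (simp only: Re_complex_of_real Im_complex_of_real times_complex.sel)
      moreover have "0 \<le> Re (1 / z n)" using z(1)[of n] by (simp add: Re_divide)
      ultimately show ?thesis by (metis mult_nonneg_nonneg zero_le_divide_iff zero_le_numeral zero_le_power2)
    qed
    then show "AE y in lborel. norm (f y * exp (- of_real ((x - y)\<^sup>2) / (2 * z n))) \<le> norm (f y)" for n
      by (auto simp: norm_mult norm_exp_eq_Re simp del: of_real_power intro!: AE_I2 mult_left_le)
  qed (use f in \<open>measurable; simp\<close>)+
  have "(\<lambda>n. (LINT y|lborel. f y * exp (- of_real ((x - y)\<^sup>2) / (2 * z n))) / csqrt (z n))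
      \<longlonglongrightarrow> (LINT y|lborel. f y * exp (- of_real ((x - y)\<^sup>2) / (2 * (\<i> * of_real s)))) / csqrt (\<i> * of_real s)"
    using nz by (intro tendsto_divide Rint isCont_tendsto_compose[OF _ lim] continuous_at_csqrt) auto
  then have "(\<lambda>n. LINT \<xi>|lborel. fourier f \<xi> * gauss_wave (z n) x \<xi>)
      \<longlonglongrightarrow> (LINT y|lborel. f y * exp (- of_real ((x - y)\<^sup>2) / (2 * (\<i> * of_real s)))) / csqrt (\<i> * of_real s)"
    by (simp add: fourier_gauss_regularised[OF f z(1)])
  from LIMSEQ_unique[OF L this] show ?thesis .
qed

text \<open>In the frequency variable \<open>chirp (- t)\<close> is the symbol of the free group at
  time \<open>t\<close>; in the space variable \<open>chirp (1 / t)\<close> is the quadratic phase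
  of its kernel.\<close>

definition chirp :: "real \<Rightarrow> real \<Rightarrow> complex" where
  "chirp t x = exp (\<i> * of_real (t * x\<^sup>2 / 2))"

lemma cmod_chirp [simp]: "cmod (chirp t x) = 1"
  by (simp add: chirp_def norm_exp_eq_Re)

lemma chirp_measurable [measurable]: "chirp t \<in> borel_measurable borel"
  unfolding chirp_def by (intro borel_measurable_continuous_onI continuous_intros) auto

lemma chirp_minus_mult [simp]: "chirp (- t) x * chirp t x = 1" "chirp t x * chirp (- t) x = 1"
  by (simp_all add: chirp_def mult_exp_exp)

lemma cnj_chirp [simp]: "cnj (chirp t x) = chirp (- t) x"
  by (simp add: chirp_def exp_cnj)

text \<open>The factorisation \<open>M D \<F> M\<close> of the free group at time \<open>s\<close>, where \<open>M\<close> is multiplication by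
  \<open>chirp (1 / s)\<close> and \<open>D\<close> a dilation.\<close>

lemma schroedinger_factorisation:
  assumes f: "integrable lborel f" and ff: "integrable lborel (fourier f)" and s: "0 < s"
  shows "fourier (\<lambda>\<xi>. chirp (- s) \<xi> * fourier f \<xi>) (- x)
      = chirp (1 / s) x * fourier (\<lambda>y. chirp (1 / s) y * f y) (x / s) / csqrt (\<i> * of_real s)"
proof -
  have "fourier (\<lambda>\<xi>. chirp (- s) \<xi> * fourier f \<xi>) (- x)
      = of_real (1 / sqrt (2 * pi)) * (LINT \<xi>|lborel. fourier f \<xi> * gauss_wave (\<i> * of_real s) x \<xi>)"
    unfolding fourier_def[of "\<lambda>\<xi>. _ \<xi> * fourier f \<xi>"]
    by (intro arg_cong[of _ _ "\<lambda>x. _ * x"] Bochner_Integration.integral_cong)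
      (auto simp: chirp_def gauss_wave_def exp_add[symmetric] algebra_simps)
  also have "\<dots> = of_real (1 / sqrt (2 * pi)) *
      (LINT y|lborel. f y * exp (- of_real ((x - y)\<^sup>2) / (2 * (\<i> * of_real s)))) / csqrt (\<i> * of_real s)"
    by (simp add: fourier_fresnel[OF assms])
  also have "(LINT y|lborel. f y * exp (- of_real ((x - y)\<^sup>2) / (2 * (\<i> * of_real s))))
      = (LINT y|lborel. chirp (1 / s) x * (exp (- \<i> * of_real y * of_real (x / s)) * (chirp (1 / s) y * f y)))"
  proof (intro Bochner_Integration.integral_cong refl)
    fix y
    \<comment> \<open>Expanding the square separates one chirp in \<open>x\<close>, one chirp in
      \<open>y\<close> and the Fourier kernel at frequency \<open>x / s\<close>.\<close>
    have "- of_real ((x - y)\<^sup>2) / (2 * (\<i> * of_real s))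
        = \<i> * of_real (1 / s * x\<^sup>2 / 2) + - \<i> * of_real y * of_real (x / s) + \<i> * of_real (1 / s * y\<^sup>2 / 2)"
      using s by (simp add: power2_eq_square field_simps)
    then show "f y * exp (- of_real ((x - y)\<^sup>2) / (2 * (\<i> * of_real s)))
        = chirp (1 / s) x * (exp (- \<i> * of_real y * of_real (x / s)) * (chirp (1 / s) y * f y))"
      unfolding chirp_def by (simp only: exp_add mult_ac)
  qed
  also have "\<dots> = chirp (1 / s) x * (LINT y|lborel. exp (- \<i> * of_real y * of_real (x / s)) * (chirp (1 / s) y * f y))"
    by (rule integral_mult_right_zero)
  finally show ?thesis by (simp add: fourier_def mult_ac)
qed

section \<open>Plancherel's theorem\<close>

lemma translate_integrable:
  fixes f :: "real \<Rightarrow> complex"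
  assumes "integrable lborel f"
  shows "integrable lborel (\<lambda>x. f (x + c))" and "(LINT x|lborel. f (x + c)) = (LINT x|lborel. f x)"
  using lborel_integrable_real_affine[OF assms, of 1 c] lborel_integral_real_affine[of 1 f c]
  by (auto simp: add.commute)

lemma integral_cmod_translate: "(LINT x|lborel. cmod (f (x + c))) = (LINT x|lborel. cmod (f (x::real)))"
  using lborel_integral_real_affine[of 1 "\<lambda>x. cmod (f x)" c] by (simp add: add.commute)

text \<open>For open sets the positive part of the difference tends to \<open>0\<close> pointwise, and the
  negative part has the same integral; outer regularity reduces measurable sets to open ones.\<close>

lemma translation_continuous_open:
  assumes U: "open U" "emeasure lborel U < \<infinity>" and X: "X \<longlonglongrightarrow> (0::real)"
  shows "(\<lambda>n. LINT x|lborel. \<bar>indicator U (x + X n) - indicator U x\<bar>) \<longlonglongrightarrow> (0::real)"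
proof -
  have [measurable]: "U \<in> sets borel" using U by simp
  have int: "integrable lborel (indicator U :: real \<Rightarrow> real)"
    using U by simp
  have intt: "integrable lborel (\<lambda>x. indicator U (x + c) :: real)" for c
    using lborel_integrable_real_affine[OF int, of 1 c] by (simp add: add.commute)
  have eqt: "(LINT x|lborel. indicator U (x + c)) = (LINT x|lborel. (indicator U x :: real))" for c
    using lborel_integral_real_affine[of 1 "indicator U :: real \<Rightarrow> real" c] by (simp add: add.commute)
  let ?p = "\<lambda>n x. max 0 (indicator U x - indicator U (x + X n)) :: real"
  have intp: "integrable lborel (?p n)" for n
    by (rule Bochner_Integration.integrable_bound[OF int]) (auto split: split_indicator)
  have eq: "(LINT x|lborel. \<bar>indicator U (x + X n) - indicator U x\<bar>) = 2 * (LINT x|lborel. ?p n x)" for n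
  proof -
    have "(LINT x|lborel. \<bar>indicator U (x + X n) - indicator U x\<bar>)
        = (LINT x|lborel. 2 * ?p n x - (indicator U x - indicator U (x + X n)))"
      by (rule Bochner_Integration.integral_cong) (auto split: split_indicator)
    also have "\<dots> = 2 * (LINT x|lborel. ?p n x)
        - ((LINT x|lborel. indicator U x) - (LINT x|lborel. indicator U (x + X n)))"
      using int intt intp by (simp only: Bochner_Integration.integral_diff integrable_mult_right
          Bochner_Integration.integrable_diff integral_mult_right_zero)
    also have "\<dots> = 2 * (LINT x|lborel. ?p n x)" by (simp only: eqt)
    finally show ?thesis .
  qed
  have "(\<lambda>n. LINT x|lborel. ?p n x) \<longlonglongrightarrow> (LINT x::real|lborel. 0)"
  proof (rule integral_dominated_convergence[where w="indicator U"])
    show "AE x in lborel. (\<lambda>n. ?p n x) \<longlonglongrightarrow> 0"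
    proof (rule AE_I2)
      fix x :: real
      show "(\<lambda>n. ?p n x) \<longlonglongrightarrow> 0"
      proof (cases "x \<in> U")
        case True
        have "(\<lambda>n. x + X n) \<longlonglongrightarrow> x" using tendsto_add[OF tendsto_const X, of x] by simp
        then have "\<forall>\<^sub>F n in sequentially. x + X n \<in> U"
          using topological_tendstoD U(1) True by blast
        then have "\<forall>\<^sub>F n in sequentially. ?p n x = 0"
          by eventually_elim (simp add: True)
        then show ?thesis by (rule tendsto_eventually)
      next
        case False
        then have "?p n x = 0" for n by (auto split: split_indicator)
        then show ?thesis by simp
      qed
    qed
    show "AE x in lborel. norm (?p n x) \<le> indicator U x" for n
      by (auto split: split_indicator)
  qed (use int in auto)
  then have "(\<lambda>n. 2 * (LINT x|lborel. ?p n x)) \<longlonglongrightarrow> 2 * 0"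
    by (intro tendsto_mult tendsto_const) simp
  then show ?thesis by (simp add: eq)
qed

text \<open>Translations are isometries of L1, so continuity passes to L1 limits by an
  \<open>e / 3\<close> argument; the approximant may depend on \<open>e\<close>.\<close>

lemma translation_continuous_approx:
  fixes f :: "real \<Rightarrow> complex"
  assumes f: "integrable lborel f" and X: "X \<longlonglongrightarrow> 0"
    and ap: "\<And>e. 0 < e \<Longrightarrow> \<exists>g. integrable lborel g \<and> (LINT x|lborel. cmod (f x - g x)) < e \<and>
      (\<lambda>n. LINT x|lborel. cmod (g (x + X n) - g x)) \<longlonglongrightarrow> 0"
  shows "(\<lambda>n. LINT x|lborel. cmod (f (x + X n) - f x)) \<longlonglongrightarrow> 0"
proof (rule LIMSEQ_I)
  fix e :: real assume e: "0 < e"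
  then obtain g where g: "integrable lborel g" "(LINT x|lborel. cmod (f x - g x)) < e / 3"
    and lim: "(\<lambda>n. LINT x|lborel. cmod (g (x + X n) - g x)) \<longlonglongrightarrow> 0"
    using ap[of "e / 3"] by auto
  obtain N where N: "\<And>n. n \<ge> N \<Longrightarrow> norm ((LINT x|lborel. cmod (g (x + X n) - g x)) - 0) < e / 3"
    using LIMSEQ_D[OF lim, of "e / 3"] e by auto
  have "norm ((LINT x|lborel. cmod (f (x + X n) - f x)) - 0) < e" if "n \<ge> N" for n
  proof -
    note ints = translate_integrable(1)[OF f, of "X n"] translate_integrable(1)[OF g(1), of "X n"] f g(1)
    have "(LINT x|lborel. cmod (f (x + X n) - f x))
        \<le> (LINT x|lborel. cmod (f (x + X n) - g (x + X n)) + cmod (g (x + X n) - g x) + cmod (f x - g x))"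
    proof (rule integral_mono)
      show "cmod (f (x + X n) - f x) \<le> cmod (f (x + X n) - g (x + X n)) + cmod (g (x + X n) - g x) + cmod (f x - g x)" for x
        by norm
    qed (intro Bochner_Integration.integrable_add integrable_norm Bochner_Integration.integrable_diff ints)+
    also have "\<dots> = (LINT x|lborel. cmod (f (x + X n) - g (x + X n))) + (LINT x|lborel. cmod (g (x + X n) - g x))
        + (LINT x|lborel. cmod (f x - g x))"
      using ints by (simp only: Bochner_Integration.integral_add Bochner_Integration.integrable_add
          integrable_norm Bochner_Integration.integrable_diff)
    also have "(LINT x|lborel. cmod (f (x + X n) - g (x + X n))) = (LINT x|lborel. cmod (f x - g x))"
      by (rule integral_cmod_translate)
    finally show ?thesis using N[OF that] g(2) by simp
  qed
  then show "\<exists>N. \<forall>n\<ge>N. norm ((LINT x|lborel. cmod (f (x + X n) - f x)) - 0) < e" by blast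
qed

lemma translation_continuous_L1:
  fixes f :: "real \<Rightarrow> complex"
  assumes "integrable lborel f" and X: "X \<longlonglongrightarrow> 0"
  shows "(\<lambda>n. LINT x|lborel. cmod (f (x + X n) - f x)) \<longlonglongrightarrow> 0"
  using assms(1)
proof (induction f rule: integrable_induct)
  case (base A c)
  have A [measurable]: "A \<in> sets borel" using base by simp
  have intA: "integrable lborel (\<lambda>x. indicator A x *\<^sub>R c)"
    using base by (intro integrable_scaleR_left) simp
  show ?case
  proof (rule translation_continuous_approx[OF intA X])
    fix e :: real assume e: "0 < e"
    \<comment> \<open>The summand \<open>1\<close> keeps the division by \<open>k\<close> meaningful
      when \<open>c = 0\<close>.\<close>
    define k where "k = 1 + cmod c"
    define d where "d = e / (2 * k)"
    have c1: "0 < k" unfolding k_def by (rule add_pos_nonneg) auto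
    have d: "0 < d" using e c1 by (simp add: d_def)
    obtain U where U: "open U" "A \<subseteq> U" "emeasure lborel (U - A) < ennreal d"
      using outer_regular_lborel[OF A d] .
    have [measurable]: "U \<in> sets borel" using U by simp
    have "emeasure lborel U = emeasure lborel A + emeasure lborel (U - A)"
      using U by (subst plus_emeasure) (auto simp: Un_absorb1)
    then have Uf: "emeasure lborel U < \<infinity>"
      using base(2) U(3) by (metis ennreal_add_less_top ennreal_less_top infinity_ennreal_def order_less_trans)
    let ?g = "\<lambda>x. indicator U x *\<^sub>R c"
    have intU: "integrable lborel ?g" using Uf by (intro integrable_scaleR_left) simp
    have "(LINT x|lborel. cmod (indicator A x *\<^sub>R c - ?g x)) = (LINT x|lborel. indicator (U - A) x * cmod c)"
      using U(2) by (intro Bochner_Integration.integral_cong) (auto split: split_indicator)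
    also have "\<dots> = measure lborel (U - A) * cmod c"
      using U(3) by (simp add: order_less_trans[OF U(3)])
    also have "\<dots> \<le> d * k"
    proof (rule mult_mono)
      show "measure lborel (U - A) \<le> d"
        unfolding measure_def using U(3) d by (intro enn2real_leI) auto
    qed (use d in \<open>auto simp: k_def\<close>)
    also have "\<dots> = e / 2" using c1 by (simp add: d_def)
    also have "\<dots> < e" using e by simp
    finally have "(LINT x|lborel. cmod (indicator A x *\<^sub>R c - ?g x)) < e" .
    moreover have "(\<lambda>n. LINT x|lborel. cmod (?g (x + X n) - ?g x)) \<longlonglongrightarrow> 0"
    proof -
      have "(\<lambda>n. (LINT x|lborel. \<bar>indicator U (x + X n) - indicator U x\<bar>) * cmod c) \<longlonglongrightarrow> 0 * cmod c"
        by (intro tendsto_mult translation_continuous_open U(1) Uf X tendsto_const)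
      moreover have "cmod (?g (x + X n) - ?g x) = \<bar>indicator U (x + X n) - indicator U x\<bar> * cmod c" for x n
        by (simp flip: scaleR_diff_left)
      ultimately show ?thesis by simp
    qed
    ultimately show "\<exists>g. integrable lborel g \<and> (LINT x|lborel. cmod (indicator A x *\<^sub>R c - g x)) < e \<and>
      (\<lambda>n. LINT x|lborel. cmod (g (x + X n) - g x)) \<longlonglongrightarrow> 0"
      using intU by (intro exI[of _ ?g] conjI)
  qed
next
  case (add f g)
  note ints = add(1,2) translate_integrable(1)[OF add(1)] translate_integrable(1)[OF add(2)]
  have lim: "(\<lambda>n. (LINT x|lborel. cmod (f (x + X n) - f x)) + (LINT x|lborel. cmod (g (x + X n) - g x))) \<longlonglongrightarrow> 0 + 0"
    using add by (intro tendsto_add)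
  show ?case
  proof (rule Lim_null_comparison[OF _ lim[unfolded add_0_left]], rule always_eventually, rule allI)
    fix n
    have "(LINT x|lborel. cmod (f (x + X n) + g (x + X n) - (f x + g x)))
        \<le> (LINT x|lborel. cmod (f (x + X n) - f x) + cmod (g (x + X n) - g x))"
    proof (rule integral_mono)
      show "cmod (f (x + X n) + g (x + X n) - (f x + g x)) \<le> cmod (f (x + X n) - f x) + cmod (g (x + X n) - g x)" for x
        by norm
    qed (intro Bochner_Integration.integrable_add integrable_norm Bochner_Integration.integrable_diff ints)+
    also have "\<dots> = (LINT x|lborel. cmod (f (x + X n) - f x)) + (LINT x|lborel. cmod (g (x + X n) - g x))"
      using ints by simp
    finally show "norm (LINT x|lborel. cmod (f (x + X n) + g (x + X n) - (f x + g x)))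
        \<le> (LINT x|lborel. cmod (f (x + X n) - f x)) + (LINT x|lborel. cmod (g (x + X n) - g x))" by simp
  qed
next
  case (lim f s)
  have intf: "integrable lborel f" by fact
  have ints: "integrable lborel (s i)" for i by fact
  have slim: "(\<lambda>i. s i x) \<longlonglongrightarrow> f x" for x using lim.hyps by simp
  have sle: "norm (s i x) \<le> 2 * norm (f x)" for i x using lim.hyps by simp
  show ?case
  proof (rule translation_continuous_approx[OF intf X])
    fix e :: real assume e: "0 < e"
    have "(\<lambda>i. LINT x|lborel. cmod (f x - s i x)) \<longlonglongrightarrow> (LINT x::real|lborel. 0)"
    proof (rule integral_dominated_convergence[where w="\<lambda>x. 3 * cmod (f x)"])
      show "AE x in lborel. (\<lambda>i. cmod (f x - s i x)) \<longlonglongrightarrow> 0"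
      proof (rule AE_I2)
        fix x :: real
        have "(\<lambda>i. f x - s i x) \<longlonglongrightarrow> f x - f x"
          by (intro tendsto_diff tendsto_const slim)
        then show "(\<lambda>i. cmod (f x - s i x)) \<longlonglongrightarrow> 0" by (simp add: tendsto_norm_zero)
      qed
      show "AE x in lborel. norm (cmod (f x - s i x)) \<le> 3 * cmod (f x)" for i
      proof (rule AE_I2)
        fix x :: real
        show "norm (cmod (f x - s i x)) \<le> 3 * cmod (f x)"
          using sle[of i x] norm_triangle_ineq4[of "f x" "s i x"] by simp
      qed
    qed (use intf ints in auto)
    then have "(\<lambda>i. LINT x|lborel. cmod (f x - s i x)) \<longlonglongrightarrow> 0" by simp
    then have "\<forall>\<^sub>F i in sequentially. (LINT x|lborel. cmod (f x - s i x)) < e"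
      using e by (rule order_tendstoD)
    then obtain i where "(LINT x|lborel. cmod (f x - s i x)) < e"
      by (auto simp: eventually_sequentially)
    then show "\<exists>g. integrable lborel g \<and> (LINT x|lborel. cmod (f x - g x)) < e \<and>
      (\<lambda>n. LINT x|lborel. cmod (g (x + X n) - g x)) \<longlonglongrightarrow> 0"
      using ints lim.IH by blast
  qed
qed

section \<open>Autocorrelations and Gaussian regularisation\<close>

lemma L2_inner_diff_right: "f \<in> L2 \<Longrightarrow> g \<in> L2 \<Longrightarrow> h \<in> L2 \<Longrightarrow>
    L2_inner f (\<lambda>x. g x - h x) = L2_inner f g - L2_inner f h"
  using L2_mult_integrable(3)[of f g] L2_mult_integrable(3)[of f h]
  by (simp add: L2_inner_def right_diff_distrib)

lemma L2_inner_diff_left: "f \<in> L2 \<Longrightarrow> g \<in> L2 \<Longrightarrow> h \<in> L2 \<Longrightarrow>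
    L2_inner (\<lambda>x. f x - g x) h = L2_inner f h - L2_inner g h"
  using L2_mult_integrable(3)[of f h] L2_mult_integrable(3)[of g h]
  by (simp add: L2_inner_def left_diff_distrib)

lemma cnj_L2_inner: "cnj (L2_inner f g) = L2_inner g f"
  unfolding L2_inner_def by (subst Bochner_Integration.integral_cnj[symmetric]) (simp add: mult.commute)

text \<open>Continuity in L1 suffices for the autocorrelation: \<open>f\<close> is cut at height
  \<open>K\<close>, the bounded part is paired with the small L1 difference, and the part that was
  cut off is small in L2 while the difference stays below \<open>2 * L2_norm f\<close>.\<close>

lemma translation_continuous_inner:
  assumes f: "f \<in> L2" "integrable lborel f" and X: "X \<longlonglongrightarrow> 0"
  shows "(\<lambda>n. L2_inner f (\<lambda>x. f (x + X n))) \<longlonglongrightarrow> L2_inner f f"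
proof (rule LIMSEQ_I)
  note [measurable] = L2_measurable[OF f(1)]
  fix e :: real assume e: "0 < e"
  let ?h = "\<lambda>n x. f (x + X n) - f x"
  define t where "t K x = (if cmod (f x) \<le> real K then f x else 0)" for K x
  have tL: "t K \<in> L2" for K
    by (rule L2_dominated(1)[OF f(1), of _ 1]) (simp_all add: t_def[abs_def])
  have "(\<lambda>K. L2_norm (\<lambda>x. f x - t K x)) \<longlonglongrightarrow> 0"
  proof (rule L2_norm_dominated_convergence_seq[OF _ f(1)])
    show "AE x in lborel. (\<lambda>K. f x - t K x) \<longlonglongrightarrow> 0"
    proof (rule AE_I2, rule tendsto_eventually)
      fix x
      obtain N :: nat where "cmod (f x) \<le> real N" using real_arch_simple by blast
      then show "\<forall>\<^sub>F K in sequentially. f x - t K x = 0"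
        by (intro eventually_sequentiallyI[of N]) (auto simp: t_def)
    qed
  qed (simp_all add: t_def[abs_def])
  then have "(\<lambda>K. L2_norm (\<lambda>x. f x - t K x) * (2 * L2_norm f)) \<longlonglongrightarrow> 0 * (2 * L2_norm f)"
    by (intro tendsto_intros)
  then have "\<forall>\<^sub>F K in sequentially. L2_norm (\<lambda>x. f x - t K x) * (2 * L2_norm f) < e / 2"
    using e by (intro order_tendstoD) auto
  then obtain K where K: "L2_norm (\<lambda>x. f x - t K x) * (2 * L2_norm f) < e / 2"
    by (auto simp: eventually_sequentially)
  have "(\<lambda>n. real K * (LINT x|lborel. cmod (?h n x))) \<longlonglongrightarrow> real K * 0"
    by (intro tendsto_intros translation_continuous_L1 f X)
  then have "\<forall>\<^sub>F n in sequentially. real K * (LINT x|lborel. cmod (?h n x)) < e / 2"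
    using e by (intro order_tendstoD) auto
  then obtain N where N: "\<And>n. n \<ge> N \<Longrightarrow> real K * (LINT x|lborel. cmod (?h n x)) < e / 2"
    by (auto simp: eventually_sequentially)
  have "norm (L2_inner f (\<lambda>x. f (x + X n)) - L2_inner f f) < e" if n: "n \<ge> N" for n
  proof -
    have h: "?h n \<in> L2" by (intro L2_diff L2_translate f)
    have hi: "integrable lborel (?h n)"
      by (intro Bochner_Integration.integrable_diff translate_integrable f)
    have hN: "L2_norm (?h n) \<le> 2 * L2_norm f"
      using L2_norm_triangle[OF L2_translate(1)[OF f(1), of "X n"] L2_cmult[OF f(1), of "-1"]]
        L2_translate(2)[OF f(1), of "X n"] L2_norm_cmult[of "-1" f] by simp
    have "L2_inner f (\<lambda>x. f (x + X n)) - L2_inner f f = L2_inner f (?h n)"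
      by (intro L2_inner_diff_right[symmetric] L2_translate f)
    also have "\<dots> = L2_inner (\<lambda>x. f x - t K x) (?h n) + L2_inner (t K) (?h n)"
      using L2_inner_diff_left[OF f(1) tL h] by simp
    finally have "norm (L2_inner f (\<lambda>x. f (x + X n)) - L2_inner f f)
        \<le> cmod (L2_inner (\<lambda>x. f x - t K x) (?h n)) + cmod (L2_inner (t K) (?h n))"
      using norm_triangle_ineq by metis
    also have "cmod (L2_inner (\<lambda>x. f x - t K x) (?h n)) \<le> L2_norm (\<lambda>x. f x - t K x) * (2 * L2_norm f)"
      by (rule order_trans[OF L2_Cauchy_Schwarz[OF L2_diff[OF f(1) tL] h]]) (intro mult_left_mono hN, simp)
    also have "cmod (L2_inner (t K) (?h n)) \<le> (LINT x|lborel. cmod (cnj (t K x) * ?h n x))"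
      unfolding L2_inner_def by (rule integral_norm_bound)
    also have "\<dots> \<le> (LINT x|lborel. real K * cmod (?h n x))"
    proof (rule integral_mono)
      show "cmod (cnj (t K x) * ?h n x) \<le> real K * cmod (?h n x)" for x
        unfolding norm_mult by (rule mult_right_mono) (auto simp: t_def)
      show "integrable lborel (\<lambda>x. cmod (cnj (t K x) * ?h n x))"
        by (intro integrable_norm L2_mult_integrable tL h)
    qed (intro integrable_mult_right integrable_norm hi)
    also have "\<dots> = real K * (LINT x|lborel. cmod (?h n x))" by simp
    finally show ?thesis using K N[OF n] by linarith
  qed
  then show "\<exists>N. \<forall>n\<ge>N. norm (L2_inner f (\<lambda>x. f (x + X n)) - L2_inner f f) < e" by blast
qed

text \<open>The substitution \<open>y = x + d * u\<close> turns the kernel of width \<open>d\<close>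
  into the standard normal density, so that \<open>d\<close> survives only in the translation of
  \<open>f\<close>.\<close>

lemma fourier_gauss_mollifier:
  assumes f: "integrable lborel f" and d: "0 < d"
  shows "fourier (\<lambda>\<xi>. fourier f \<xi> * gauss_wave (of_real (d\<^sup>2)) 0 \<xi>) (- x)
      = (LINT u|lborel. of_real (std_normal_density u) * f (x + d * u))"
proof -
  have d2: "0 < Re (of_real (d\<^sup>2) :: complex)" using d by simp
  have "fourier (\<lambda>\<xi>. fourier f \<xi> * gauss_wave (of_real (d\<^sup>2)) 0 \<xi>) (- x)
      = of_real (1 / sqrt (2 * pi)) * (LINT \<xi>|lborel. fourier f \<xi> * gauss_wave (of_real (d\<^sup>2)) x \<xi>)"
    unfolding fourier_def[of "\<lambda>\<xi>. fourier f \<xi> * _ \<xi>"]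
    by (intro arg_cong[of _ _ "\<lambda>x. _ * x"] Bochner_Integration.integral_cong)
      (auto simp: gauss_wave_def exp_add[symmetric] algebra_simps)
  also have "\<dots> = of_real (1 / sqrt (2 * pi)) *
      ((LINT y|lborel. f y * exp (- of_real ((x - y)\<^sup>2) / (2 * of_real (d\<^sup>2)))) / csqrt (of_real (d\<^sup>2)))"
    by (simp only: fourier_gauss_regularised[OF f d2])
  also have "csqrt (of_real (d\<^sup>2)) = of_real d"
    using d by (simp only: csqrt_of_real zero_le_power2 real_sqrt_abs) simp
  also have "(LINT y|lborel. f y * exp (- of_real ((x - y)\<^sup>2) / (2 * of_real (d\<^sup>2))))
      = of_real d * (LINT u|lborel. f (x + d * u) * exp (- of_real ((x - (x + d * u))\<^sup>2) / (2 * of_real (d\<^sup>2))))"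
    using d lborel_integral_real_affine[of d "\<lambda>y. f y * exp (- of_real ((x - y)\<^sup>2) / (2 * of_real (d\<^sup>2)))" x]
    by (simp add: scaleR_conv_of_real)
  also have "of_real (1 / sqrt (2 * pi)) * (of_real d * (LINT u|lborel. f (x + d * u) *
        exp (- of_real ((x - (x + d * u))\<^sup>2) / (2 * of_real (d\<^sup>2)))) / of_real d)
      = of_real (1 / sqrt (2 * pi)) * (LINT u|lborel. f (x + d * u) *
        exp (- of_real ((x - (x + d * u))\<^sup>2) / (2 * of_real (d\<^sup>2))))"
    using d by simp
  also have "\<dots> = (LINT u|lborel. of_real (std_normal_density u) * f (x + d * u))"
  proof (subst integral_mult_right_zero[symmetric], rule Bochner_Integration.integral_cong)
    fix u :: real
    have "- complex_of_real ((x - (x + d * u))\<^sup>2) / (2 * of_real (d\<^sup>2)) = of_real (- u\<^sup>2 / 2)"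
      using d by (simp add: power2_eq_square field_simps)
    then have "exp (- complex_of_real ((x - (x + d * u))\<^sup>2) / (2 * of_real (d\<^sup>2))) = of_real (exp (- u\<^sup>2 / 2))"
      by (simp only: exp_of_real)
    then show "of_real (1 / sqrt (2 * pi)) * (f (x + d * u) *
        exp (- of_real ((x - (x + d * u))\<^sup>2) / (2 * of_real (d\<^sup>2))))
        = of_real (std_normal_density u) * f (x + d * u)"
      by (simp add: std_normal_density_def mult_ac)
  qed simp
  finally show ?thesis .
qed

text \<open>Duality removes one transform, regularised inversion undoes the other, and Fubini
  collects the translates of \<open>f\<close> into an autocorrelation. Cauchy-Schwarz bounds the
  inner integral by \<open>(L2_norm f)\<^sup>2\<close>, which makes the double integral absolutely
  convergent.\<close>

lemma gaussian_weighted_plancherel: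
  assumes f: "f \<in> L2" "integrable lborel f" and d: "0 < d"
  shows "(LINT \<xi>|lborel. cnj (fourier f \<xi>) * (fourier f \<xi> * gauss_wave (of_real (d\<^sup>2)) 0 \<xi>))
      = (LINT u|lborel. of_real (std_normal_density u) * L2_inner f (\<lambda>x. f (x + d * u)))"
proof -
  note [measurable] = L2_measurable[OF f(1)]
  have d2: "0 < Re (of_real (d\<^sup>2) :: complex)" using d by simp
  have fc: "integrable lborel (\<lambda>x. cnj (f x))" using f by simp
  let ?h = "\<lambda>\<xi>. fourier f \<xi> * gauss_wave (of_real (d\<^sup>2)) 0 \<xi>"
  have h: "integrable lborel ?h"
  proof (rule integrable_mult_bounded)
    show "integrable lborel (gauss_wave (of_real (d\<^sup>2)) 0)"
      using gauss_wave_moment_integrable[OF d2, of 0] by simp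
  qed (use fourier_measurable[OF f(2)] cmod_fourier_le in auto)
  have "(LINT \<xi>|lborel. cnj (fourier f \<xi>) * ?h \<xi>)
      = (LINT \<xi>|lborel. fourier (\<lambda>x. cnj (f x)) (- \<xi>) * ?h \<xi>)" by (simp add: fourier_cnj)
  also have "\<dots> = (LINT \<xi>|lborel. fourier (\<lambda>x. cnj (f x)) \<xi> * ?h (- \<xi>))"
    using lborel_integral_real_affine[of "-1" "\<lambda>\<xi>. fourier (\<lambda>x. cnj (f x)) (- \<xi>) * ?h \<xi>" 0] by simp
  also have "\<dots> = (LINT x|lborel. cnj (f x) * fourier (\<lambda>\<xi>. ?h (- \<xi>)) x)"
    by (rule fourier_swap[OF fc integrable_reflect[OF h]])
  also have "\<dots> = (LINT x|lborel. (LINT u|lborel. of_real (std_normal_density u) * (cnj (f x) * f (x + d * u))))"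
  proof (rule Bochner_Integration.integral_cong[OF refl])
    fix x
    have "fourier (\<lambda>\<xi>. ?h (- \<xi>)) x = fourier ?h (- x)" by (rule fourier_reflect)
    also have "\<dots> = (LINT u|lborel. of_real (std_normal_density u) * f (x + d * u))"
      by (rule fourier_gauss_mollifier[OF f(2) d])
    finally show "cnj (f x) * fourier (\<lambda>\<xi>. ?h (- \<xi>)) x
        = (LINT u|lborel. of_real (std_normal_density u) * (cnj (f x) * f (x + d * u)))"
      by (simp only: integral_mult_right_zero[symmetric] mult.left_commute[of "cnj _"])
  qed
  also have "\<dots> = (LINT u|lborel. (LINT x|lborel. of_real (std_normal_density u) * (cnj (f x) * f (x + d * u))))"
  proof (rule lborel_pair.Fubini_integral)
    let ?K = "\<lambda>u x. of_real (std_normal_density u) * (cnj (f x) * f (x + d * u))"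
    show "integrable (lborel \<Otimes>\<^sub>M lborel) (case_prod ?K)"
    proof (rule lborel_pair.Fubini_integrable)
      show meas: "case_prod ?K \<in> borel_measurable (lborel \<Otimes>\<^sub>M lborel)"
        unfolding split_beta' by measurable
      have shift: "(\<lambda>x. f (x + d * u)) \<in> L2" "L2_norm (\<lambda>x. f (x + d * u)) = L2_norm f" for u
        using L2_translate[OF f(1)] by auto
      have bound: "(LINT x|lborel. norm (?K u x)) \<le> std_normal_density u * (L2_norm f)\<^sup>2" for u
      proof -
        have "(LINT x|lborel. norm (?K u x)) = std_normal_density u * (LINT x|lborel. cmod (f x) * cmod (f (x + d * u)))"
          by (simp add: norm_mult)
        also have "\<dots> \<le> std_normal_density u * (L2_norm f * L2_norm (\<lambda>x. f (x + d * u)))"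
          by (intro mult_left_mono L2_Cauchy_Schwarz_abs f shift) simp
        finally show ?thesis by (simp add: shift power2_eq_square)
      qed
      show "AE u in lborel. integrable lborel (\<lambda>x. case (u, x) of (u, x) \<Rightarrow> ?K u x)"
        using L2_mult_integrable(3)[OF f(1) shift(1)] by simp
      show "integrable lborel (\<lambda>u. LINT x|lborel. norm (case (u, x) of (u, x) \<Rightarrow> ?K u x))"
      proof (rule Bochner_Integration.integrable_bound)
        show "integrable lborel (\<lambda>u. std_normal_density u * (L2_norm f)\<^sup>2)"
          using integrable_std_normal_moment[of 0] by simp
        show "(\<lambda>u. LINT x|lborel. norm (case (u, x) of (u, x) \<Rightarrow> ?K u x)) \<in> borel_measurable lborel"
          using measurable_compose[OF meas borel_measurable_norm] by (intro lborel.borel_measurable_lebesgue_integral) (simp add: split_beta')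
        show "AE u in lborel. norm (LINT x|lborel. norm (case (u, x) of (u, x) \<Rightarrow> ?K u x))
            \<le> norm (std_normal_density u * (L2_norm f)\<^sup>2)"
          using bound by (auto intro!: AE_I2 order_trans[OF _ abs_ge_self])
      qed
    qed
  qed
  also have "\<dots> = (LINT u|lborel. of_real (std_normal_density u) * L2_inner f (\<lambda>x. f (x + d * u)))"
    by (simp only: L2_inner_def integral_mult_right_zero)
  finally show ?thesis .
qed

text \<open>The width tends to \<open>0\<close>. The autocorrelation side converges by dominated
  convergence. The Fourier side increases, so monotone convergence proves square integrability and
  identifies the norm at once.\<close>

theorem plancherel_L1:
  assumes f: "f \<in> L2" "integrable lborel f"
  shows "fourier f \<in> L2" and "L2_norm (fourier f) = L2_norm f"
proof -
  note [measurable] = L2_measurable[OF f(1)] fourier_measurable[OF f(2)]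
  define d where "d n = inverse (real (Suc n))" for n
  have d: "0 < d n" for n by (simp add: d_def)
  have d0: "d \<longlonglongrightarrow> 0" unfolding d_def by (rule LIMSEQ_inverse_real_of_nat)
  let ?q = "\<lambda>n \<xi>. (cmod (fourier f \<xi>))\<^sup>2 * exp (- ((d n)\<^sup>2 * \<xi>\<^sup>2 / 2))"
  have qint: "integrable lborel (?q n)" for n
  proof (rule Bochner_Integration.integrable_bound)
    show "integrable lborel (\<lambda>\<xi>. ((LINT x|lborel. cmod (f x)) / sqrt (2 * pi))\<^sup>2 * exp (- ((d n)\<^sup>2 * \<xi>\<^sup>2 / 2)))"
      using gaussian_moment_integrable[of "(d n)\<^sup>2" 0] d[of n] by simp
    show "AE \<xi> in lborel. norm (?q n \<xi>)
        \<le> norm (((LINT x|lborel. cmod (f x)) / sqrt (2 * pi))\<^sup>2 * exp (- ((d n)\<^sup>2 * \<xi>\<^sup>2 / 2)))"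
      using power_mono[OF cmod_fourier_le[of f] norm_ge_zero, of _ 2]
      by (intro AE_I2) (simp add: abs_mult mult_right_mono)
  qed measurable
  have "complex_of_real (LINT \<xi>|lborel. ?q n \<xi>)
      = (LINT u|lborel. of_real (std_normal_density u) * L2_inner f (\<lambda>x. f (x + d n * u)))" for n
  proof -
    have "complex_of_real (LINT \<xi>|lborel. ?q n \<xi>)
        = (LINT \<xi>|lborel. cnj (fourier f \<xi>) * (fourier f \<xi> * gauss_wave (of_real ((d n)\<^sup>2)) 0 \<xi>))"
      unfolding integral_complex_of_real[symmetric]
    proof (rule Bochner_Integration.integral_cong)
      fix \<xi> :: real
      have "gauss_wave (of_real ((d n)\<^sup>2)) 0 \<xi> = of_real (exp (- ((d n)\<^sup>2 * \<xi>\<^sup>2 / 2)))"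
        by (simp add: gauss_wave_def exp_of_real[symmetric])
      then show "complex_of_real (?q n \<xi>) = cnj (fourier f \<xi>) * (fourier f \<xi> * gauss_wave (of_real ((d n)\<^sup>2)) 0 \<xi>)"
        by (simp add: complex_norm_square mult_ac del: of_real_power flip: of_real_power)
    qed simp
    then show ?thesis using gaussian_weighted_plancherel[OF f d] by simp
  qed
  moreover have "(\<lambda>n. LINT u|lborel. of_real (std_normal_density u) * L2_inner f (\<lambda>x. f (x + d n * u)))
      \<longlonglongrightarrow> (LINT u|lborel. of_real (std_normal_density u) * L2_inner f f)"
  proof (rule integral_dominated_convergence[where w="\<lambda>u. std_normal_density u * (L2_norm f)\<^sup>2"])
    show "integrable lborel (\<lambda>u. std_normal_density u * (L2_norm f)\<^sup>2)"
      using integrable_std_normal_moment[of 0] by simp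
    have "(\<lambda>n. of_real (std_normal_density u) * L2_inner f (\<lambda>x. f (x + d n * u)))
        \<longlonglongrightarrow> of_real (std_normal_density u) * L2_inner f f" for u
    proof (intro tendsto_mult tendsto_const translation_continuous_inner f)
      show "(\<lambda>n. d n * u) \<longlonglongrightarrow> 0" using tendsto_mult[OF d0 tendsto_const, of u] by simp
    qed
    then show "AE u in lborel. (\<lambda>n. of_real (std_normal_density u) * L2_inner f (\<lambda>x. f (x + d n * u)))
        \<longlonglongrightarrow> of_real (std_normal_density u) * L2_inner f f" by simp
    show "AE u in lborel. norm (of_real (std_normal_density u) * L2_inner f (\<lambda>x. f (x + d n * u)))
        \<le> std_normal_density u * (L2_norm f)\<^sup>2" for n
    proof (rule AE_I2)
      fix u
      have "cmod (L2_inner f (\<lambda>x. f (x + d n * u))) \<le> (L2_norm f)\<^sup>2"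
        using L2_Cauchy_Schwarz[OF f(1) L2_translate(1)[OF f(1)], of "d n * u"]
        by (simp add: L2_translate(2)[OF f(1)] power2_eq_square)
      then show "norm (of_real (std_normal_density u) * L2_inner f (\<lambda>x. f (x + d n * u)))
        \<le> std_normal_density u * (L2_norm f)\<^sup>2"
        by (simp add: norm_mult mult_left_mono)
    qed
    show "(\<lambda>u. of_real (std_normal_density u) * L2_inner f (\<lambda>x. f (x + d n * u))) \<in> borel_measurable lborel" for n
      unfolding L2_inner_def
      by (intro borel_measurable_times lborel.borel_measurable_lebesgue_integral) measurable
  qed simp
  moreover have "(LINT u|lborel. of_real (std_normal_density u) * L2_inner f f) = of_real ((L2_norm f)\<^sup>2)"
  proof -
    have "(LINT u|lborel. complex_of_real (std_normal_density u)) = 1"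
      using integral_normal_density[of 1 0] by (simp add: integral_complex_of_real)
    then show ?thesis by (simp add: L2_inner_self)
  qed
  ultimately have "(\<lambda>n. complex_of_real (LINT \<xi>|lborel. ?q n \<xi>)) \<longlonglongrightarrow> of_real ((L2_norm f)\<^sup>2)"
    by (simp only:)
  then have lim: "(\<lambda>n. LINT \<xi>|lborel. ?q n \<xi>) \<longlonglongrightarrow> (L2_norm f)\<^sup>2"
    by (simp only: tendsto_of_real_iff)
  have mono: "AE \<xi> in lborel. mono (\<lambda>n. ?q n \<xi>)"
  proof (intro AE_I2 monoI mult_left_mono)
    fix \<xi> :: real and m n :: nat assume "m \<le> n"
    then have "d n \<le> d m" by (simp add: d_def)
    then have "(d n)\<^sup>2 * \<xi>\<^sup>2 \<le> (d m)\<^sup>2 * \<xi>\<^sup>2"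
      using d[of n] by (intro mult_right_mono power_mono) auto
    then show "exp (- ((d m)\<^sup>2 * \<xi>\<^sup>2 / 2)) \<le> exp (- ((d n)\<^sup>2 * \<xi>\<^sup>2 / 2))" by simp
  qed simp
  have "(\<lambda>n. ?q n \<xi>) \<longlonglongrightarrow> (cmod (fourier f \<xi>))\<^sup>2" for \<xi>
  proof -
    have "(\<lambda>n. ?q n \<xi>) \<longlonglongrightarrow> (cmod (fourier f \<xi>))\<^sup>2 * exp (- (0\<^sup>2 * \<xi>\<^sup>2 / 2))"
      by (intro tendsto_intros d0) simp
    then show ?thesis by simp
  qed
  then have ptw: "AE \<xi> in lborel. (\<lambda>n. ?q n \<xi>) \<longlonglongrightarrow> (cmod (fourier f \<xi>))\<^sup>2" by simp
  have meas: "(\<lambda>\<xi>. (cmod (fourier f \<xi>))\<^sup>2) \<in> borel_measurable lborel" by measurable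
  show "fourier f \<in> L2"
    using integrable_monotone_convergence[OF qint mono ptw lim meas] by (simp add: L2_def)
  show "L2_norm (fourier f) = L2_norm f"
    using integral_monotone_convergence[OF qint mono ptw lim meas] by (simp add: L2_norm_def)
qed

section \<open>The Fourier transform on square integrable functions\<close>

definition truncate_at :: "real \<Rightarrow> (real \<Rightarrow> complex) \<Rightarrow> real \<Rightarrow> complex" where
  "truncate_at R f = (\<lambda>x. indicator {-R..R} x * f x)"

lemma is_fourier_L2_alt: "is_fourier_L2 f g \<longleftrightarrow>
    f \<in> L2 \<and> tendsto_L2 (\<lambda>R. fourier (truncate_at R f)) g at_top"
  by (simp add: is_fourier_L2_def truncate_at_def)

lemma truncate_L2:
  assumes f: "f \<in> L2" shows "truncate_at R f \<in> L2" "integrable lborel (truncate_at R f)"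
proof -
  note [measurable] = L2_measurable[OF f]
  show "truncate_at R f \<in> L2"
    by (rule L2_dominated(1)[OF f, of _ 1]) (auto simp: truncate_at_def split: split_indicator)
  have "(indicator {-R..R} :: real \<Rightarrow> complex) \<in> L2"
  proof (rule L2_integrable_bounded[where C=1])
    have "integrable lborel (\<lambda>x. complex_of_real (indicator {-R..R} x))"
      by (intro integrable_of_real integrable_real_indicator) (auto simp: emeasure_lborel_Icc_eq)
    then show "integrable lborel (indicator {-R..R} :: real \<Rightarrow> complex)"
      by (rule back_subst[where P="integrable lborel"]) (auto split: split_indicator)
  qed (simp split: split_indicator)
  from L2_mult_integrable(1)[OF this f] show "integrable lborel (truncate_at R f)"
    by (simp add: truncate_at_def)
qed

lemma truncate_tendsto_L2:
  assumes f: "f \<in> L2" shows "((\<lambda>R. L2_norm (\<lambda>x. truncate_at R f x - f x)) \<longlongrightarrow> 0) at_top"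
proof (rule L2_norm_dominated_convergence_at_top[OF _ f])
  note [measurable] = L2_measurable[OF f]
  show "(\<lambda>x. truncate_at R f x - f x) \<in> borel_measurable borel" for R
    unfolding truncate_at_def by measurable
  show "AE x in lborel. cmod (truncate_at R f x - f x) \<le> cmod (f x)" for R
    by (auto simp: truncate_at_def split: split_indicator)
  show "AE x in lborel. ((\<lambda>R. truncate_at R f x - f x) \<longlongrightarrow> 0) at_top"
  proof (rule AE_I2, rule tendsto_eventually)
    fix x :: real
    show "\<forall>\<^sub>F R in at_top. truncate_at R f x - f x = 0"
      using eventually_ge_at_top[of "\<bar>x\<bar>"]
      by eventually_elim (auto simp: truncate_at_def split: split_indicator)
  qed
qed

lemma truncate_norm_tendsto:
  assumes "f \<in> L2" shows "((\<lambda>R. L2_norm (truncate_at R f)) \<longlongrightarrow> L2_norm f) at_top"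
  by (rule tendsto_L2_norm[OF truncate_tendsto_L2[OF assms]]) (use assms truncate_L2 in auto)

lemma fourier_truncate_L2:
  assumes "f \<in> L2" shows "fourier (truncate_at R f) \<in> L2"
    "L2_norm (fourier (truncate_at R f)) = L2_norm (truncate_at R f)"
  using plancherel_L1[OF truncate_L2[OF assms]] by auto

lemma is_fourier_L2_I:
  assumes "f \<in> L2" "F \<in> L2"
    "((\<lambda>R. L2_norm (\<lambda>\<xi>. fourier (truncate_at R f) \<xi> - F \<xi>)) \<longlongrightarrow> 0) at_top"
  shows "is_fourier_L2 f F"
  using assms fourier_truncate_L2[OF assms(1)] by (simp add: is_fourier_L2_alt tendsto_L2_def)

lemma is_fourier_L2_D:
  assumes "is_fourier_L2 f F"
  shows "f \<in> L2" "F \<in> L2"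
    "((\<lambda>R. L2_norm (\<lambda>\<xi>. fourier (truncate_at R f) \<xi> - F \<xi>)) \<longlongrightarrow> 0) at_top"
  using assms by (auto simp: is_fourier_L2_alt tendsto_L2_def)

lemma plancherel_L2:
  assumes F: "is_fourier_L2 f F" shows "L2_norm F = L2_norm f"
proof -
  note D = is_fourier_L2_D[OF F]
  have "((\<lambda>R. L2_norm (fourier (truncate_at R f))) \<longlongrightarrow> L2_norm F) at_top"
    by (rule tendsto_L2_norm[OF D(3)]) (use D fourier_truncate_L2 in auto)
  then have "((\<lambda>R. L2_norm (truncate_at R f)) \<longlongrightarrow> L2_norm F) at_top"
    by (simp add: fourier_truncate_L2[OF D(1)])
  from tendsto_unique[OF _ this truncate_norm_tendsto[OF D(1)]] show ?thesis by simp
qed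

lemma is_fourier_L2_cmult:
  assumes F: "is_fourier_L2 f F" shows "is_fourier_L2 (\<lambda>x. c * f x) (\<lambda>\<xi>. c * F \<xi>)"
proof (rule is_fourier_L2_I)
  note D = is_fourier_L2_D[OF F]
  show "(\<lambda>x. c * f x) \<in> L2" "(\<lambda>\<xi>. c * F \<xi>) \<in> L2" by (intro L2_cmult D)+
  have "truncate_at R (\<lambda>x. c * f x) = (\<lambda>x. c * truncate_at R f x)" for R
    by (auto simp: truncate_at_def)
  then have "(\<lambda>\<xi>. fourier (truncate_at R (\<lambda>x. c * f x)) \<xi> - c * F \<xi>)
      = (\<lambda>\<xi>. c * (fourier (truncate_at R f) \<xi> - F \<xi>))" for R
    by (simp add: fourier_cmult right_diff_distrib)
  then have "L2_norm (\<lambda>\<xi>. fourier (truncate_at R (\<lambda>x. c * f x)) \<xi> - c * F \<xi>)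
      = cmod c * L2_norm (\<lambda>\<xi>. fourier (truncate_at R f) \<xi> - F \<xi>)" for R
    by (simp only: L2_norm_cmult)
  moreover have "((\<lambda>R. cmod c * L2_norm (\<lambda>\<xi>. fourier (truncate_at R f) \<xi> - F \<xi>)) \<longlongrightarrow> cmod c * 0) at_top"
    by (intro tendsto_intros D)
  ultimately show "((\<lambda>R. L2_norm (\<lambda>\<xi>. fourier (truncate_at R (\<lambda>x. c * f x)) \<xi> - c * F \<xi>)) \<longlongrightarrow> 0) at_top"
    by simp
qed

lemma is_fourier_L2_add:
  assumes F: "is_fourier_L2 f F" and G: "is_fourier_L2 g G"
  shows "is_fourier_L2 (\<lambda>x. f x + g x) (\<lambda>\<xi>. F \<xi> + G \<xi>)"
proof (rule is_fourier_L2_I)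
  note D = is_fourier_L2_D[OF F] is_fourier_L2_D[OF G]
  show "(\<lambda>x. f x + g x) \<in> L2" "(\<lambda>\<xi>. F \<xi> + G \<xi>) \<in> L2" by (intro L2_add D)+
  have eq: "fourier (truncate_at R (\<lambda>x. f x + g x)) \<xi> - (F \<xi> + G \<xi>)
      = (fourier (truncate_at R f) \<xi> - F \<xi>) + (fourier (truncate_at R g) \<xi> - G \<xi>)" for R \<xi>
  proof -
    have "truncate_at R (\<lambda>x. f x + g x) = (\<lambda>x. truncate_at R f x + truncate_at R g x)"
      by (auto simp: truncate_at_def algebra_simps)
    then show ?thesis using fourier_add[OF truncate_L2(2)[OF D(1)] truncate_L2(2)[OF D(4)]] by simp
  qed
  have lim: "((\<lambda>R. L2_norm (\<lambda>\<xi>. fourier (truncate_at R f) \<xi> - F \<xi>)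
      + L2_norm (\<lambda>\<xi>. fourier (truncate_at R g) \<xi> - G \<xi>)) \<longlongrightarrow> 0) at_top"
    using tendsto_add[OF D(3) D(6)] by simp
  show "((\<lambda>R. L2_norm (\<lambda>\<xi>. fourier (truncate_at R (\<lambda>x. f x + g x)) \<xi> - (F \<xi> + G \<xi>))) \<longlongrightarrow> 0) at_top"
  proof (rule Lim_null_comparison[OF always_eventually lim], rule allI)
    fix R
    show "norm (L2_norm (\<lambda>\<xi>. fourier (truncate_at R (\<lambda>x. f x + g x)) \<xi> - (F \<xi> + G \<xi>)))
      \<le> L2_norm (\<lambda>\<xi>. fourier (truncate_at R f) \<xi> - F \<xi>) + L2_norm (\<lambda>\<xi>. fourier (truncate_at R g) \<xi> - G \<xi>)"
      unfolding eq real_norm_def abs_of_nonneg[OF L2_norm_nonneg]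
      by (intro L2_norm_triangle L2_diff fourier_truncate_L2 D)
  qed
qed

lemma is_fourier_L2_diff:
  assumes F: "is_fourier_L2 f F" and G: "is_fourier_L2 g G"
  shows "is_fourier_L2 (\<lambda>x. f x - g x) (\<lambda>\<xi>. F \<xi> - G \<xi>)"
  using is_fourier_L2_add[OF F is_fourier_L2_cmult[OF G, of "-1"]] by simp

lemma is_fourier_L2_L1:
  assumes f: "f \<in> L2" "integrable lborel f" shows "is_fourier_L2 f (fourier f)"
proof (rule is_fourier_L2_I)
  show "f \<in> L2" "fourier f \<in> L2" using plancherel_L1[OF f] f by auto
  have "L2_norm (\<lambda>\<xi>. fourier (truncate_at R f) \<xi> - fourier f \<xi>) = L2_norm (\<lambda>x. truncate_at R f x - f x)" for R
  proof -
    have "(\<lambda>\<xi>. fourier (truncate_at R f) \<xi> - fourier f \<xi>) = fourier (\<lambda>x. truncate_at R f x - f x)"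
      by (rule ext) (rule fourier_diff[OF truncate_L2(2)[OF f(1)] f(2), symmetric])
    then show ?thesis
      by (simp add: plancherel_L1(2)[OF L2_diff[OF truncate_L2(1)[OF f(1)] f(1)]] f truncate_L2)
  qed
  then show "((\<lambda>R. L2_norm (\<lambda>\<xi>. fourier (truncate_at R f) \<xi> - fourier f \<xi>)) \<longlongrightarrow> 0) at_top"
    using truncate_tendsto_L2[OF f(1)] by simp
qed

lemma is_fourier_L2_unique:
  assumes F: "is_fourier_L2 f F" and G: "is_fourier_L2 g G" and eq: "AE x in lborel. f x = g x"
  shows "AE \<xi> in lborel. F \<xi> = G \<xi>"
proof -
  note D = is_fourier_L2_D[OF F] is_fourier_L2_D[OF G]
  have d: "is_fourier_L2 (\<lambda>x. f x - g x) (\<lambda>\<xi>. F \<xi> - G \<xi>)" by (rule is_fourier_L2_diff[OF F G])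
  note [measurable] = D(1)[THEN L2_measurable] D(4)[THEN L2_measurable]
  have "L2_norm (\<lambda>x. f x - g x) = L2_norm (\<lambda>x. 0)"
    by (rule L2_norm_cong_AE) (use eq in auto)
  then have "L2_norm (\<lambda>\<xi>. F \<xi> - G \<xi>) = 0" by (simp add: plancherel_L2[OF d] L2_norm_def)
  from L2_norm_eq_0[OF L2_diff[OF D(2,5)] this] show ?thesis by simp
qed

lemma is_fourier_L2_cong:
  assumes F: "is_fourier_L2 f F" and [measurable]: "g \<in> borel_measurable borel" "G \<in> borel_measurable borel"
    and fg: "AE x in lborel. f x = g x" and FG: "AE \<xi> in lborel. F \<xi> = G \<xi>"
  shows "is_fourier_L2 g G"
proof (rule is_fourier_L2_I)
  note D = is_fourier_L2_D[OF F]
  note [measurable] = D(1,2)[THEN L2_measurable]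
  show g: "g \<in> L2" by (rule L2_cong_AE(1)[OF D(1)]) (use fg in \<open>auto elim: eventually_mono\<close>)
  show G: "G \<in> L2" by (rule L2_cong_AE(1)[OF D(2)]) (use FG in \<open>auto elim: eventually_mono\<close>)
  have "fourier (truncate_at R g) = fourier (truncate_at R f)" for R
  proof (rule ext, rule fourier_cong_AE)
    show "AE x in lborel. truncate_at R g x = truncate_at R f x"
      using fg by eventually_elim (simp add: truncate_at_def)
  qed (simp_all add: truncate_at_def)
  moreover have "L2_norm (\<lambda>\<xi>. fourier (truncate_at R f) \<xi> - G \<xi>) = L2_norm (\<lambda>\<xi>. fourier (truncate_at R f) \<xi> - F \<xi>)" for R
  proof (rule L2_norm_cong_AE)
    show "AE x in lborel. fourier (truncate_at R f) x - G x = fourier (truncate_at R f) x - F x"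
      using FG by eventually_elim simp
  qed (use L2_measurable[OF fourier_truncate_L2(1)[OF D(1)]] in simp_all)
  ultimately show "((\<lambda>R. L2_norm (\<lambda>\<xi>. fourier (truncate_at R g) \<xi> - G \<xi>)) \<longlongrightarrow> 0) at_top"
    using D(3) by simp
qed

lemma is_fourier_L2_modulate:
  assumes F: "is_fourier_L2 f F"
  shows "is_fourier_L2 (\<lambda>x. exp (\<i> * of_real (c * x)) * f x) (\<lambda>\<xi>. F (\<xi> - c))"
proof (rule is_fourier_L2_I)
  note D = is_fourier_L2_D[OF F]
  note [measurable] = D(1)[THEN L2_measurable]
  have [measurable]: "(\<lambda>x. exp (\<i> * of_real (c * x))) \<in> borel_measurable borel"
    by (intro borel_measurable_continuous_onI continuous_intros)
  show "(\<lambda>x. exp (\<i> * of_real (c * x)) * f x) \<in> L2"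
    by (rule L2_dominated(1)[OF D(1), of _ 1]) (auto simp: norm_mult)
  show "(\<lambda>\<xi>. F (\<xi> - c)) \<in> L2" using L2_translate(1)[OF D(2), of "-c"] by simp
  have "fourier (truncate_at R (\<lambda>x. exp (\<i> * of_real (c * x)) * f x)) \<xi> = fourier (truncate_at R f) (\<xi> - c)" for R \<xi>
    unfolding fourier_modulate[symmetric] by (simp add: truncate_at_def mult_ac)
  moreover have "L2_norm (\<lambda>\<xi>. fourier (truncate_at R f) (\<xi> - c) - F (\<xi> - c))
      = L2_norm (\<lambda>\<xi>. fourier (truncate_at R f) \<xi> - F \<xi>)" for R
    using L2_translate(2)[OF L2_diff[OF fourier_truncate_L2(1)[OF D(1), of R] D(2)], of "-c"] by simp
  ultimately show "((\<lambda>R. L2_norm (\<lambda>\<xi>. fourier (truncate_at R (\<lambda>x. exp (\<i> * of_real (c * x)) * f x)) \<xi> - F (\<xi> - c))) \<longlongrightarrow> 0) at_top"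
    using D(3) by (simp only:)
qed

section \<open>Duality and inversion in L2\<close>

lemma fourier_inner_swap:
  assumes F: "integrable lborel F" and g: "integrable lborel g"
  shows "L2_inner (\<lambda>x. fourier F (- x)) g = L2_inner F (fourier g)"
proof -
  have "L2_inner (\<lambda>x. fourier F (- x)) g = (LINT x|lborel. fourier (\<lambda>\<xi>. cnj (F \<xi>)) x * g x)"
    by (simp add: L2_inner_def fourier_cnj)
  also have "\<dots> = L2_inner F (fourier g)"
    unfolding L2_inner_def using F g by (intro fourier_swap) auto
  finally show ?thesis .
qed

lemma tendsto_L2_inner:
  assumes lim: "((\<lambda>a. L2_norm (\<lambda>x. f a x - g x)) \<longlongrightarrow> 0) A" and f: "\<forall>\<^sub>F a in A. f a \<in> L2" and g: "g \<in> L2" and h: "h \<in> L2"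
  shows "((\<lambda>a. L2_inner h (f a)) \<longlongrightarrow> L2_inner h g) A"
proof -
  have "((\<lambda>a. L2_inner h (f a) - L2_inner h g) \<longlongrightarrow> 0) A"
  proof (rule Lim_null_comparison)
    show "\<forall>\<^sub>F a in A. norm (L2_inner h (f a) - L2_inner h g) \<le> L2_norm h * L2_norm (\<lambda>x. f a x - g x)"
      using f
    proof eventually_elim
      case (elim a)
      show ?case
        using L2_Cauchy_Schwarz[OF h L2_diff[OF elim g]] L2_inner_diff_right[OF h elim g] by simp
    qed
    show "((\<lambda>a. L2_norm h * L2_norm (\<lambda>x. f a x - g x)) \<longlongrightarrow> 0) A"
      using tendsto_mult[OF tendsto_const lim, of "L2_norm h"] by simp
  qed
  then show ?thesis by (simp add: LIM_zero_cancel)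
qed

lemma fourier_inverse_L2:
  assumes F: "F \<in> L2" "integrable lborel F"
  shows "(\<lambda>x. fourier F (- x)) \<in> L2" "L2_norm (\<lambda>x. fourier F (- x)) = L2_norm F"
  using L2_reflect[OF plancherel_L1(1)[OF F]] plancherel_L1(2)[OF F] by auto

text \<open>Let \<open>g\<close> be the inverse transform of \<open>F\<close>. Duality gives
  \<open>L2_inner g f = L2_inner F F\<close>, and \<open>g\<close>, \<open>F\<close>,
  \<open>f\<close> have the same norm, so expanding the square of the norm of \<open>g - f\<close>
  gives \<open>0\<close>.\<close>

lemma fourier_inversion:
  assumes F: "is_fourier_L2 f F" and int: "integrable lborel F"
  shows "AE x in lborel. f x = fourier F (- x)"
proof -
  note D = is_fourier_L2_D[OF F]
  define g where "g = (\<lambda>x. fourier F (- x))"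
  have g: "g \<in> L2" "L2_norm g = L2_norm F"
    unfolding g_def by (rule fourier_inverse_L2[OF D(2) int])+
  have "((\<lambda>R. L2_inner g (truncate_at R f)) \<longlongrightarrow> L2_inner g f) at_top"
    by (rule tendsto_L2_inner[OF truncate_tendsto_L2[OF D(1)] always_eventually[OF allI[OF truncate_L2(1)[OF D(1)]]] D(1) g(1)])
  moreover have "((\<lambda>R. L2_inner F (fourier (truncate_at R f))) \<longlongrightarrow> L2_inner F F) at_top"
    by (rule tendsto_L2_inner[OF D(3) always_eventually[OF allI[OF fourier_truncate_L2(1)[OF D(1)]]] D(2) D(2)])
  moreover have "L2_inner g (truncate_at R f) = L2_inner F (fourier (truncate_at R f))" for R
    unfolding g_def by (rule fourier_inner_swap[OF int truncate_L2(2)[OF D(1)]])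
  ultimately have "L2_inner g f = L2_inner F F"
    by (simp only:) (rule tendsto_unique[OF trivial_limit_at_top_linorder])
  then have "(L2_norm (\<lambda>x. g x - f x))\<^sup>2 = (L2_norm g)\<^sup>2 - 2 * (L2_norm F)\<^sup>2 + (L2_norm f)\<^sup>2"
    by (simp add: L2_norm_diff_power2[OF g(1) D(1)] L2_inner_self)
  then have "(L2_norm (\<lambda>x. g x - f x))\<^sup>2 = 0"
    using g plancherel_L2[OF F] by simp
  then have "AE x in lborel. g x - f x = 0"
    by (intro L2_norm_eq_0 L2_diff g D) simp
  then show ?thesis by (auto simp: g_def elim: eventually_mono)
qed

text \<open>The pairing of \<open>F\<close> with the transform of a truncation of \<open>g\<close>
  is the pairing of \<open>g\<close> with that truncation, hence the squared norm of the truncation.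
  The squared error is therefore the mass of \<open>g\<close> outside
  \<open>[-R, R]\<close>.\<close>

lemma is_fourier_L2_inverse:
  assumes F: "F \<in> L2" "integrable lborel F"
  shows "is_fourier_L2 (\<lambda>x. fourier F (- x)) F"
proof (rule is_fourier_L2_I)
  define g where "g = (\<lambda>x. fourier F (- x))"
  have g: "g \<in> L2" "L2_norm g = L2_norm F"
    unfolding g_def by (rule fourier_inverse_L2[OF F])+
  have gt: "L2_inner g (truncate_at R g) = L2_inner (truncate_at R g) (truncate_at R g)" for R
    unfolding L2_inner_def by (rule Bochner_Integration.integral_cong) (auto simp: truncate_at_def split: split_indicator)
  have "(L2_norm (\<lambda>\<xi>. fourier (truncate_at R g) \<xi> - F \<xi>))\<^sup>2 = (L2_norm g)\<^sup>2 - (L2_norm (truncate_at R g))\<^sup>2" for R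
  proof -
    have "L2_inner F (fourier (truncate_at R g)) = of_real ((L2_norm (truncate_at R g))\<^sup>2)"
      unfolding fourier_inner_swap[OF F(2) truncate_L2(2)[OF g(1)], symmetric] g_def[symmetric] gt
      by (rule L2_inner_self)
    then have "Re (L2_inner (fourier (truncate_at R g)) F) = (L2_norm (truncate_at R g))\<^sup>2"
      by (subst cnj_L2_inner[symmetric]) simp
    then show ?thesis
      by (simp add: L2_norm_diff_power2[OF fourier_truncate_L2(1)[OF g(1)] F(1)] fourier_truncate_L2(2)[OF g(1)] g(2))
  qed
  moreover have "((\<lambda>R. (L2_norm g)\<^sup>2 - (L2_norm (truncate_at R g))\<^sup>2) \<longlongrightarrow> (L2_norm g)\<^sup>2 - (L2_norm g)\<^sup>2) at_top"
    by (intro tendsto_intros truncate_norm_tendsto g)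
  ultimately have "((\<lambda>R. (L2_norm (\<lambda>\<xi>. fourier (truncate_at R g) \<xi> - F \<xi>))\<^sup>2) \<longlongrightarrow> 0) at_top" by simp
  then have "((\<lambda>R. sqrt ((L2_norm (\<lambda>\<xi>. fourier (truncate_at R g) \<xi> - F \<xi>))\<^sup>2)) \<longlongrightarrow> sqrt 0) at_top"
    by (rule tendsto_real_sqrt)
  then show "((\<lambda>R. L2_norm (\<lambda>\<xi>. fourier (truncate_at R (\<lambda>x. fourier F (- x))) \<xi> - F \<xi>)) \<longlongrightarrow> 0) at_top"
    by (simp add: g_def)
  show "(\<lambda>x. fourier F (- x)) \<in> L2" using g by (simp add: g_def)
qed fact

section \<open>Fatou's lemma and the moment bounds\<close>

lemma L2_Fatou:
  assumes f: "\<And>n. f n \<in> L2" and le: "\<And>n. L2_norm (f n) \<le> C" and [measurable]: "g \<in> borel_measurable borel"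
    and lim: "AE x in lborel. (\<lambda>n. f n x) \<longlonglongrightarrow> g x"
  shows "g \<in> L2" "L2_norm g \<le> C"
proof -
  note [measurable] = L2_measurable[OF f]
  have C: "0 \<le> C" using le[of 0] L2_norm_nonneg order_trans by blast
  have "(\<integral>\<^sup>+x. ennreal ((cmod (g x))\<^sup>2) \<partial>lborel) = (\<integral>\<^sup>+x. liminf (\<lambda>n. ennreal ((cmod (f n x))\<^sup>2)) \<partial>lborel)"
  proof (rule nn_integral_cong_AE)
    show "AE x in lborel. ennreal ((cmod (g x))\<^sup>2) = liminf (\<lambda>n. ennreal ((cmod (f n x))\<^sup>2))"
      using lim
    proof eventually_elim
      case (elim x)
      then have "(\<lambda>n. ennreal ((cmod (f n x))\<^sup>2)) \<longlonglongrightarrow> ennreal ((cmod (g x))\<^sup>2)"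
        by (intro tendsto_ennrealI tendsto_intros)
      then show ?case by (intro lim_imp_Liminf[OF trivial_limit_sequentially, symmetric])
    qed
  qed
  also have "\<dots> \<le> liminf (\<lambda>n. \<integral>\<^sup>+x. ennreal ((cmod (f n x))\<^sup>2) \<partial>lborel)"
    by (rule nn_integral_liminf) measurable
  also have "\<dots> \<le> ennreal (C\<^sup>2)"
  proof (rule Liminf_le)
    show "\<forall>\<^sub>F n in sequentially. (\<integral>\<^sup>+x. ennreal ((cmod (f n x))\<^sup>2) \<partial>lborel) \<le> ennreal (C\<^sup>2)"
    proof (intro always_eventually allI)
      fix n
      have "(\<integral>\<^sup>+x. ennreal ((cmod (f n x))\<^sup>2) \<partial>lborel) = ennreal ((L2_norm (f n))\<^sup>2)"
        unfolding L2_norm_power2 by (rule nn_integral_eq_integral[OF L2_integrable[OF f]]) simp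
      also have "\<dots> \<le> ennreal (C\<^sup>2)" by (intro ennreal_leI power_mono le) simp
      finally show "(\<integral>\<^sup>+x. ennreal ((cmod (f n x))\<^sup>2) \<partial>lborel) \<le> ennreal (C\<^sup>2)" .
    qed
  qed simp
  finally have le': "(\<integral>\<^sup>+x. ennreal ((cmod (g x))\<^sup>2) \<partial>lborel) \<le> ennreal (C\<^sup>2)" .
  then have int: "integrable lborel (\<lambda>x. (cmod (g x))\<^sup>2)"
    by (intro integrableI_bounded) (auto simp: top_unique less_top[symmetric])
  then show "g \<in> L2" by (simp add: L2_def)
  have "(\<integral>\<^sup>+x. ennreal ((cmod (g x))\<^sup>2) \<partial>lborel) = ennreal ((L2_norm g)\<^sup>2)"
    unfolding L2_norm_power2 by (rule nn_integral_eq_integral[OF int]) simp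
  with le' have "ennreal ((L2_norm g)\<^sup>2) \<le> ennreal (C\<^sup>2)" by (simp only:)
  then have "(L2_norm g)\<^sup>2 \<le> C\<^sup>2" by simp
  then show "L2_norm g \<le> C" by (rule power2_le_imp_le[OF _ C])
qed

lemma cmod_exp_minus_one_le: "cmod (exp (\<i> * of_real \<theta>) - 1) \<le> \<bar>\<theta>\<bar>"
  using cmod_exp_diff_le[of "\<i> * of_real \<theta>" 0 0] by (simp add: norm_mult)

lemma modulation_quotient_tendsto:
  "((\<lambda>h. (exp (\<i> * of_real (h * x)) - 1) / of_real h) \<longlongrightarrow> \<i> * of_real x) (at (0::real))"
proof -
  have "((\<lambda>w. exp (\<i> * (w * of_real x))) has_field_derivative \<i> * of_real x) (at 0)"
    by (auto intro!: derivative_eq_intros)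
  then have "((\<lambda>w. (exp (\<i> * (w * of_real x)) - 1) / w) \<longlongrightarrow> \<i> * of_real x) (at 0)"
    by (simp add: has_field_derivative_iff)
  moreover have "filterlim complex_of_real (at 0) (at 0)"
    by (rule filterlim_atI) (auto intro!: tendsto_eq_intros eventually_at_filter[THEN iffD2])
  ultimately show ?thesis using filterlim_compose by fastforce
qed

text \<open>Fatou's lemma for the quotients \<open>(exp (\<i> h x) - 1) / (\<i> h) * v x\<close>,
  which tend to \<open>x * v x\<close> pointwise. This is how first moments are obtained from finite
  differences.\<close>

lemma modulation_bound_imp_moment:
  assumes v: "v \<in> L2" and le: "\<And>h. L2_norm (\<lambda>x. (exp (\<i> * of_real (h * x)) - 1) * v x) \<le> D * \<bar>h\<bar>"
  shows "(\<lambda>x. of_real x * v x) \<in> L2" "L2_norm (\<lambda>x. of_real x * v x) \<le> D"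
proof -
  note [measurable] = L2_measurable[OF v]
  define h where "h n = inverse (real (Suc n))" for n
  have h: "0 < h n" for n by (simp add: h_def)
  have h0: "h \<longlonglongrightarrow> 0" unfolding h_def by (rule LIMSEQ_inverse_real_of_nat)
  let ?f = "\<lambda>n x. (exp (\<i> * of_real (h n * x)) - 1) / (\<i> * of_real (h n)) * v x"
  have [measurable]: "(\<lambda>x. exp (\<i> * of_real (c * x))) \<in> borel_measurable borel" for c
    by (intro borel_measurable_continuous_onI continuous_intros)
  have f: "?f n \<in> L2" for n
  proof (rule L2_dominated(1)[OF v, of _ "2 / h n"])
    have "cmod (exp (\<i> * of_real (h n * x)) - 1) \<le> 2" for x
      using norm_triangle_ineq4[of "exp (\<i> * of_real (h n * x))" 1] by simp
    then show "AE x in lborel. cmod (?f n x) \<le> 2 / h n * cmod (v x)"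
      using h[of n] by (auto simp: norm_mult norm_divide intro!: AE_I2 mult_right_mono divide_right_mono)
  qed (use h[of n] in auto)
  have fle: "L2_norm (?f n) \<le> D" for n
  proof -
    have "L2_norm (?f n) = cmod (1 / (\<i> * of_real (h n))) * L2_norm (\<lambda>x. (exp (\<i> * of_real (h n * x)) - 1) * v x)"
      unfolding L2_norm_cmult[symmetric] by (simp add: mult_ac)
    also have "\<dots> \<le> cmod (1 / (\<i> * of_real (h n))) * (D * h n)"
      using le[of "h n"] h[of n] by (intro mult_left_mono) auto
    also have "\<dots> = D" using h[of n] by (simp add: norm_divide norm_mult)
    finally show ?thesis .
  qed
  have lim: "AE x in lborel. (\<lambda>n. ?f n x) \<longlonglongrightarrow> of_real x * v x"
  proof (rule AE_I2)
    fix x :: real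
    have "(\<lambda>n. (exp (\<i> * of_real (h n * x)) - 1) / of_real (h n)) \<longlonglongrightarrow> \<i> * of_real x"
    proof (rule filterlim_compose[OF modulation_quotient_tendsto])
      show "filterlim h (at 0) sequentially"
        by (rule filterlim_atI[OF h0]) (use h less_irrefl in \<open>auto intro!: always_eventually simp: h_def\<close>)
    qed
    then have "(\<lambda>n. (exp (\<i> * of_real (h n * x)) - 1) / of_real (h n) * (1 / \<i>) * v x) \<longlonglongrightarrow> \<i> * of_real x * (1 / \<i>) * v x"
      by (intro tendsto_intros)
    moreover have "A / c * (1 / d) * b = A / (d * c) * b" for A b c d :: complex
      by (simp add: mult.commute)
    ultimately have "(\<lambda>n. ?f n x) \<longlonglongrightarrow> \<i> * of_real x * (1 / \<i>) * v x" by (simp only:)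
    moreover have "\<i> * of_real x * (1 / \<i>) * v x = of_real x * v x" by (simp add: field_simps)
    ultimately show "(\<lambda>n. ?f n x) \<longlonglongrightarrow> of_real x * v x" by (simp only:)
  qed
  have "(\<lambda>x. of_real x * v x) \<in> borel_measurable borel" by measurable
  from L2_Fatou[of ?f, OF f fle this lim]
  show "(\<lambda>x. of_real x * v x) \<in> L2" "L2_norm (\<lambda>x. of_real x * v x) \<le> D" by auto
qed

text \<open>Shifting the transform by \<open>h\<close> modulates the function by \<open>- h\<close>,
  and Plancherel's identity compares the two differences.\<close>

lemma is_fourier_L2_shift_diff:
  assumes F: "is_fourier_L2 f F"
  shows "L2_norm (\<lambda>\<xi>. F (\<xi> + h) - F \<xi>) = L2_norm (\<lambda>x. (exp (\<i> * of_real (- h * x)) - 1) * f x)"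
  using plancherel_L2[OF is_fourier_L2_diff[OF is_fourier_L2_modulate[OF F, of "-h"] F]]
  by (simp add: left_diff_distrib)

lemma shift_bound_imp_moment:
  assumes F: "is_fourier_L2 f F" and le: "\<And>h. L2_norm (\<lambda>\<xi>. F (\<xi> + h) - F \<xi>) \<le> D * \<bar>h\<bar>"
  shows "(\<lambda>x. of_real x * f x) \<in> L2" "L2_norm (\<lambda>x. of_real x * f x) \<le> D"
proof -
  have "L2_norm (\<lambda>x. (exp (\<i> * of_real (h * x)) - 1) * f x) \<le> D * \<bar>h\<bar>" for h
    using le[of "-h"] is_fourier_L2_shift_diff[OF F, of "-h"] by simp
  from modulation_bound_imp_moment[OF is_fourier_L2_D(1)[OF F] this]
  show "(\<lambda>x. of_real x * f x) \<in> L2" "L2_norm (\<lambda>x. of_real x * f x) \<le> D" by auto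
qed

lemma moment_imp_modulation_bound:
  assumes [measurable]: "v \<in> borel_measurable borel" and xv: "(\<lambda>x. of_real x * v x) \<in> L2"
  shows "(\<lambda>x. (exp (\<i> * of_real (h * x)) - 1) * v x) \<in> L2"
    "L2_norm (\<lambda>x. (exp (\<i> * of_real (h * x)) - 1) * v x) \<le> \<bar>h\<bar> * L2_norm (\<lambda>x. of_real x * v x)"
proof -
  have [measurable]: "(\<lambda>x. exp (\<i> * of_real (c * x))) \<in> borel_measurable borel" for c
    by (intro borel_measurable_continuous_onI continuous_intros)
  have m: "(\<lambda>x. (exp (\<i> * of_real (h * x)) - 1) * v x) \<in> borel_measurable borel" by measurable
  have le: "AE x in lborel. cmod ((exp (\<i> * of_real (h * x)) - 1) * v x) \<le> \<bar>h\<bar> * cmod (of_real x * v x)"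
  proof (rule AE_I2)
    fix x
    show "cmod ((exp (\<i> * of_real (h * x)) - 1) * v x) \<le> \<bar>h\<bar> * cmod (of_real x * v x)"
      using mult_right_mono[OF cmod_exp_minus_one_le[of "h * x"], of "cmod (v x)"]
      by (simp add: norm_mult abs_mult mult.assoc)
  qed
  show "(\<lambda>x. (exp (\<i> * of_real (h * x)) - 1) * v x) \<in> L2"
    "L2_norm (\<lambda>x. (exp (\<i> * of_real (h * x)) - 1) * v x) \<le> \<bar>h\<bar> * L2_norm (\<lambda>x. of_real x * v x)"
    using L2_dominated[OF xv m le] by simp_all
qed

section \<open>Differentiation in time of quadratic quantities\<close>

text \<open>With \<open>q\<close> the difference quotient in L2, the quotient of the squared norms
  is exactly \<open>2 * Re (L2_inner (\<beta> t) q) + h * (L2_norm q)\<^sup>2\<close>; the last term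
  vanishes in the limit because the norms of \<open>q\<close> converge.\<close>

lemma L2_norm_power2_derivative:
  assumes \<beta>: "\<beta> t \<in> L2" "\<forall>\<^sub>F h in at 0. \<beta> (t + h) \<in> L2" and A: "A \<in> L2"
    and lim: "((\<lambda>h. L2_norm (\<lambda>x. (\<beta> (t + h) x - \<beta> t x) / of_real h - A x)) \<longlongrightarrow> 0) (at 0)"
  shows "((\<lambda>s. (L2_norm (\<beta> s))\<^sup>2) has_real_derivative 2 * Re (L2_inner (\<beta> t) A)) (at t)"
proof -
  let ?q = "\<lambda>h x. (\<beta> (t + h) x - \<beta> t x) / of_real h"
  have q: "\<forall>\<^sub>F h in at 0. ?q h \<in> L2"
    using \<beta>(2)
  proof eventually_elim
    case (elim h)
    show ?case using L2_cmult[OF L2_diff[OF elim \<beta>(1)], of "1 / of_real h"] by simp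
  qed
  have "((\<lambda>h. 2 * Re (L2_inner (\<beta> t) (?q h)) + h * (L2_norm (?q h))\<^sup>2)
      \<longlongrightarrow> 2 * Re (L2_inner (\<beta> t) A) + 0 * (L2_norm A)\<^sup>2) (at 0)"
    by (intro tendsto_intros tendsto_L2_inner[OF lim q A \<beta>(1)] tendsto_L2_norm[OF lim q A])
  moreover have "\<forall>\<^sub>F h in at 0. 2 * Re (L2_inner (\<beta> t) (?q h)) + h * (L2_norm (?q h))\<^sup>2
      = ((L2_norm (\<beta> (t + h)))\<^sup>2 - (L2_norm (\<beta> t))\<^sup>2) / h"
    using q eventually_neq_at_within[of 0 0 UNIV]
  proof eventually_elim
    case (elim h)
    have "\<beta> (t + h) = (\<lambda>x. \<beta> t x + of_real h * ?q h x)" using elim(2) by auto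
    then have "(L2_norm (\<beta> (t + h)))\<^sup>2 = (L2_norm (\<lambda>x. \<beta> t x + of_real h * ?q h x))\<^sup>2"
      by (rule arg_cong)
    also have "\<dots> = (L2_norm (\<beta> t))\<^sup>2 + 2 * Re (L2_inner (\<beta> t) (\<lambda>x. of_real h * ?q h x))
        + (L2_norm (\<lambda>x. of_real h * ?q h x))\<^sup>2"
      by (rule L2_norm_add_power2[OF \<beta>(1) L2_cmult[OF elim(1)]])
    also have "L2_inner (\<beta> t) (\<lambda>x. of_real h * ?q h x) = of_real h * L2_inner (\<beta> t) (?q h)"
      unfolding L2_inner_def mult.left_commute[of "cnj _"] by (rule integral_mult_right_zero)
    also have "L2_norm (\<lambda>x. of_real h * ?q h x) = \<bar>h\<bar> * L2_norm (?q h)"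
      unfolding L2_norm_cmult by simp
    finally show ?case
      using elim(2) by (simp add: field_simps power2_eq_square)
  qed
  ultimately have "((\<lambda>h. ((L2_norm (\<beta> (t + h)))\<^sup>2 - (L2_norm (\<beta> t))\<^sup>2) / h)
      \<longlongrightarrow> 2 * Re (L2_inner (\<beta> t) A)) (at 0)"
    using tendsto_cong by fastforce
  then show ?thesis by (simp add: DERIV_def)
qed

text \<open>Linearity is recorded through differences and scalar multiples, the operations of a
  difference quotient, and for all functions, so that rewriting with it has no side
  conditions.\<close>

definition L2_operator :: "((real \<Rightarrow> complex) \<Rightarrow> real \<Rightarrow> complex) \<Rightarrow> bool" where
  "L2_operator B \<longleftrightarrow> (\<exists>C\<ge>0. \<forall>f\<in>L2. B f \<in> L2 \<and> L2_norm (B f) \<le> C * L2_norm f) \<and>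
     (\<forall>f g. B (\<lambda>x. f x - g x) = (\<lambda>x. B f x - B g x)) \<and> (\<forall>f c. B (\<lambda>x. c * f x) = (\<lambda>x. c * B f x))"

lemma L2_operator_derivative:
  assumes B: "L2_operator B" and \<beta>: "\<beta> t \<in> L2" "\<forall>\<^sub>F h in at 0. \<beta> (t + h) \<in> L2" and A: "A \<in> L2"
    and lim: "((\<lambda>h. L2_norm (\<lambda>x. (\<beta> (t + h) x - \<beta> t x) / of_real h - A x)) \<longlongrightarrow> 0) (at 0)"
  shows "((\<lambda>s. (L2_norm (B (\<beta> s)))\<^sup>2) has_real_derivative 2 * Re (L2_inner (B (\<beta> t)) (B A))) (at t)"
proof (rule L2_norm_power2_derivative[where \<beta>="\<lambda>s. B (\<beta> s)"])
  obtain C where C: "0 \<le> C" "\<And>f. f \<in> L2 \<Longrightarrow> B f \<in> L2" "\<And>f. f \<in> L2 \<Longrightarrow> L2_norm (B f) \<le> C * L2_norm f"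
    using B unfolding L2_operator_def by blast
  have diff: "B (\<lambda>x. f x - g x) = (\<lambda>x. B f x - B g x)" and cm: "B (\<lambda>x. c * f x) = (\<lambda>x. c * B f x)" for f g c
    using B by (auto simp: L2_operator_def)
  show "B (\<beta> t) \<in> L2" "B A \<in> L2" using C \<beta> A by auto
  show "\<forall>\<^sub>F h in at 0. B (\<beta> (t + h)) \<in> L2" using \<beta>(2) by eventually_elim (rule C)
  show "((\<lambda>h. L2_norm (\<lambda>x. (B (\<beta> (t + h)) x - B (\<beta> t) x) / of_real h - B A x)) \<longlongrightarrow> 0) (at 0)"
  proof (rule Lim_null_comparison)
    show "((\<lambda>h. C * L2_norm (\<lambda>x. (\<beta> (t + h) x - \<beta> t x) / of_real h - A x)) \<longlongrightarrow> 0) (at 0)"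
      using tendsto_mult[OF tendsto_const lim, of C] by simp
    show "\<forall>\<^sub>F h in at 0. norm (L2_norm (\<lambda>x. (B (\<beta> (t + h)) x - B (\<beta> t) x) / of_real h - B A x))
        \<le> C * L2_norm (\<lambda>x. (\<beta> (t + h) x - \<beta> t x) / of_real h - A x)"
      using \<beta>(2)
    proof eventually_elim
      case (elim h)
      let ?e = "\<lambda>x. 1 / of_real h * (\<beta> (t + h) x - \<beta> t x) - A x"
      have "?e \<in> L2" by (intro L2_diff L2_cmult elim \<beta>(1) A)
      from C(3)[OF this] show ?case
        unfolding diff cm by (simp add: mult.commute)
    qed
  qed
qed

text \<open>A phase space translation minus the identity, acting on profiles: \<open>a\<close>
  translates in space and \<open>b\<close> in frequency. A Lipschitz bound in \<open>a\<close> is a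
  bound for the frequency moment, one in \<open>b\<close> a bound for the moment in space.\<close>

definition weyl_diff :: "real \<Rightarrow> real \<Rightarrow> (real \<Rightarrow> complex) \<Rightarrow> real \<Rightarrow> complex" where
  "weyl_diff a b f \<xi> = exp (\<i> * of_real (a * \<xi>)) * f (\<xi> + b) - f \<xi>"

lemma iexp_measurable [measurable]: "(\<lambda>x. exp (\<i> * of_real (c * x))) \<in> borel_measurable borel"
  by (intro borel_measurable_continuous_onI continuous_intros)

lemma L2_operator_weyl_diff: "L2_operator (weyl_diff a b)"
  unfolding L2_operator_def
proof (intro conjI allI)
  show "\<exists>C\<ge>0. \<forall>f\<in>L2. weyl_diff a b f \<in> L2 \<and> L2_norm (weyl_diff a b f) \<le> C * L2_norm f"
  proof (intro exI[of _ 2] conjI ballI)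
    fix f assume f: "f \<in> L2"
    note [measurable] = L2_measurable[OF f]
    let ?g = "\<lambda>\<xi>. exp (\<i> * of_real (a * \<xi>)) * f (\<xi> + b)"
    have le: "AE \<xi> in lborel. cmod (?g \<xi>) \<le> 1 * cmod (f (\<xi> + b))" by (simp add: norm_mult)
    have m: "?g \<in> borel_measurable borel" by measurable
    have g: "?g \<in> L2" "L2_norm ?g \<le> L2_norm f"
      using L2_dominated[OF L2_translate(1)[OF f] m le] L2_translate(2)[OF f] by simp_all
    show "weyl_diff a b f \<in> L2"
      unfolding weyl_diff_def[abs_def] by (rule L2_diff[OF g(1) f])
    show "L2_norm (weyl_diff a b f) \<le> 2 * L2_norm f"
      using L2_norm_triangle[OF g(1) L2_cmult[OF f, of "-1"]] g(2)
      unfolding weyl_diff_def[abs_def] by simp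
  qed simp
qed (auto simp: weyl_diff_def[abs_def] algebra_simps)

lemma L2_operator_indicator: "L2_operator (\<lambda>f \<xi>. indicator {a..b} \<xi> * f \<xi>)"
  unfolding L2_operator_def
proof (intro conjI allI)
  show "\<exists>C\<ge>0. \<forall>f\<in>L2. (\<lambda>\<xi>. indicator {a..b} \<xi> * f \<xi>) \<in> L2 \<and>
      L2_norm (\<lambda>\<xi>. indicator {a..b} \<xi> * f \<xi>) \<le> C * L2_norm f"
  proof (intro exI[of _ 1] conjI ballI)
    fix f assume f: "f \<in> L2"
    note [measurable] = L2_measurable[OF f]
    have le: "AE \<xi> in lborel. cmod (indicator {a..b} \<xi> * f \<xi>) \<le> 1 * cmod (f \<xi>)"
      by (simp split: split_indicator)
    have m: "(\<lambda>\<xi>. indicator {a..b} \<xi> * f \<xi>) \<in> borel_measurable borel" by measurable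
    show "(\<lambda>\<xi>. indicator {a..b} \<xi> * f \<xi>) \<in> L2" "L2_norm (\<lambda>\<xi>. indicator {a..b} \<xi> * f \<xi>) \<le> 1 * L2_norm f"
      using L2_dominated[OF f m le] by simp_all
  qed simp
qed (auto simp: algebra_simps)

lemma L2_operator_id: "L2_operator (\<lambda>f. f)"
  unfolding L2_operator_def by (auto intro: exI[of _ 1])

text \<open>The Sobolev embedding of H2 in terms of the transform \<open>V\<close>: the weight
  controls \<open>V\<close> and its first moment, hence its L1 norm and the sup of its Fourier
  integral. The estimate \<open>2 \<le> sqrt (2 * pi)\<close> absorbs the two summands.\<close>

lemma weighted_L2:
  assumes [measurable]: "V \<in> borel_measurable borel" and W: "(\<lambda>\<xi>. of_real (1 + \<xi>\<^sup>2) * V \<xi>) \<in> L2" (is "?W \<in> L2")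
  shows "V \<in> L2" "(\<lambda>\<xi>. of_real \<xi> * V \<xi>) \<in> L2" "integrable lborel V" "L2_norm V \<le> L2_norm ?W"
    "cmod (fourier V x) \<le> weight_const * L2_norm ?W"
proof -
  have n: "cmod (?W \<xi>) = (1 + \<xi>\<^sup>2) * cmod (V \<xi>)" for \<xi>
    unfolding norm_mult norm_of_real by (simp add: add_nonneg_nonneg)
  have 1: "AE \<xi> in lborel. cmod (V \<xi>) \<le> 1 * cmod (?W \<xi>)"
    unfolding n by (simp add: mult_le_cancel_right1)
  have le2: "\<bar>\<xi>\<bar> \<le> 1 + \<xi>\<^sup>2" for \<xi> :: real
    using sum_squares_bound[of "\<bar>\<xi>\<bar>" 1] by (simp add: abs_le_square_iff)
  have 2: "AE \<xi> in lborel. cmod (of_real \<xi> * V \<xi>) \<le> 1 * cmod (?W \<xi>)"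
  proof (rule AE_I2)
    fix \<xi>
    have "cmod (of_real \<xi> * V \<xi>) = \<bar>\<xi>\<bar> * cmod (V \<xi>)" by (simp add: norm_mult)
    also have "\<dots> \<le> (1 + \<xi>\<^sup>2) * cmod (V \<xi>)" using le2 by (intro mult_right_mono) auto
    finally show "cmod (of_real \<xi> * V \<xi>) \<le> 1 * cmod (?W \<xi>)" unfolding n by simp
  qed
  show V: "V \<in> L2" "L2_norm V \<le> L2_norm ?W" using L2_dominated[OF W _ 1] by simp_all
  have 3: "(\<lambda>\<xi>. of_real \<xi> * V \<xi>) \<in> borel_measurable borel" by measurable
  show xV: "(\<lambda>\<xi>. of_real \<xi> * V \<xi>) \<in> L2" using L2_dominated(1)[OF W 3 2] by simp
  have xVn: "L2_norm (\<lambda>\<xi>. of_real \<xi> * V \<xi>) \<le> L2_norm ?W" using L2_dominated(2)[OF W 3 2] by simp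
  note w = weighted_L2_imp_L1[OF V(1) xV]
  show "integrable lborel V" by (rule w)
  have w0: "0 \<le> weight_const" by (simp add: weight_const_def)
  have s: "2 \<le> sqrt (2 * pi)" using pi_gt3 by (intro real_le_rsqrt) simp
  have "cmod (fourier V x) \<le> (LINT x|lborel. cmod (V x)) / sqrt (2 * pi)" by (rule cmod_fourier_le)
  also have "\<dots> \<le> (LINT x|lborel. cmod (V x)) / 2" using s by (intro divide_left_mono) auto
  also have "\<dots> \<le> weight_const * (L2_norm ?W + L2_norm ?W) / 2"
    using order_trans[OF w(2) mult_left_mono[OF add_mono[OF V(2) xVn] w0]] by simp
  finally show "cmod (fourier V x) \<le> weight_const * L2_norm ?W" by simp
qed

lemma cubic_L2:
  assumes f: "f \<in> L2" "\<And>x. cmod (f x) \<le> M" and g: "g \<in> L2" "\<And>x. cmod (g x) \<le> M"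
  shows "(\<lambda>x. of_real ((cmod (g x))\<^sup>2) * f x) \<in> L2" "integrable lborel (\<lambda>x. of_real ((cmod (g x))\<^sup>2) * f x)"
proof -
  note [measurable] = f(1)[THEN L2_measurable] g(1)[THEN L2_measurable]
  have m: "(\<lambda>x. of_real ((cmod (g x))\<^sup>2) * f x) \<in> borel_measurable borel" by measurable
  have "cmod (of_real ((cmod (g x))\<^sup>2) * f x) \<le> M * (cmod (g x))\<^sup>2" for x
    using mult_right_mono[OF f(2)[of x], of "(cmod (g x))\<^sup>2"] by (simp add: norm_mult norm_power mult.commute)
  then show "integrable lborel (\<lambda>x. of_real ((cmod (g x))\<^sup>2) * f x)"
    using m by (intro Bochner_Integration.integrable_bound[OF integrable_mult_right[OF L2_integrable[OF g(1)], of M]])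
      (auto intro!: AE_I2 order_trans[OF _ abs_ge_self])
  have "cmod (of_real ((cmod (g x))\<^sup>2) * f x) \<le> M\<^sup>2 * cmod (f x)" for x
    using g by (simp add: norm_mult norm_power mult_right_mono power_mono)
  then show "(\<lambda>x. of_real ((cmod (g x))\<^sup>2) * f x) \<in> L2"
    by (intro L2_dominated(1)[OF f(1) m, of "M\<^sup>2"]) auto
qed

section \<open>The profile equation\<close>

text \<open>The locale describes the system on the Fourier side: \<open>U j t\<close> is the transform of \<open>u\<^sub>j(t)\<close>
  and \<open>prof j t\<close> is the transform of \<open>\<U>(-t) u\<^sub>j(t)\<close>; the two components are indexed by \<open>bool\<close>.\<close>

locale nls_profile =
  fixes U :: "bool \<Rightarrow> real \<Rightarrow> real \<Rightarrow> complex"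
  assumes U_meas: "\<And>j t. 0 \<le> t \<Longrightarrow> U j t \<in> borel_measurable borel"
    and U_weighted: "\<And>j t. 0 \<le> t \<Longrightarrow> (\<lambda>\<xi>. of_real (1 + \<xi>\<^sup>2) * U j t \<xi>) \<in> L2"
    and U_cont: "\<And>j t. 0 \<le> t \<Longrightarrow>
      ((\<lambda>\<tau>. L2_norm (\<lambda>\<xi>. of_real (1 + \<xi>\<^sup>2) * (U j \<tau> \<xi> - U j t \<xi>))) \<longlongrightarrow> 0) (at t within {0..})"
    and U_evol: "\<And>j t. 0 < t \<Longrightarrow>
      ((\<lambda>h. L2_norm (\<lambda>\<xi>. (chirp (t + h) \<xi> * U j (t + h) \<xi> - chirp t \<xi> * U j t \<xi>) / of_real h
         - (- (chirp t \<xi> * fourier (\<lambda>x. of_real ((cmod (fourier (U (\<not> j) t) (- x)))\<^sup>2) *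
              fourier (U j t) (- x)) \<xi>)))) \<longlongrightarrow> 0) (at 0)"
begin

definition prof :: "bool \<Rightarrow> real \<Rightarrow> real \<Rightarrow> complex" where
  "prof j t \<xi> = chirp t \<xi> * U j t \<xi>"

text \<open>The reflected argument makes \<open>fourier\<close> the inverse transform, so this is
  the continuous representative of \<open>u\<^sub>j(t)\<close>.\<close>

definition wave :: "bool \<Rightarrow> real \<Rightarrow> real \<Rightarrow> complex" where
  "wave j t x = fourier (U j t) (- x)"

definition nonlin :: "bool \<Rightarrow> real \<Rightarrow> real \<Rightarrow> complex" where
  "nonlin j t x = of_real ((cmod (wave (\<not> j) t x))\<^sup>2) * wave j t x"

lemma U_L2: assumes "0 \<le> t"
  shows "U j t \<in> L2" "(\<lambda>\<xi>. of_real \<xi> * U j t \<xi>) \<in> L2" "integrable lborel (U j t)"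
  using weighted_L2[OF U_meas[OF assms] U_weighted[OF assms]] by auto

lemma wave_L2: assumes "0 \<le> t" shows "wave j t \<in> L2" "L2_norm (wave j t) = L2_norm (U j t)"
  using fourier_inverse_L2[OF U_L2(1,3)[OF assms]] by (auto simp: wave_def[abs_def])

lemma wave_bounded: assumes "0 \<le> t" obtains M where "0 \<le> M" "\<And>j x. cmod (wave j t x) \<le> M"
proof -
  let ?b = "\<lambda>j. weight_const * L2_norm (\<lambda>\<xi>. of_real (1 + \<xi>\<^sup>2) * U j t \<xi>)"
  have "cmod (wave j t x) \<le> ?b j" for j x
    unfolding wave_def by (rule weighted_L2(5)[OF U_meas[OF assms] U_weighted[OF assms]])
  moreover have "0 \<le> ?b j" for j by (simp add: weight_const_def)
  ultimately have "cmod (wave j t x) \<le> ?b True + ?b False" for j x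
    by (cases j) (simp_all add: add_increasing add_increasing2)
  moreover have "0 \<le> ?b True + ?b False" by (simp add: weight_const_def)
  ultimately show ?thesis using that by blast
qed

text \<open>The weighted norm of the difference controls its sup, so the continuity in time is
  uniform in \<open>x\<close>, as the continuity argument for the decay bound requires.\<close>

lemma wave_continuous:
  assumes t: "0 \<le> t" and e: "0 < e"
  shows "\<forall>\<^sub>F \<tau> in at t within {0..}. \<forall>x. cmod (wave j \<tau> x - wave j t x) < e"
proof -
  have "((\<lambda>\<tau>. weight_const * L2_norm (\<lambda>\<xi>. of_real (1 + \<xi>\<^sup>2) * (U j \<tau> \<xi> - U j t \<xi>))) \<longlongrightarrow> weight_const * 0) (at t within {0..})"
    by (intro tendsto_intros U_cont t)
  then have "\<forall>\<^sub>F \<tau> in at t within {0..}. weight_const * L2_norm (\<lambda>\<xi>. of_real (1 + \<xi>\<^sup>2) * (U j \<tau> \<xi> - U j t \<xi>)) < e"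
    using e by (intro order_tendstoD) auto
  moreover have "\<forall>\<^sub>F \<tau> in at t within {0..}. 0 \<le> \<tau>"
    by (simp add: eventually_at_filter)
  ultimately show ?thesis
  proof eventually_elim
    case (elim \<tau>)
    note [measurable] = U_meas[OF t] U_meas[OF elim(2)]
    have "(\<lambda>\<xi>. of_real (1 + \<xi>\<^sup>2) * (U j \<tau> \<xi> - U j t \<xi>)) \<in> L2"
      using L2_diff[OF U_weighted[OF elim(2)] U_weighted[OF t]] by (simp add: right_diff_distrib)
    moreover have "(\<lambda>\<xi>. U j \<tau> \<xi> - U j t \<xi>) \<in> borel_measurable borel" by measurable
    ultimately have "cmod (fourier (\<lambda>\<xi>. U j \<tau> \<xi> - U j t \<xi>) (- x)) < e" for x
      using elim(1) weighted_L2(5) by (intro order_le_less_trans[OF _ elim(1)])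
    then show ?case
      unfolding wave_def by (simp add: fourier_diff[OF U_L2(3)[OF elim(2)] U_L2(3)[OF t]])
  qed
qed

lemma nonlin_L2: assumes t: "0 \<le> t" shows "nonlin j t \<in> L2" "integrable lborel (nonlin j t)"
proof -
  obtain M where M: "\<And>j x. cmod (wave j t x) \<le> M" using wave_bounded[OF t] by blast
  show "nonlin j t \<in> L2" "integrable lborel (nonlin j t)"
    unfolding nonlin_def[abs_def] by (rule cubic_L2[OF wave_L2(1)[OF t] M wave_L2(1)[OF t] M])+
qed

lemma chirp_L2: assumes "f \<in> L2" shows "(\<lambda>\<xi>. chirp t \<xi> * f \<xi>) \<in> L2" "L2_norm (\<lambda>\<xi>. chirp t \<xi> * f \<xi>) = L2_norm f"
proof -
  note [measurable] = L2_measurable[OF assms]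
  show "(\<lambda>\<xi>. chirp t \<xi> * f \<xi>) \<in> L2"
    by (rule L2_dominated(1)[OF assms, of _ 1]) (auto simp: norm_mult)
  show "L2_norm (\<lambda>\<xi>. chirp t \<xi> * f \<xi>) = L2_norm f" by (simp add: L2_norm_def norm_mult)
qed

lemma prof_L2: assumes "0 \<le> t" shows "prof j t \<in> L2" "L2_norm (prof j t) = L2_norm (U j t)" "integrable lborel (prof j t)"
proof -
  show "prof j t \<in> L2" "L2_norm (prof j t) = L2_norm (U j t)"
    using chirp_L2[OF U_L2(1)[OF assms], of t] by (auto simp: prof_def[abs_def])
  show "integrable lborel (prof j t)"
    unfolding prof_def[abs_def] by (rule integrable_mult_bounded[OF U_L2(3)[OF assms], of _ 1]) auto
qed

text \<open>The chirp is continuous in \<open>t\<close> only strongly. The change of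
  \<open>U\<close> is therefore carried by a unimodular factor, and the change of the chirp at fixed
  \<open>U j t\<close> is treated by dominated convergence.\<close>

lemma prof_continuous:
  assumes t: "0 \<le> t"
  shows "((\<lambda>\<tau>. L2_norm (\<lambda>\<xi>. prof j \<tau> \<xi> - prof j t \<xi>)) \<longlongrightarrow> 0) (at t within {0..})"
proof (rule Lim_null_comparison)
  note [measurable] = U_meas[OF t]
  let ?a = "\<lambda>\<tau>. L2_norm (\<lambda>\<xi>. of_real (1 + \<xi>\<^sup>2) * (U j \<tau> \<xi> - U j t \<xi>))"
  let ?b = "\<lambda>\<tau>. L2_norm (\<lambda>\<xi>. (chirp \<tau> \<xi> - chirp t \<xi>) * U j t \<xi>)"
  have "(?b \<longlongrightarrow> 0) (at t)"
  proof (rule L2_norm_dominated_convergence_at)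
    show "(\<lambda>\<xi>. 2 * U j t \<xi>) \<in> L2" by (rule L2_cmult[OF U_L2(1)[OF t]])
    show "AE \<xi> in lborel. cmod ((chirp \<tau> \<xi> - chirp t \<xi>) * U j t \<xi>) \<le> cmod (2 * U j t \<xi>)" for \<tau>
    proof (rule AE_I2)
      fix \<xi>
      have "cmod (chirp \<tau> \<xi> - chirp t \<xi>) \<le> 2"
        using norm_triangle_ineq4[of "chirp \<tau> \<xi>" "chirp t \<xi>"] by simp
      then show "cmod ((chirp \<tau> \<xi> - chirp t \<xi>) * U j t \<xi>) \<le> cmod (2 * U j t \<xi>)"
        by (simp add: norm_mult mult_right_mono)
    qed
    show "AE \<xi> in lborel. ((\<lambda>\<tau>. (chirp \<tau> \<xi> - chirp t \<xi>) * U j t \<xi>) \<longlongrightarrow> 0) (at t)"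
    proof (rule AE_I2)
      fix \<xi>
      have "((\<lambda>\<tau>. (chirp \<tau> \<xi> - chirp t \<xi>) * U j t \<xi>) \<longlongrightarrow> (chirp t \<xi> - chirp t \<xi>) * U j t \<xi>) (at t)"
        unfolding chirp_def by (intro tendsto_intros) auto
      then show "((\<lambda>\<tau>. (chirp \<tau> \<xi> - chirp t \<xi>) * U j t \<xi>) \<longlongrightarrow> 0) (at t)" by simp
    qed
  qed measurable
  then have "(?b \<longlongrightarrow> 0) (at t within {0..})" by (rule tendsto_within_subset) simp
  from tendsto_add[OF U_cont[OF t] this] show "((\<lambda>\<tau>. ?a \<tau> + ?b \<tau>) \<longlongrightarrow> 0) (at t within {0..})" by simp
  have "\<forall>\<^sub>F \<tau> in at t within {0..}. 0 \<le> \<tau>" by (simp add: eventually_at_filter)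
  then show "\<forall>\<^sub>F \<tau> in at t within {0..}. norm (L2_norm (\<lambda>\<xi>. prof j \<tau> \<xi> - prof j t \<xi>)) \<le> ?a \<tau> + ?b \<tau>"
  proof eventually_elim
    case (elim \<tau>)
    note [measurable] = U_meas[OF elim]
    have d: "(\<lambda>\<xi>. U j \<tau> \<xi> - U j t \<xi>) \<in> L2" by (intro L2_diff U_L2 elim t)
    have w: "(\<lambda>\<xi>. of_real (1 + \<xi>\<^sup>2) * (U j \<tau> \<xi> - U j t \<xi>)) \<in> L2"
      using L2_diff[OF U_weighted[OF elim] U_weighted[OF t]] by (simp add: right_diff_distrib)
    have c: "(\<lambda>\<xi>. (chirp \<tau> \<xi> - chirp t \<xi>) * U j t \<xi>) \<in> L2"
      using L2_diff[OF chirp_L2(1)[OF U_L2(1)[OF t]] chirp_L2(1)[OF U_L2(1)[OF t]]]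
      by (simp add: left_diff_distrib)
    have "L2_norm (\<lambda>\<xi>. prof j \<tau> \<xi> - prof j t \<xi>)
        = L2_norm (\<lambda>\<xi>. chirp \<tau> \<xi> * (U j \<tau> \<xi> - U j t \<xi>) + (chirp \<tau> \<xi> - chirp t \<xi>) * U j t \<xi>)"
      by (simp add: prof_def algebra_simps)
    also have "\<dots> \<le> L2_norm (\<lambda>\<xi>. chirp \<tau> \<xi> * (U j \<tau> \<xi> - U j t \<xi>)) + ?b \<tau>"
      by (rule L2_norm_triangle[OF chirp_L2(1)[OF d] c])
    also have "L2_norm (\<lambda>\<xi>. chirp \<tau> \<xi> * (U j \<tau> \<xi> - U j t \<xi>)) \<le> ?a \<tau>"
      unfolding chirp_L2(2)[OF d] by (rule weighted_L2(4)[OF _ w]) measurable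
    finally show ?case by simp
  qed
qed

lemma energy_continuous:
  assumes B: "L2_operator B" shows "continuous_on {0..} (\<lambda>s. (L2_norm (B (prof j s)))\<^sup>2)"
  unfolding continuous_on
proof (intro ballI tendsto_power)
  fix t :: real assume "t \<in> {0..}"
  then have t: "0 \<le> t" by simp
  obtain C where C: "0 \<le> C" "\<And>f. f \<in> L2 \<Longrightarrow> B f \<in> L2" "\<And>f. f \<in> L2 \<Longrightarrow> L2_norm (B f) \<le> C * L2_norm f"
    using B unfolding L2_operator_def by blast
  have diff: "B (\<lambda>x. f x - g x) = (\<lambda>x. B f x - B g x)" for f g
    using B by (auto simp: L2_operator_def)
  have ev: "\<forall>\<^sub>F \<tau> in at t within {0..}. 0 \<le> \<tau>" by (simp add: eventually_at_filter)
  show "((\<lambda>s. L2_norm (B (prof j s))) \<longlongrightarrow> L2_norm (B (prof j t))) (at t within {0..})"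
  proof (rule tendsto_L2_norm)
    show "\<forall>\<^sub>F a in at t within {0..}. B (prof j a) \<in> L2"
      using ev by eventually_elim (intro C prof_L2)
    show "B (prof j t) \<in> L2" by (intro C prof_L2 t)
    show "((\<lambda>a. L2_norm (\<lambda>x. B (prof j a) x - B (prof j t) x)) \<longlongrightarrow> 0) (at t within {0..})"
    proof (rule Lim_null_comparison)
      show "((\<lambda>a. C * L2_norm (\<lambda>x. prof j a x - prof j t x)) \<longlongrightarrow> 0) (at t within {0..})"
        using tendsto_mult[OF tendsto_const prof_continuous[OF t], of C] by simp
      show "\<forall>\<^sub>F a in at t within {0..}. norm (L2_norm (\<lambda>x. B (prof j a) x - B (prof j t) x))
          \<le> C * L2_norm (\<lambda>x. prof j a x - prof j t x)"
        using ev
      proof eventually_elim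
        case (elim a)
        show ?case using C(3)[OF L2_diff[OF prof_L2(1)[OF elim] prof_L2(1)[OF t]]] by (simp add: diff)
      qed
    qed
  qed
qed

lemma energy_derivative:
  assumes B: "L2_operator B" and t: "0 < t"
  shows "((\<lambda>s. (L2_norm (B (prof j s)))\<^sup>2) has_real_derivative
    - 2 * Re (L2_inner (B (prof j t)) (B (\<lambda>\<xi>. chirp t \<xi> * fourier (nonlin j t) \<xi>)))) (at t)"
proof -
  have t0: "0 \<le> t" using t by simp
  have n: "(\<lambda>\<xi>. chirp t \<xi> * fourier (nonlin j t) \<xi>) \<in> L2"
    by (intro chirp_L2 plancherel_L1 nonlin_L2 t0)
  have cm: "B (\<lambda>x. c * f x) = (\<lambda>x. c * B f x)" for f c using B by (auto simp: L2_operator_def)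
  have neg: "B (\<lambda>\<xi>. - (chirp t \<xi> * fourier (nonlin j t) \<xi>)) = (\<lambda>x. - 1 * B (\<lambda>\<xi>. chirp t \<xi> * fourier (nonlin j t) \<xi>) x)"
    using cm[of "-1" "\<lambda>\<xi>. chirp t \<xi> * fourier (nonlin j t) \<xi>"] by simp
  have "((\<lambda>s. (L2_norm (B (prof j s)))\<^sup>2) has_real_derivative
    2 * Re (L2_inner (B (prof j t)) (B (\<lambda>\<xi>. - (chirp t \<xi> * fourier (nonlin j t) \<xi>))))) (at t)"
  proof (rule L2_operator_derivative[where \<beta>="prof j" and t=t, OF B prof_L2(1)[OF t0]])
    have "\<forall>\<^sub>F h in at 0. - t < (h :: real)"
      using t by (intro order_tendstoD(1)[OF tendsto_ident_at]) auto
    then show "\<forall>\<^sub>F h in at 0. prof j (t + h) \<in> L2"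
      by eventually_elim (intro prof_L2, simp)
    show "(\<lambda>\<xi>. - (chirp t \<xi> * fourier (nonlin j t) \<xi>)) \<in> L2"
      using L2_cmult[OF n, of "-1"] by simp
    show "((\<lambda>h. L2_norm (\<lambda>x. (prof j (t + h) x - prof j t x) / of_real h
        - - (chirp t x * fourier (nonlin j t) x))) \<longlongrightarrow> 0) (at 0)"
      using U_evol[OF t, of j] unfolding prof_def nonlin_def[abs_def] wave_def .
  qed
  then show ?thesis unfolding neg by (simp add: L2_inner_def)
qed

end

section \<open>Growth of the first moments\<close>

text \<open>The part \<open>(cmod p')\<^sup>2 * (p - q)\<close> is kept apart because it is the
  dissipative one; what remains is controlled by the difference in the other component
  alone.\<close>

lemma cubic_difference_le:
  fixes p q p' q' :: complex
  assumes "cmod p' \<le> M" "cmod q' \<le> M" "cmod q \<le> M"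
  shows "cmod (of_real ((cmod p')\<^sup>2) * p - of_real ((cmod q')\<^sup>2) * q - of_real ((cmod p')\<^sup>2) * (p - q))
      \<le> 2 * M\<^sup>2 * cmod (p' - q')"
proof -
  have M: "0 \<le> M" using assms(1) norm_ge_zero order_trans by blast
  have "\<bar>(cmod p')\<^sup>2 - (cmod q')\<^sup>2\<bar> = (cmod p' + cmod q') * \<bar>cmod p' - cmod q'\<bar>"
  proof -
    have "(cmod p')\<^sup>2 - (cmod q')\<^sup>2 = (cmod p' + cmod q') * (cmod p' - cmod q')"
      by (simp add: power2_eq_square algebra_simps)
    then show ?thesis by (simp add: abs_mult)
  qed
  also have "\<dots> \<le> (2 * M) * cmod (p' - q')"
    using assms M by (intro mult_mono) (auto intro: norm_triangle_ineq3)
  finally have le: "\<bar>(cmod p')\<^sup>2 - (cmod q')\<^sup>2\<bar> \<le> 2 * M * cmod (p' - q')" .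
  have "of_real ((cmod p')\<^sup>2) * p - of_real ((cmod q')\<^sup>2) * q - of_real ((cmod p')\<^sup>2) * (p - q)
      = of_real ((cmod p')\<^sup>2 - (cmod q')\<^sup>2) * q" by (simp add: algebra_simps)
  then have "cmod (of_real ((cmod p')\<^sup>2) * p - of_real ((cmod q')\<^sup>2) * q - of_real ((cmod p')\<^sup>2) * (p - q))
      = \<bar>(cmod p')\<^sup>2 - (cmod q')\<^sup>2\<bar> * cmod q" by (simp only: norm_mult norm_of_real)
  also have "\<dots> \<le> (2 * M * cmod (p' - q')) * M" using le assms M by (intro mult_mono) auto
  finally show ?thesis by (simp add: power2_eq_square mult_ac)
qed

text \<open>The part with frozen coefficient contributes a nonnegative amount and is dropped; the
  arithmetic-geometric mean inequality makes the rest symmetric in the two components.\<close>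

lemma cubic_dissipation:
  fixes p q p' q' :: complex
  assumes "cmod p' \<le> M" "cmod q' \<le> M" "cmod q \<le> M"
  shows "- (M\<^sup>2 * ((cmod (p - q))\<^sup>2 + (cmod (p' - q'))\<^sup>2))
    \<le> Re (cnj (p - q) * (of_real ((cmod p')\<^sup>2) * p - of_real ((cmod q')\<^sup>2) * q))"
proof -
  define r where "r = of_real ((cmod p')\<^sup>2) * p - of_real ((cmod q')\<^sup>2) * q - of_real ((cmod p')\<^sup>2) * (p - q)"
  have r: "cmod r \<le> 2 * M\<^sup>2 * cmod (p' - q')" unfolding r_def by (rule cubic_difference_le[OF assms])
  have "of_real ((cmod p')\<^sup>2) * p - of_real ((cmod q')\<^sup>2) * q = of_real ((cmod p')\<^sup>2) * (p - q) + r"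
    by (simp add: r_def)
  then have "cnj (p - q) * (of_real ((cmod p')\<^sup>2) * p - of_real ((cmod q')\<^sup>2) * q)
      = of_real ((cmod p')\<^sup>2) * (cnj (p - q) * (p - q)) + cnj (p - q) * r"
    by (simp only: distrib_left mult_ac)
  also have "cnj (p - q) * (p - q) = of_real ((cmod (p - q))\<^sup>2)"
    by (simp only: complex_norm_square mult.commute)
  finally have eq: "Re (cnj (p - q) * (of_real ((cmod p')\<^sup>2) * p - of_real ((cmod q')\<^sup>2) * q))
      = (cmod p')\<^sup>2 * (cmod (p - q))\<^sup>2 + Re (cnj (p - q) * r)"
    by (simp only: plus_complex.sel of_real_mult[symmetric] Re_complex_of_real)
  have "\<bar>Re (cnj (p - q) * r)\<bar> \<le> cmod (p - q) * cmod r"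
    using abs_Re_le_cmod[of "cnj (p - q) * r"] by (simp only: norm_mult complex_mod_cnj)
  also have "\<dots> \<le> cmod (p - q) * (2 * M\<^sup>2 * cmod (p' - q'))" by (intro mult_left_mono r) simp
  also have "\<dots> = M\<^sup>2 * (2 * cmod (p - q) * cmod (p' - q'))" by simp
  also have "\<dots> \<le> M\<^sup>2 * ((cmod (p - q))\<^sup>2 + (cmod (p' - q'))\<^sup>2)"
    by (intro mult_left_mono sum_squares_bound) simp
  finally have "- (M\<^sup>2 * ((cmod (p - q))\<^sup>2 + (cmod (p' - q'))\<^sup>2)) \<le> Re (cnj (p - q) * r)" by linarith
  moreover have "0 \<le> (cmod p')\<^sup>2 * (cmod (p - q))\<^sup>2" by simp
  ultimately show ?thesis unfolding eq by linarith
qed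

text \<open>The Galilean boost conjugate, on the physical side, to the Weyl operator
  \<open>exp (i a \<xi>) f (\<xi> + b)\<close> acting on the profile at time \<open>t\<close>.\<close>

definition boost :: "real \<Rightarrow> real \<Rightarrow> real \<Rightarrow> (real \<Rightarrow> complex) \<Rightarrow> real \<Rightarrow> complex" where
  "boost t a b f x = chirp t b * exp (\<i> * of_real (- b * (x + (a + t * b)))) * f (x + (a + t * b))"

text \<open>The same boost seen on the Fourier side; the displacement \<open>a + t * b\<close> is
  uniform motion with velocity \<open>b\<close>.\<close>

definition boost_hat :: "real \<Rightarrow> real \<Rightarrow> real \<Rightarrow> (real \<Rightarrow> complex) \<Rightarrow> real \<Rightarrow> complex" where
  "boost_hat t a b V \<xi> = chirp t b * exp (\<i> * of_real ((a + t * b) * \<xi>)) * V (\<xi> + b)"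

text \<open>Expanding \<open>(\<xi> + b)\<^sup>2\<close> in the chirp yields the extra phase
  \<open>chirp t b * exp (\<i> t b \<xi>)\<close>. This is the Galilean covariance of the free
  evolution.\<close>

lemma weyl_diff_chirp:
  "weyl_diff a b (\<lambda>\<xi>. chirp t \<xi> * V \<xi>) \<xi> = chirp t \<xi> * (boost_hat t a b V \<xi> - V \<xi>)"
proof -
  have "exp (\<i> * of_real (a * \<xi>)) * chirp t (\<xi> + b) = chirp t \<xi> * (chirp t b * exp (\<i> * of_real ((a + t * b) * \<xi>)))"
    unfolding chirp_def mult_exp_exp
    by (rule arg_cong[of _ _ exp]) (simp add: power2_eq_square algebra_simps add_divide_distrib)
  then show ?thesis
    unfolding weyl_diff_def boost_hat_def by (simp add: algebra_simps)
qed

lemma fourier_boost: "fourier (boost t a b f) \<xi> = boost_hat t a b (fourier f) \<xi>"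
proof -
  let ?g = "\<lambda>x. exp (\<i> * of_real (- b * x)) * f x"
  have "boost t a b f = (\<lambda>x. chirp t b * ?g (x + (a + t * b)))" by (simp add: boost_def[abs_def] mult.assoc)
  then have "fourier (boost t a b f) \<xi> = chirp t b * fourier (\<lambda>x. ?g (x + (a + t * b))) \<xi>"
    by (simp only: fourier_cmult)
  also have "\<dots> = chirp t b * (exp (\<i> * of_real ((a + t * b) * \<xi>)) * fourier ?g \<xi>)"
    by (subst fourier_translate) simp
  also have "fourier ?g \<xi> = fourier f (\<xi> + b)" by (subst fourier_modulate) simp
  finally show ?thesis by (simp add: boost_hat_def mult.assoc)
qed

lemma fourier_boost_hat: "fourier (boost_hat t a b V) (- x) = boost t a b (\<lambda>x. fourier V (- x)) x"
proof -
  have "boost_hat t a b V = (\<lambda>\<xi>. chirp t b * (exp (\<i> * of_real ((a + t * b) * \<xi>)) * V (\<xi> + b)))"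
    by (simp add: boost_hat_def[abs_def] mult.assoc)
  then have "fourier (boost_hat t a b V) (- x) = chirp t b * fourier (\<lambda>\<xi>. exp (\<i> * of_real ((a + t * b) * \<xi>)) * V (\<xi> + b)) (- x)"
    by (simp only: fourier_cmult)
  also have "\<dots> = chirp t b * fourier (\<lambda>\<xi>. V (\<xi> + b)) (- x - (a + t * b))" by (subst fourier_modulate) simp
  also have "\<dots> = chirp t b * (exp (\<i> * of_real (b * (- x - (a + t * b)))) * fourier V (- x - (a + t * b)))"
    by (subst fourier_translate) simp
  also have "- x - (a + t * b) = - (x + (a + t * b))" by simp
  also have "b * - (x + (a + t * b)) = - b * (x + (a + t * b))"
    by (simp only: mult_minus_right mult_minus_left)
  also have "chirp t b * (exp (\<i> * of_real (- b * (x + (a + t * b)))) * fourier V (- (x + (a + t * b))))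
      = boost t a b (\<lambda>x. fourier V (- x)) x"
    by (simp only: boost_def mult.assoc)
  finally show ?thesis .
qed

lemma cmod_boost: "cmod (boost t a b f x) = cmod (f (x + (a + t * b)))"
  by (simp add: boost_def norm_mult)

lemma boost_integrable:
  assumes f: "integrable lborel f" shows "integrable lborel (boost t a b f)"
  unfolding boost_def[abs_def]
  by (rule integrable_mult_bounded[where C=1, OF translate_integrable(1)[OF f]])
    (auto simp: norm_mult intro!: borel_measurable_continuous_onI continuous_intros)

lemma boost_hat_integrable:
  assumes f: "integrable lborel f" shows "integrable lborel (boost_hat t a b f)"
  unfolding boost_hat_def[abs_def]
  by (rule integrable_mult_bounded[where C=1, OF translate_integrable(1)[OF f]]) (simp_all add: norm_mult)

lemma boost_hat_L2:
  assumes f: "f \<in> L2" shows "boost_hat t a b f \<in> L2"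
proof -
  note [measurable] = L2_measurable[OF f]
  show ?thesis unfolding boost_hat_def[abs_def]
    by (rule L2_dominated(1)[OF L2_translate(1)[OF f, of b], of _ 1]) (auto simp: norm_mult)
qed

lemma boost_L2:
  assumes f: "f \<in> L2" shows "boost t a b f \<in> L2"
proof -
  note [measurable] = L2_measurable[OF f]
  have [measurable]: "(\<lambda>x. exp (\<i> * of_real (- b * (x + (a + t * b))))) \<in> borel_measurable borel"
    by (intro borel_measurable_continuous_onI continuous_intros)
  have "boost t a b f \<in> borel_measurable borel" unfolding boost_def[abs_def] by measurable
  then show ?thesis
    by (rule L2_dominated(1)[OF L2_translate(1)[OF f, of "a + t * b"], of _ 1]) (auto simp: cmod_boost)
qed

section \<open>Growth of the Weyl energies and decay of the mass\<close>

context nls_profile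
begin

text \<open>Both components are summed because the rate of each one is bounded by the differences in
  both.\<close>

definition weyl_energy :: "real \<Rightarrow> real \<Rightarrow> real \<Rightarrow> real" where
  "weyl_energy a b t = (L2_norm (weyl_diff a b (prof True t)))\<^sup>2 + (L2_norm (weyl_diff a b (prof False t)))\<^sup>2"

definition boost_diff :: "real \<Rightarrow> real \<Rightarrow> bool \<Rightarrow> real \<Rightarrow> real \<Rightarrow> complex" where
  "boost_diff a b j t x = boost t a b (wave j t) x - wave j t x"

lemma boost_diff_L2: assumes "0 \<le> t" shows "boost_diff a b j t \<in> L2"
  unfolding boost_diff_def[abs_def] by (intro L2_diff boost_L2 wave_L2 assms)

lemma L2_norm_weyl_diff_prof:
  assumes t: "0 \<le> t" shows "L2_norm (weyl_diff a b (prof j t)) = L2_norm (boost_diff a b j t)"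
proof -
  let ?V = "\<lambda>\<xi>. boost_hat t a b (U j t) \<xi> - U j t \<xi>"
  have V: "?V \<in> L2" "integrable lborel ?V"
    by (intro L2_diff boost_hat_L2 U_L2 t) (intro Bochner_Integration.integrable_diff boost_hat_integrable U_L2 t)
  have "weyl_diff a b (prof j t) = (\<lambda>\<xi>. chirp t \<xi> * ?V \<xi>)"
    unfolding prof_def[abs_def] by (rule ext) (rule weyl_diff_chirp)
  then have "L2_norm (weyl_diff a b (prof j t)) = L2_norm ?V" by (simp add: chirp_L2(2)[OF V(1)])
  also have "\<dots> = L2_norm (\<lambda>x. fourier ?V (- x))" by (rule fourier_inverse_L2(2)[OF V, symmetric])
  also have "(\<lambda>x. fourier ?V (- x)) = boost_diff a b j t"
    unfolding boost_diff_def[abs_def] wave_def[abs_def]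
    by (simp add: fourier_diff boost_hat_integrable U_L2(3)[OF t] fourier_boost_hat)
  finally show ?thesis .
qed

text \<open>The chirps cancel against their conjugates, and duality moves the pairing to the space
  side, where the cubic term acts pointwise.\<close>

lemma inner_weyl_diff:
  assumes t: "0 \<le> t"
  shows "L2_inner (weyl_diff a b (prof j t)) (weyl_diff a b (\<lambda>\<xi>. chirp t \<xi> * fourier (nonlin j t) \<xi>))
    = L2_inner (boost_diff a b j t) (\<lambda>x. boost t a b (nonlin j t) x - nonlin j t x)"
proof -
  let ?V = "\<lambda>\<xi>. boost_hat t a b (U j t) \<xi> - U j t \<xi>"
  let ?n = "\<lambda>x. boost t a b (nonlin j t) x - nonlin j t x"
  have V: "integrable lborel ?V"
    by (intro Bochner_Integration.integrable_diff boost_hat_integrable U_L2 t)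
  have n: "integrable lborel ?n"
    by (intro Bochner_Integration.integrable_diff boost_integrable nonlin_L2 t)
  have "L2_inner (weyl_diff a b (prof j t)) (weyl_diff a b (\<lambda>\<xi>. chirp t \<xi> * fourier (nonlin j t) \<xi>))
      = L2_inner ?V (fourier ?n)"
    unfolding L2_inner_def
  proof (rule Bochner_Integration.integral_cong[OF refl])
    fix \<xi> :: real
    have a: "weyl_diff a b (prof j t) \<xi> = chirp t \<xi> * ?V \<xi>"
      unfolding prof_def[abs_def] by (rule weyl_diff_chirp)
    have "fourier ?n \<xi> = boost_hat t a b (fourier (nonlin j t)) \<xi> - fourier (nonlin j t) \<xi>"
      by (simp add: fourier_diff boost_integrable nonlin_L2(2)[OF t] fourier_boost)
    then have b: "weyl_diff a b (\<lambda>\<xi>. chirp t \<xi> * fourier (nonlin j t) \<xi>) \<xi> = chirp t \<xi> * fourier ?n \<xi>"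
      by (simp only: weyl_diff_chirp)
    have "cnj (chirp t \<xi> * ?V \<xi>) * (chirp t \<xi> * fourier ?n \<xi>)
        = (chirp (- t) \<xi> * chirp t \<xi>) * (cnj (?V \<xi>) * fourier ?n \<xi>)"
      by (simp only: complex_cnj_mult cnj_chirp mult_ac)
    then show "cnj (weyl_diff a b (prof j t) \<xi>) * weyl_diff a b (\<lambda>\<xi>. chirp t \<xi> * fourier (nonlin j t) \<xi>) \<xi>
        = cnj (?V \<xi>) * fourier ?n \<xi>"
      unfolding a b by simp
  qed
  also have "\<dots> = L2_inner (\<lambda>x. fourier ?V (- x)) ?n" by (rule fourier_inner_swap[OF V n, symmetric])
  also have "(\<lambda>x. fourier ?V (- x)) = boost_diff a b j t"
    unfolding boost_diff_def[abs_def] wave_def[abs_def]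
    by (simp add: fourier_diff boost_hat_integrable U_L2(3)[OF t] fourier_boost_hat)
  finally show ?thesis .
qed

text \<open>Invariance of the system under boosts: the unimodular factor disappears from the
  modulus, and the translation acts on both factors alike.\<close>

lemma boost_nonlin: "boost t a b (nonlin j t) x
    = of_real ((cmod (boost t a b (wave (\<not> j) t) x))\<^sup>2) * boost t a b (wave j t) x"
  unfolding cmod_boost by (simp add: boost_def nonlin_def mult_ac)

text \<open>By \<open>cubic_dissipation\<close> under the integral, each component grows at a rate
  of at most \<open>2 * M\<^sup>2\<close> times the whole energy.\<close>

lemma weyl_energy_derivative:
  assumes t: "0 < t" and M: "\<And>j x. cmod (wave j t x) \<le> M"
  obtains D where "(weyl_energy a b has_real_derivative D) (at t)" "D \<le> 4 * M\<^sup>2 * weyl_energy a b t"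
proof -
  have t0: "0 \<le> t" using t by simp
  let ?I = "\<lambda>j. Re (L2_inner (boost_diff a b j t) (\<lambda>x. boost t a b (nonlin j t) x - nonlin j t x))"
  let ?N = "\<lambda>j. (L2_norm (boost_diff a b j t))\<^sup>2"
  have d: "((\<lambda>s. (L2_norm (weyl_diff a b (prof j s)))\<^sup>2) has_real_derivative - 2 * ?I j) (at t)" for j
    using energy_derivative[OF L2_operator_weyl_diff t] by (simp only: inner_weyl_diff[OF t0])
  have I: "- (M\<^sup>2 * (?N j + ?N (\<not> j))) \<le> ?I j" for j
  proof -
    let ?d = "\<lambda>j. boost_diff a b j t"
    let ?n = "\<lambda>x. boost t a b (nonlin j t) x - nonlin j t x"
    have n: "?n \<in> L2" by (intro L2_diff boost_L2 nonlin_L2 t0)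
    have int: "integrable lborel (\<lambda>x. cnj (?d j x) * ?n x)"
      by (rule L2_mult_integrable(3)[OF boost_diff_L2[OF t0] n])
    have int2: "integrable lborel (\<lambda>x. - (M\<^sup>2 * ((cmod (?d j x))\<^sup>2 + (cmod (?d (\<not> j) x))\<^sup>2)))"
      using boost_diff_L2[OF t0, THEN L2_integrable] by simp
    have "- (M\<^sup>2 * (?N j + ?N (\<not> j))) = (LINT x|lborel. - (M\<^sup>2 * ((cmod (?d j x))\<^sup>2 + (cmod (?d (\<not> j) x))\<^sup>2)))"
      using boost_diff_L2[OF t0, THEN L2_integrable] by (simp add: L2_norm_power2)
    also have "\<dots> \<le> (LINT x|lborel. Re (cnj (?d j x) * ?n x))"
    proof (rule integral_mono[OF int2 integrable_Re[OF int]])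
      fix x
      show "- (M\<^sup>2 * ((cmod (?d j x))\<^sup>2 + (cmod (?d (\<not> j) x))\<^sup>2)) \<le> Re (cnj (?d j x) * ?n x)"
        unfolding boost_diff_def boost_nonlin nonlin_def
        by (rule cubic_dissipation) (simp_all only: cmod_boost M)
    qed
    also have "\<dots> = ?I j" unfolding L2_inner_def by (rule integral_Re[OF int])
    finally show ?thesis .
  qed
  show ?thesis
  proof (rule that)
    show "(weyl_energy a b has_real_derivative (- 2 * ?I True + - 2 * ?I False)) (at t)"
      unfolding weyl_energy_def[abs_def] by (intro DERIV_add d)
    show "- 2 * ?I True + - 2 * ?I False \<le> 4 * M\<^sup>2 * weyl_energy a b t"
      using I[of True] I[of False]
      by (simp add: weyl_energy_def L2_norm_weyl_diff_prof[OF t0] algebra_simps)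
  qed
qed

lemma weyl_energy_continuous: "continuous_on {0..} (weyl_energy a b)"
  unfolding weyl_energy_def[abs_def]
  by (intro continuous_on_add energy_continuous L2_operator_weyl_diff)

text \<open>Gronwall with the integrating factor \<open>(1 + s) powr (- 4 * K\<^sup>2)\<close>:
  decay of the waves like \<open>1 / sqrt (1 + s)\<close> makes the rate
  \<open>4 * K\<^sup>2 / (1 + s)\<close>, so the energy grows at most polynomially, with an exponent
  that is small with \<open>K\<close>.\<close>

lemma weyl_energy_growth:
  assumes T: "0 \<le> T" and bd: "\<And>s j x. 0 < s \<Longrightarrow> s < T \<Longrightarrow> cmod (wave j s x) \<le> K / sqrt (1 + s)"
  shows "weyl_energy a b T \<le> weyl_energy a b 0 * (1 + T) powr (4 * K\<^sup>2)"
proof -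
  let ?k = "4 * K\<^sup>2"
  let ?f = "\<lambda>s. weyl_energy a b s * (1 + s) powr (- ?k)"
  have "?f T \<le> ?f 0"
  proof (rule DERIV_nonpos_imp_decreasing_open[OF T])
    show "continuous_on {0..T} ?f"
      by (intro continuous_on_mult continuous_on_subset[OF weyl_energy_continuous] continuous_intros) auto
    fix s assume s: "0 < s" "s < T"
    then have bs: "cmod (wave j s x) \<le> K / sqrt (1 + s)" for j x using bd by auto
    have "(K / sqrt (1 + s))\<^sup>2 = K\<^sup>2 / (1 + s)" using s by (simp add: power_divide)
    moreover obtain D where D: "(weyl_energy a b has_real_derivative D) (at s)"
      "D \<le> 4 * (K / sqrt (1 + s))\<^sup>2 * weyl_energy a b s"
      using weyl_energy_derivative[OF s(1) bs, of a b] by blast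
    ultimately have D2: "D \<le> ?k / (1 + s) * weyl_energy a b s" by simp
    have "(?f has_real_derivative D * (1 + s) powr (- ?k)
        + weyl_energy a b s * (- ?k * (1 + s) powr (- ?k - 1))) (at s)"
      using s by (auto intro!: derivative_eq_intros D(1))
    moreover have "D * (1 + s) powr (- ?k) + weyl_energy a b s * (- ?k * (1 + s) powr (- ?k - 1)) \<le> 0"
    proof -
      have "(1 + s) powr (- ?k - 1) = (1 + s) powr (- ?k) / (1 + s)"
        using s by (simp add: powr_diff)
      then have "D * (1 + s) powr (- ?k) + weyl_energy a b s * (- ?k * (1 + s) powr (- ?k - 1))
          = (D - ?k / (1 + s) * weyl_energy a b s) * (1 + s) powr (- ?k)" by (simp add: algebra_simps)
      also have "\<dots> \<le> 0" using D2 by (intro mult_nonpos_nonneg) auto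
      finally show ?thesis .
    qed
    ultimately show "\<exists>y. (?f has_real_derivative y) (at s) \<and> y \<le> 0" by blast
  qed
  then have "weyl_energy a b T * (1 + T) powr (- ?k) * (1 + T) powr ?k \<le> weyl_energy a b 0 * (1 + T) powr ?k"
    by (intro mult_right_mono) auto
  moreover have "(1 + T) powr (- ?k) * (1 + T) powr ?k = 1"
    using T by (simp flip: powr_add)
  ultimately show ?thesis by (simp add: mult.assoc)
qed

text \<open>The rate is minus twice the integral of the product of the two squared moduli, which is
  the dissipation of the system.\<close>

lemma mass_nonincreasing:
  assumes t: "0 \<le> t" shows "L2_norm (prof j t) \<le> L2_norm (prof j 0)"
proof -
  have "(L2_norm (prof j t))\<^sup>2 \<le> (L2_norm (prof j 0))\<^sup>2"
  proof (rule DERIV_nonpos_imp_decreasing_open[OF t])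
    show "continuous_on {0..t} (\<lambda>t. (L2_norm (prof j t))\<^sup>2)"
      by (rule continuous_on_subset[OF energy_continuous[OF L2_operator_id]]) auto
    fix s assume s: "0 < s" "s < t"
    then have s0: "0 \<le> s" by simp
    have "L2_inner (prof j s) (\<lambda>\<xi>. chirp s \<xi> * fourier (nonlin j s) \<xi>) = L2_inner (U j s) (fourier (nonlin j s))"
      unfolding L2_inner_def
    proof (rule Bochner_Integration.integral_cong[OF refl])
      fix \<xi> :: real
      have "cnj (prof j s \<xi>) * (chirp s \<xi> * fourier (nonlin j s) \<xi>)
          = (chirp (- s) \<xi> * chirp s \<xi>) * (cnj (U j s \<xi>) * fourier (nonlin j s) \<xi>)"
        by (simp only: prof_def complex_cnj_mult cnj_chirp mult_ac)
      then show "cnj (prof j s \<xi>) * (chirp s \<xi> * fourier (nonlin j s) \<xi>) = cnj (U j s \<xi>) * fourier (nonlin j s) \<xi>"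
        by simp
    qed
    also have "\<dots> = L2_inner (wave j s) (nonlin j s)"
      unfolding wave_def[abs_def] by (rule fourier_inner_swap[OF U_L2(3)[OF s0] nonlin_L2(2)[OF s0], symmetric])
    finally have eq: "L2_inner (prof j s) (\<lambda>\<xi>. chirp s \<xi> * fourier (nonlin j s) \<xi>) = L2_inner (wave j s) (nonlin j s)" .
    have int: "integrable lborel (\<lambda>x. cnj (wave j s x) * nonlin j s x)"
      by (rule L2_mult_integrable(3)[OF wave_L2(1)[OF s0] nonlin_L2(1)[OF s0]])
    have "Re (L2_inner (wave j s) (nonlin j s)) = (LINT x|lborel. Re (cnj (wave j s x) * nonlin j s x))"
      unfolding L2_inner_def by (rule integral_Re[OF int, symmetric])
    moreover have "Re (cnj (wave j s x) * nonlin j s x) = (cmod (wave (\<not> j) s x))\<^sup>2 * (cmod (wave j s x))\<^sup>2" for x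
    proof -
      have "cnj (wave j s x) * nonlin j s x = of_real ((cmod (wave (\<not> j) s x))\<^sup>2) * (wave j s x * cnj (wave j s x))"
        by (simp only: nonlin_def mult_ac)
      then show ?thesis by (simp only: complex_norm_square[symmetric] of_real_mult[symmetric] Re_complex_of_real)
    qed
    ultimately have "0 \<le> Re (L2_inner (wave j s) (nonlin j s))" by simp
    then show "\<exists>y. ((\<lambda>t. (L2_norm (prof j t))\<^sup>2) has_real_derivative y) (at s) \<and> y \<le> 0"
      using energy_derivative[OF L2_operator_id s(1), of j] unfolding eq by fastforce
  qed
  then show ?thesis by (rule power2_le_imp_le) simp
qed

lemma weyl_diff_bound:
  assumes "\<And>a b. sqrt (weyl_energy a b t) \<le> D * (\<bar>a\<bar> + \<bar>b\<bar>)"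
  shows "L2_norm (weyl_diff a b (prof j t)) \<le> D * (\<bar>a\<bar> + \<bar>b\<bar>)"
proof -
  have "(L2_norm (weyl_diff a b (prof j t)))\<^sup>2 \<le> weyl_energy a b t"
    by (cases j) (simp_all add: weyl_energy_def)
  then have "L2_norm (weyl_diff a b (prof j t)) \<le> sqrt (weyl_energy a b t)" by (rule real_le_rsqrt)
  then show ?thesis using assms[of a b] by linarith
qed

text \<open>The profile as a function of space, that is, \<open>\<U>(-t) u\<^sub>j(t)\<close>
  itself.\<close>

definition profx :: "bool \<Rightarrow> real \<Rightarrow> real \<Rightarrow> complex" where
  "profx j t x = fourier (prof j t) (- x)"

lemma profx_fourier: "0 \<le> t \<Longrightarrow> is_fourier_L2 (profx j t) (prof j t)"
  unfolding profx_def[abs_def] by (rule is_fourier_L2_inverse) (simp_all add: prof_L2)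

text \<open>At \<open>b = 0\<close> the Weyl difference is a pure modulation and at
  \<open>a = 0\<close> a pure shift, so each of the two yields one moment.\<close>

lemma prof_moments:
  assumes t: "0 \<le> t" and D: "\<And>a b. sqrt (weyl_energy a b t) \<le> D * (\<bar>a\<bar> + \<bar>b\<bar>)"
  shows "(\<lambda>\<xi>. of_real \<xi> * prof j t \<xi>) \<in> L2" "L2_norm (\<lambda>\<xi>. of_real \<xi> * prof j t \<xi>) \<le> D"
    "(\<lambda>x. of_real x * profx j t x) \<in> L2" "L2_norm (\<lambda>x. of_real x * profx j t x) \<le> D"
proof -
  have "L2_norm (\<lambda>\<xi>. (exp (\<i> * of_real (h * \<xi>)) - 1) * prof j t \<xi>) \<le> D * \<bar>h\<bar>" for h
    using weyl_diff_bound[OF D, of h 0 j] by (simp add: weyl_diff_def[abs_def] left_diff_distrib)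
  from modulation_bound_imp_moment[OF prof_L2(1)[OF t] this]
  show "(\<lambda>\<xi>. of_real \<xi> * prof j t \<xi>) \<in> L2" "L2_norm (\<lambda>\<xi>. of_real \<xi> * prof j t \<xi>) \<le> D" by auto
  have "L2_norm (\<lambda>\<xi>. prof j t (\<xi> + h) - prof j t \<xi>) \<le> D * \<bar>h\<bar>" for h
    using weyl_diff_bound[OF D, of 0 h j] by (simp add: weyl_diff_def[abs_def])
  from shift_bound_imp_moment[OF profx_fourier[OF t] this]
  show "(\<lambda>x. of_real x * profx j t x) \<in> L2" "L2_norm (\<lambda>x. of_real x * profx j t x) \<le> D" by auto
qed

end

section \<open>Comparison of the profile with the rescaled solution\<close>

text \<open>After scaling, \<open>(chirp s x - 1) / x\<close> has \<open>L\<^sup>2\<close> norm proportional to \<open>s powr (1/4)\<close>.\<close>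

definition chirp_quotient :: "real \<Rightarrow> real \<Rightarrow> complex" where
  "chirp_quotient s x = (chirp s x - 1) / of_real x"

definition chirp_const :: real where
  "chirp_const = L2_norm (chirp_quotient 1)"

lemma chirp_const_nonneg: "0 \<le> chirp_const"
  by (simp add: chirp_const_def)

lemma cmod_chirp_minus_one_le: "cmod (chirp s x - 1) \<le> \<bar>s * x\<^sup>2 / 2\<bar>" "cmod (chirp s x - 1) \<le> 2"
  using cmod_exp_minus_one_le[of "s * x\<^sup>2 / 2"] norm_triangle_ineq4[of "chirp s x" 1]
  by (simp_all add: chirp_def)

lemma chirp_quotient_measurable [measurable]: "chirp_quotient s \<in> borel_measurable borel"
  unfolding chirp_quotient_def[abs_def] by measurable

text \<open>The quotient is at most \<open>\<bar>x\<bar> / 2\<close> near \<open>0\<close> and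
  \<open>2 / \<bar>x\<bar>\<close> at infinity; the factor \<open>3\<close> covers both
  ranges.\<close>

lemma chirp_quotient_1_L2: "chirp_quotient 1 \<in> L2"
proof (rule L2_dominated(1)[OF inverse_sqrt_weight_L2, of _ 3])
  show "AE x in lborel. cmod (chirp_quotient 1 x) \<le> 3 * cmod (of_real (1 / sqrt (1 + x\<^sup>2)))"
  proof (rule AE_I2)
    fix x :: real
    have s: "0 < sqrt (1 + x\<^sup>2)" by (simp add: add_pos_nonneg)
    have w: "cmod (of_real (1 / sqrt (1 + x\<^sup>2))) = 1 / sqrt (1 + x\<^sup>2)"
      unfolding norm_of_real by (simp add: add_nonneg_nonneg)
    have "cmod (chirp_quotient 1 x) * sqrt (1 + x\<^sup>2) \<le> 3"
    proof (cases "\<bar>x\<bar> \<le> 1")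
      case True
      have "cmod (chirp_quotient 1 x) \<le> 1"
      proof (cases "x = 0")
        case False
        have "cmod (chirp 1 x - 1) \<le> \<bar>x\<bar> * \<bar>x\<bar> / 2"
          using cmod_chirp_minus_one_le(1)[of 1 x] by (simp add: power2_eq_square abs_mult)
        also have "\<dots> \<le> \<bar>x\<bar> * 1" using True mult_left_mono[OF True abs_ge_zero[of x]] by simp
        finally show ?thesis using False by (simp add: chirp_quotient_def norm_divide)
      qed (simp add: chirp_quotient_def)
      moreover have "sqrt (1 + x\<^sup>2) \<le> 3"
        using True by (intro real_le_lsqrt) (auto simp: abs_square_le_1[symmetric] intro: order_trans[of _ 2])
      ultimately show ?thesis using mult_mono[of "cmod (chirp_quotient 1 x)" 1 "sqrt (1 + x\<^sup>2)" 3] by simp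
    next
      case False
      have x1: "1 \<le> x\<^sup>2" using False abs_le_square_iff[of 1 x] by simp
      have "sqrt (1 + x\<^sup>2) \<le> 3 / 2 * \<bar>x\<bar>"
        using x1 by (intro real_le_lsqrt) (auto simp: power_mult_distrib power_divide)
      moreover have "cmod (chirp_quotient 1 x) \<le> 2 / \<bar>x\<bar>"
        using False cmod_chirp_minus_one_le(2)[of 1 x] by (simp add: chirp_quotient_def norm_divide divide_right_mono)
      ultimately have "cmod (chirp_quotient 1 x) * sqrt (1 + x\<^sup>2) \<le> 2 / \<bar>x\<bar> * (3 / 2 * \<bar>x\<bar>)"
        by (intro mult_mono) auto
      also have "\<dots> = 3" using False by auto
      finally show ?thesis .
    qed
    then show "cmod (chirp_quotient 1 x) \<le> 3 * cmod (of_real (1 / sqrt (1 + x\<^sup>2)))"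
      unfolding w using s by (simp add: pos_le_divide_eq)
  qed
qed auto

lemma chirp_quotient_scale:
  assumes s: "0 < s" shows "chirp_quotient s x = of_real (sqrt s) * chirp_quotient 1 (sqrt s * x)"
  using s by (simp add: chirp_quotient_def chirp_def power_mult_distrib)

lemma chirp_quotient_L2:
  assumes s: "0 < s" shows "chirp_quotient s \<in> L2" "L2_norm (chirp_quotient s) = s powr (1 / 4) * chirp_const"
proof -
  let ?r = "sqrt s"
  let ?f = "\<lambda>x. (cmod (chirp_quotient 1 x))\<^sup>2"
  have r: "0 < ?r" using s by simp
  have eq: "(\<lambda>x. (cmod (chirp_quotient s x))\<^sup>2) = (\<lambda>x. s * ?f (?r * x))"
    using s by (simp add: chirp_quotient_scale[OF s] norm_mult power_mult_distrib)
  have "integrable lborel (\<lambda>x. ?f (0 + ?r * x))"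
    by (rule lborel_integrable_real_affine[OF L2_integrable[OF chirp_quotient_1_L2]]) (use r in simp)
  then have int: "integrable lborel (\<lambda>x. ?f (?r * x))" by simp
  then show "chirp_quotient s \<in> L2" by (simp add: L2_def eq)
  have "(LINT x|lborel. ?f x) = ?r * (LINT x|lborel. ?f (?r * x))"
    using lborel_integral_real_affine[of ?r ?f 0] r by simp
  then have "(LINT x|lborel. (cmod (chirp_quotient s x))\<^sup>2) = ?r * (LINT x|lborel. ?f x)"
    unfolding eq using s by simp
  then have "L2_norm (chirp_quotient s) = sqrt ?r * chirp_const"
    by (simp add: L2_norm_def chirp_const_def real_sqrt_mult)
  also have "sqrt ?r = s powr (1 / 4)"
    using s by (simp add: powr_half_sqrt[symmetric] powr_powr)
  finally show "L2_norm (chirp_quotient s) = s powr (1 / 4) * chirp_const" .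
qed

text \<open>Writing \<open>(chirp s x - 1) * v x\<close> as \<open>chirp_quotient s x\<close> times
  \<open>x * v x\<close> and applying Cauchy-Schwarz, one moment of \<open>v\<close> buys the power
  \<open>1 / 4\<close> of the parameter in sup norm.\<close>

lemma fourier_chirp_diff:
  assumes v: "v \<in> L2" "integrable lborel v" and xv: "(\<lambda>x. of_real x * v x) \<in> L2" and s: "0 < \<bar>s\<bar>"
  shows "cmod (fourier (\<lambda>x. chirp s x * v x) \<xi> - fourier v \<xi>)
    \<le> chirp_const * \<bar>s\<bar> powr (1 / 4) * L2_norm (\<lambda>x. of_real x * v x)"
proof -
  note [measurable] = L2_measurable[OF v(1)]
  let ?d = "\<lambda>x. chirp s x * v x - v x"
  have cv: "integrable lborel (\<lambda>x. chirp s x * v x)"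
    by (rule integrable_mult_bounded[where C=1, OF v(2)]) auto
  have q: "chirp_quotient \<bar>s\<bar> \<in> L2" "L2_norm (chirp_quotient \<bar>s\<bar>) = \<bar>s\<bar> powr (1 / 4) * chirp_const"
    using chirp_quotient_L2[OF s] by auto
  have le: "cmod (?d x) = cmod (chirp_quotient \<bar>s\<bar> x) * cmod (of_real x * v x)" for x
  proof -
    \<comment> \<open>Changing the sign of the parameter only conjugates the chirp.\<close>
    have "cmod (chirp s x - 1) = cmod (chirp \<bar>s\<bar> x - 1)"
    proof (cases "0 \<le> s")
      case False
      then have "chirp s x - 1 = cnj (chirp \<bar>s\<bar> x - 1)" by simp
      then show ?thesis by (metis complex_mod_cnj)
    qed simp
    \<comment> \<open>At \<open>x = 0\<close> both sides vanish, whatever value the division by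
      \<open>0\<close> gives to the quotient.\<close>
    moreover have "chirp s 0 = 1" by (simp add: chirp_def)
    moreover have "?d x = (chirp s x - 1) * v x" by (simp add: left_diff_distrib)
    ultimately show ?thesis by (cases "x = 0") (auto simp: chirp_quotient_def norm_mult norm_divide)
  qed
  have pi1: "1 \<le> sqrt (2 * pi)" using pi_gt3 by (intro real_le_rsqrt) simp
  have "fourier (\<lambda>x. chirp s x * v x) \<xi> - fourier v \<xi> = fourier ?d \<xi>"
    by (rule fourier_diff[OF cv v(2), symmetric])
  also have "cmod \<dots> \<le> (LINT x|lborel. cmod (?d x)) / sqrt (2 * pi)" by (rule cmod_fourier_le)
  also have "\<dots> \<le> (LINT x|lborel. cmod (?d x)) / 1"
    using pi1 by (intro divide_left_mono) auto
  also have "\<dots> = (LINT x|lborel. cmod (chirp_quotient \<bar>s\<bar> x) * cmod (of_real x * v x))"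
    unfolding le by simp
  also have "\<dots> \<le> L2_norm (chirp_quotient \<bar>s\<bar>) * L2_norm (\<lambda>x. of_real x * v x)"
    by (rule L2_Cauchy_Schwarz_abs[OF q(1) xv])
  finally show ?thesis by (simp add: q(2) mult_ac)
qed

lemma csqrt_imaginary: assumes "0 < s" shows "csqrt (\<i> * of_real s) = of_real (sqrt s) * csqrt \<i>"
proof (rule csqrt_unique)
  have "(complex_of_real (sqrt s))\<^sup>2 = of_real s" using assms by (simp flip: of_real_power)
  then show "(of_real (sqrt s) * csqrt \<i>)\<^sup>2 = \<i> * of_real s"
    by (simp only: power_mult_distrib power2_csqrt mult.commute)
  show "0 < Re (of_real (sqrt s) * csqrt \<i>) \<or> Re (of_real (sqrt s) * csqrt \<i>) = 0 \<and> 0 \<le> Im (of_real (sqrt s) * csqrt \<i>)"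
    using assms by (simp add: field_simps)
qed

lemma cmod_csqrt_imaginary: assumes "0 < s" shows "cmod (csqrt (\<i> * of_real s)) = sqrt s"
proof -
  have "(cmod (csqrt \<i>))\<^sup>2 = 1" by (simp only: norm_power[symmetric] power2_csqrt norm_ii)
  then have "cmod (csqrt \<i>) = 1" by (metis norm_ge_zero power2_eq_1_iff abs_of_nonneg abs_neg_one)
  then show ?thesis using assms by (simp only: csqrt_imaginary norm_mult norm_of_real) simp
qed

lemma fourier_dilate:
  assumes t: "0 < t"
  shows "fourier (\<lambda>x. f (x / t)) \<xi> = of_real t * fourier f (t * \<xi>)"
proof -
  have "(LINT x|lborel. exp (- \<i> * of_real x * of_real \<xi>) * f (x / t))
      = of_real t * (LINT y|lborel. exp (- \<i> * of_real (t * y) * of_real \<xi>) * f y)"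
    using lborel_integral_real_affine[of t "\<lambda>x. exp (- \<i> * of_real x * of_real \<xi>) * f (x / t)" 0] t
    by (simp add: scaleR_conv_of_real)
  then show ?thesis by (simp add: fourier_def mult_ac)
qed

text \<open>A Lipschitz bound for the shifts of \<open>g\<close> is a first moment of its transform,
  so \<open>fourier_chirp_diff\<close> applies on the Fourier side: in sup norm the free evolution
  moves \<open>g\<close> by at most a multiple of \<open>s powr (1 / 4)\<close>.\<close>

lemma schroedinger_short_time:
  assumes g: "g \<in> L2" "integrable lborel g"
    and L: "\<And>h. L2_norm (\<lambda>\<xi>. g (\<xi> + h) - g \<xi>) \<le> L * \<bar>h\<bar>" and s: "0 < s"
  shows "integrable lborel (fourier g)"
    and "AE \<xi> in lborel. cmod (fourier (\<lambda>\<eta>. chirp (- s) \<eta> * fourier g \<eta>) (- \<xi>) - g \<xi>) \<le> chirp_const * s powr (1 / 4) * L"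
proof -
  have F: "is_fourier_L2 g (fourier g)" by (rule is_fourier_L2_L1[OF g])
  have FL: "fourier g \<in> L2" by (rule plancherel_L1(1)[OF g])
  have "L2_norm (\<lambda>x. (exp (\<i> * of_real (h * x)) - 1) * fourier g x) \<le> L * \<bar>h\<bar>" for h
  proof -
    have gh: "(\<lambda>\<xi>. g (\<xi> + h)) \<in> L2" "integrable lborel (\<lambda>\<xi>. g (\<xi> + h))"
      using L2_translate(1)[OF g(1)] translate_integrable(1)[OF g(2)] by auto
    have "(\<lambda>x. (exp (\<i> * of_real (h * x)) - 1) * fourier g x) = fourier (\<lambda>\<xi>. g (\<xi> + h) - g \<xi>)"
      by (rule ext) (simp add: fourier_diff[OF gh(2) g(2)] fourier_translate left_diff_distrib)
    then show ?thesis
      using plancherel_L1(2)[OF L2_diff[OF gh(1) g(1)] Bochner_Integration.integrable_diff[OF gh(2) g(2)]] L[of h]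
      by simp
  qed
  note m = modulation_bound_imp_moment[OF FL this]
  show int: "integrable lborel (fourier g)" by (rule weighted_L2_imp_L1(1)[OF FL m(1)])
  have "AE \<xi> in lborel. g \<xi> = fourier (fourier g) (- \<xi>)" by (rule fourier_inversion[OF F int])
  then show "AE \<xi> in lborel. cmod (fourier (\<lambda>\<eta>. chirp (- s) \<eta> * fourier g \<eta>) (- \<xi>) - g \<xi>) \<le> chirp_const * s powr (1 / 4) * L"
  proof eventually_elim
    case (elim \<xi>)
    have "cmod (fourier (\<lambda>\<eta>. chirp (- s) \<eta> * fourier g \<eta>) (- \<xi>) - fourier (fourier g) (- \<xi>))
        \<le> chirp_const * \<bar>- s\<bar> powr (1 / 4) * L2_norm (\<lambda>x. of_real x * fourier g x)"
      by (rule fourier_chirp_diff[OF FL int m(1)]) (use s in simp)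
    also have "\<dots> \<le> chirp_const * s powr (1 / 4) * L"
      using s m(2) chirp_const_nonneg by (simp add: mult_left_mono)
    finally show ?case by (simp only: elim)
  qed
qed

text \<open>In the factor \<open>3\<close>, one unit comes from shifting \<open>W j\<close> itself
  and two from shifting the squared modulus of the other component.\<close>

lemma cubic_shift_bound:
  assumes W: "\<And>j. W j \<in> L2" "\<And>j x. cmod (W j x) \<le> S" and L: "\<And>j h. L2_norm (\<lambda>x. W j (x + h) - W j x) \<le> X * \<bar>h\<bar>"
  shows "L2_norm (\<lambda>x. of_real ((cmod (W (\<not> j) (x + h)))\<^sup>2) * W j (x + h) - of_real ((cmod (W (\<not> j) x))\<^sup>2) * W j x)
    \<le> 3 * S\<^sup>2 * X * \<bar>h\<bar>"
proof -
  note [measurable] = L2_measurable[OF W(1)]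
  let ?d = "\<lambda>j x. W j (x + h) - W j x"
  let ?r = "\<lambda>x. of_real ((cmod (W (\<not> j) (x + h)))\<^sup>2) * ?d j x"
  let ?e = "\<lambda>x. of_real ((cmod (W (\<not> j) (x + h)))\<^sup>2) * W j (x + h) - of_real ((cmod (W (\<not> j) x))\<^sup>2) * W j x - ?r x"
  have d: "?d j \<in> L2" for j by (intro L2_diff L2_translate W)
  have rm: "?r \<in> borel_measurable borel" and em: "?e \<in> borel_measurable borel" by measurable
  have "AE x in lborel. cmod (?r x) \<le> S\<^sup>2 * cmod (?d j x)"
    using W(2) by (intro AE_I2) (simp add: norm_mult norm_power mult_right_mono power_mono)
  note r = L2_dominated[OF d rm this zero_le_power2]
  have "AE x in lborel. cmod (?e x) \<le> 2 * S\<^sup>2 * cmod (?d (\<not> j) x)"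
    by (intro AE_I2 cubic_difference_le W)
  note e = L2_dominated[OF d em this]
  have "L2_norm (\<lambda>x. ?r x + ?e x) \<le> L2_norm ?r + L2_norm ?e" by (rule L2_norm_triangle) (use r e in auto)
  also have "\<dots> \<le> S\<^sup>2 * (X * \<bar>h\<bar>) + 2 * S\<^sup>2 * (X * \<bar>h\<bar>)"
    using order_trans[OF r(2) mult_left_mono[OF L]] order_trans[OF e(2) mult_left_mono[OF L]] by (intro add_mono) auto
  finally show ?thesis by (simp add: algebra_simps)
qed

section \<open>The profile, the rescaled solution and the error in the profile equation\<close>

context nls_profile
begin

text \<open>The continuous representative of \<open>prof j t\<close>, available once
  \<open>profx j t\<close> is integrable; pointwise bounds are deduced for it from averages.\<close>

definition spec :: "bool \<Rightarrow> real \<Rightarrow> real \<Rightarrow> complex" where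
  "spec j t = fourier (profx j t)"

text \<open>The transform with the inner chirp of the factorisation: up to a unimodular factor and
  \<open>sqrt t\<close>, the wave at \<open>(t, x)\<close> is its value at
  \<open>x / t\<close>.\<close>

definition rescaled :: "bool \<Rightarrow> real \<Rightarrow> real \<Rightarrow> complex" where
  "rescaled j t = fourier (\<lambda>y. chirp (1 / t) y * profx j t y)"

lemma profx_L2: "0 \<le> t \<Longrightarrow> profx j t \<in> L2" "0 \<le> t \<Longrightarrow> L2_norm (profx j t) = L2_norm (prof j t)"
  using profx_fourier[of t j] by (auto dest: is_fourier_L2_D plancherel_L2)

context
  fixes t X :: real
  assumes t: "0 \<le> t"
    and xL2: "\<And>j. (\<lambda>x. of_real x * profx j t x) \<in> L2"
    and xle: "\<And>j. L2_norm (\<lambda>x. of_real x * profx j t x) \<le> X"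
    and nle: "\<And>j. L2_norm (prof j t) \<le> X"
begin

lemma profx_integrable: "integrable lborel (profx j t)"
  and profx_L1_le: "(LINT x|lborel. cmod (profx j t x)) \<le> 2 * weight_const * X"
proof -
  show "integrable lborel (profx j t)" by (rule weighted_L2_imp_L1(1)[OF profx_L2(1)[OF t] xL2])
  have "(LINT x|lborel. cmod (profx j t x)) \<le> weight_const * (L2_norm (profx j t) + L2_norm (\<lambda>x. of_real x * profx j t x))"
    by (rule weighted_L2_imp_L1(2)[OF profx_L2(1)[OF t] xL2])
  also have "\<dots> \<le> weight_const * (X + X)"
    using nle[of j] xle[of j] by (intro mult_left_mono add_mono) (auto simp: profx_L2(2)[OF t] weight_const_def)
  finally show "(LINT x|lborel. cmod (profx j t x)) \<le> 2 * weight_const * X" by simp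
qed

lemma fourier_profx_le:
  assumes "\<And>x. cmod (g x) = cmod (profx j t x)" shows "cmod (fourier g \<xi>) \<le> 2 * weight_const * X"
proof -
  have pi1: "1 \<le> sqrt (2 * pi)" using pi_gt3 by (intro real_le_rsqrt) simp
  have "cmod (fourier g \<xi>) \<le> (LINT x|lborel. cmod (profx j t x)) / sqrt (2 * pi)"
    using cmod_fourier_le[of g \<xi>] by (simp add: assms)
  also have "\<dots> \<le> (LINT x|lborel. cmod (profx j t x)) / 1" using pi1 by (intro divide_left_mono) auto
  finally show ?thesis using profx_L1_le[of j] by simp
qed

lemma spec_le: "cmod (spec j t \<xi>) \<le> 2 * weight_const * X"
  unfolding spec_def by (rule fourier_profx_le) simp

lemma rescaled_le: "cmod (rescaled j t \<xi>) \<le> 2 * weight_const * X"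
  unfolding rescaled_def by (rule fourier_profx_le[of _ j]) (simp add: norm_mult)

lemma spec_eq_prof: "AE \<xi> in lborel. prof j t \<xi> = spec j t \<xi>"
  unfolding spec_def
  by (rule is_fourier_L2_unique[OF profx_fourier[OF t] is_fourier_L2_L1[OF profx_L2(1)[OF t] profx_integrable]]) simp

lemma spec_continuous: "continuous_on A (spec j t)"
  unfolding spec_def by (rule continuous_on_fourier[OF profx_integrable])

lemma spec_measurable: "spec j t \<in> borel_measurable borel"
  unfolding spec_def by (rule fourier_measurable[OF profx_integrable])

lemma spec_integrable: "integrable lborel (spec j t)"
proof -
  have "integrable lborel (prof j t) = integrable lborel (spec j t)"
    by (rule integrable_cong_AE) (use spec_eq_prof spec_measurable L2_measurable[OF prof_L2(1)[OF t]] in auto)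
  then show ?thesis using prof_L2(3)[OF t] by simp
qed

context
  assumes tp: "0 < t"
begin

lemma chirp_profx: "(\<lambda>y. chirp (1 / t) y * profx j t y) \<in> L2" "integrable lborel (\<lambda>y. chirp (1 / t) y * profx j t y)"
  by (rule chirp_L2(1)[OF profx_L2(1)[OF t]])
    (rule integrable_mult_bounded[where C=1, OF profx_integrable], auto)

text \<open>The two transforms differ by a chirp of parameter \<open>1 / t\<close>, and the power
  \<open>1 / 4\<close> of that parameter is the decay.\<close>

lemma rescaled_minus_spec: "cmod (rescaled j t \<xi> - spec j t \<xi>) \<le> chirp_const * t powr (- 1 / 4) * X"
proof -
  have "cmod (rescaled j t \<xi> - spec j t \<xi>)
      \<le> chirp_const * \<bar>1 / t\<bar> powr (1 / 4) * L2_norm (\<lambda>x. of_real x * profx j t x)"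
    unfolding rescaled_def spec_def
    by (rule fourier_chirp_diff[OF profx_L2(1)[OF t] profx_integrable xL2]) (use tp in simp)
  also have "\<bar>1 / t\<bar> powr (1 / 4) = t powr (- 1 / 4)"
    using tp by (simp add: powr_divide powr_minus_divide)
  also have "chirp_const * t powr (- 1 / 4) * L2_norm (\<lambda>x. of_real x * profx j t x) \<le> chirp_const * t powr (- 1 / 4) * X"
    by (intro mult_left_mono xle mult_nonneg_nonneg chirp_const_nonneg) simp
  finally show ?thesis .
qed

lemma wave_rescaled: "wave j t x = chirp (1 / t) x * rescaled j t (x / t) / csqrt (\<i> * of_real t)"
proof -
  note [measurable] = U_meas[OF t] spec_measurable
  have "wave j t x = fourier (\<lambda>\<xi>. chirp (- t) \<xi> * fourier (profx j t) \<xi>) (- x)"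
    unfolding wave_def
  proof (rule fourier_cong_AE)
    show "AE \<xi> in lborel. U j t \<xi> = chirp (- t) \<xi> * fourier (profx j t) \<xi>"
      using spec_eq_prof[of j] unfolding spec_def[symmetric]
    proof eventually_elim
      case (elim \<xi>)
      have "chirp (- t) \<xi> * prof j t \<xi> = (chirp (- t) \<xi> * chirp t \<xi>) * U j t \<xi>" by (simp only: prof_def mult.assoc)
      then show ?case using elim by simp
    qed
    show "(\<lambda>\<xi>. chirp (- t) \<xi> * fourier (profx j t) \<xi>) \<in> borel_measurable borel"
      unfolding spec_def[symmetric] by measurable
  qed measurable
  also have "\<dots> = chirp (1 / t) x * rescaled j t (x / t) / csqrt (\<i> * of_real t)"
    unfolding rescaled_def
    by (rule schroedinger_factorisation[OF profx_integrable _ tp]) (use spec_integrable in \<open>simp add: spec_def\<close>)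
  finally show ?thesis .
qed

lemma cmod_wave_rescaled: "cmod (wave j t x) = cmod (rescaled j t (x / t)) / sqrt t"
  unfolding wave_rescaled by (simp only: norm_mult norm_divide cmod_chirp cmod_csqrt_imaginary[OF tp] mult_1)

lemma rescaled_L2: "rescaled j t \<in> L2"
  unfolding rescaled_def by (rule plancherel_L1(1)[OF chirp_profx])

text \<open>Shifts of the transform are modulations in space, and the unimodular chirp does not
  affect their norm; the moment in space is therefore the Lipschitz constant.\<close>

lemma rescaled_shift: "L2_norm (\<lambda>\<xi>. rescaled j t (\<xi> + h) - rescaled j t \<xi>) \<le> X * \<bar>h\<bar>"
proof -
  note [measurable] = L2_measurable[OF profx_L2(1)[OF t]]
  have n: "L2_norm (\<lambda>x. (exp (\<i> * of_real (c * x)) - 1) * (chirp (1 / t) x * profx j t x))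
      = L2_norm (\<lambda>x. (exp (\<i> * of_real (c * x)) - 1) * profx j t x)" for c
    by (simp add: L2_norm_def norm_mult)
  have "L2_norm (\<lambda>\<xi>. rescaled j t (\<xi> + h) - rescaled j t \<xi>)
      = L2_norm (\<lambda>x. (exp (\<i> * of_real (- h * x)) - 1) * profx j t x)"
    unfolding rescaled_def is_fourier_L2_shift_diff[OF is_fourier_L2_L1[OF chirp_profx]] by (rule n)
  also have "\<dots> \<le> \<bar>- h\<bar> * L2_norm (\<lambda>x. of_real x * profx j t x)"
    by (rule moment_imp_modulation_bound(2)[OF _ xL2]) measurable
  also have "\<dots> \<le> X * \<bar>h\<bar>" using xle[of j] mult_left_mono[OF xle[of j] abs_ge_zero[of h]] by (simp add: mult.commute)
  finally show ?thesis .
qed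

definition rcubic :: "bool \<Rightarrow> real \<Rightarrow> complex" where
  "rcubic j \<xi> = of_real ((cmod (rescaled (\<not> j) t \<xi>))\<^sup>2) * rescaled j t \<xi>"

lemma rcubic_L2: "rcubic j \<in> L2" "integrable lborel (rcubic j)"
  unfolding rcubic_def[abs_def] by (rule cubic_L2[OF rescaled_L2 rescaled_le rescaled_L2 rescaled_le])+

text \<open>By \<open>wave_rescaled\<close> the nonlinearity is a dilated chirp times
  \<open>rcubic j\<close>. Read backwards, the factorisation at time \<open>1 / t\<close> shows that
  \<open>chirp t\<close> times its transform is the free evolution of \<open>rcubic j\<close> over
  the short time \<open>1 / t\<close>, divided by \<open>t\<close>.\<close>

lemma chirp_fourier_nonlin:
  assumes ff: "integrable lborel (fourier (rcubic j))"
  shows "chirp t \<xi> * fourier (nonlin j t) \<xi>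
    = fourier (\<lambda>\<eta>. chirp (- (1 / t)) \<eta> * fourier (rcubic j) \<eta>) (- \<xi>) / of_real t"
proof -
  let ?c = "csqrt (\<i> * of_real t)"
  have "nonlin j t = (\<lambda>x. 1 / (of_real t * ?c) * (\<lambda>y. chirp t y * rcubic j y) (x / t))"
  proof (rule ext)
    fix x
    have c: "chirp (1 / t) x = chirp t (x / t)" using tp by (simp add: chirp_def power2_eq_square)
    have "(cmod (wave (\<not> j) t x))\<^sup>2 = (cmod (rescaled (\<not> j) t (x / t)))\<^sup>2 / t"
      using tp by (simp add: cmod_wave_rescaled power_divide)
    then have "nonlin j t x = of_real ((cmod (rescaled (\<not> j) t (x / t)))\<^sup>2 / t) * (chirp t (x / t) * rescaled j t (x / t) / ?c)"
      unfolding nonlin_def by (simp only: wave_rescaled[of j] c)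
    also have "\<dots> = 1 / (of_real t * ?c) * (chirp t (x / t) * rcubic j (x / t))"
      by (simp add: rcubic_def)
    finally show "nonlin j t x = 1 / (of_real t * ?c) * (\<lambda>y. chirp t y * rcubic j y) (x / t)" .
  qed
  then have "fourier (nonlin j t) \<xi> = 1 / (of_real t * ?c) * fourier (\<lambda>x. (\<lambda>y. chirp t y * rcubic j y) (x / t)) \<xi>"
    by (simp only: fourier_cmult)
  also have "\<dots> = 1 / ?c * fourier (\<lambda>y. chirp t y * rcubic j y) (t * \<xi>)"
    by (subst fourier_dilate[OF tp]) (use tp in simp)
  finally have N: "fourier (nonlin j t) \<xi> = 1 / ?c * fourier (\<lambda>y. chirp t y * rcubic j y) (t * \<xi>)" .
  have s: "0 < 1 / t" using tp by simp
  have "fourier (\<lambda>\<eta>. chirp (- (1 / t)) \<eta> * fourier (rcubic j) \<eta>) (- \<xi>)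
      = chirp t \<xi> * fourier (\<lambda>y. chirp t y * rcubic j y) (t * \<xi>) / csqrt (\<i> * of_real (1 / t))"
    using schroedinger_factorisation[OF rcubic_L2(2) ff s, of \<xi>] by (simp add: mult.commute)
  \<comment> \<open>The square roots of the factorisations at the times \<open>t\<close> and
    \<open>1 / t\<close> differ by the factor \<open>t\<close>.\<close>
  moreover have "csqrt (\<i> * of_real (1 / t)) * of_real t = ?c"
  proof -
    have "complex_of_real (sqrt (1 / t)) * of_real t = of_real (sqrt t)"
      unfolding of_real_mult[symmetric] using tp by (simp add: real_sqrt_divide real_div_sqrt)
    then show ?thesis unfolding csqrt_imaginary[OF s] csqrt_imaginary[OF tp] by (simp only: mult_ac)
  qed
  ultimately show ?thesis unfolding N by (metis (no_types, lifting) divide_divide_eq_left mult.right_neutral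
        times_divide_eq_left times_divide_eq_right mult.commute)
qed

text \<open>Undoing the short free evolution costs \<open>3 * S\<^sup>2 * k\<close>, and replacing
  \<open>rescaled\<close> by \<open>spec\<close> in the cubic term costs
  \<open>2 * S\<^sup>2 * k + S\<^sup>2 * k\<close>. With \<open>S = 2 * weight_const * X\<close> the
  total \<open>6 * S\<^sup>2 * k\<close> has the numerical constant \<open>24\<close>.\<close>

lemma profile_error:
  "AE \<xi> in lborel. cmod (of_real t * (chirp t \<xi> * fourier (nonlin j t) \<xi>) - of_real ((cmod (prof (\<not> j) t \<xi>))\<^sup>2) * prof j t \<xi>)
    \<le> 24 * chirp_const * weight_const\<^sup>2 * X ^ 3 * t powr (- 1 / 4)"
proof -
  define S where "S = 2 * weight_const * X"
  have S: "cmod (rescaled j t \<xi>) \<le> S" "cmod (spec j t \<xi>) \<le> S" for j \<xi>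
    unfolding S_def by (rule rescaled_le, rule spec_le)
  define k where "k = chirp_const * t powr (- 1 / 4) * X"
  have sh: "L2_norm (\<lambda>\<xi>. rcubic j (\<xi> + h) - rcubic j \<xi>) \<le> 3 * S\<^sup>2 * X * \<bar>h\<bar>" for h
    unfolding rcubic_def by (rule cubic_shift_bound[OF rescaled_L2 S(1) rescaled_shift])
  have s: "0 < 1 / t" using tp by simp
  have p: "(1 / t) powr (1 / 4) = t powr (- 1 / 4)" using tp by (simp add: powr_divide powr_minus_divide)
  note st = schroedinger_short_time[OF rcubic_L2 sh s]
  show ?thesis
    using st(2) spec_eq_prof[of j] spec_eq_prof[of "\<not> j"]
  proof eventually_elim
    case (elim \<xi>)
    let ?U = "fourier (\<lambda>\<eta>. chirp (- (1 / t)) \<eta> * fourier (rcubic j) \<eta>) (- \<xi>)"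
    let ?a = "of_real ((cmod (spec (\<not> j) t \<xi>))\<^sup>2) * spec j t \<xi>"
    have 1: "cmod (?U - rcubic j \<xi>) \<le> 3 * S\<^sup>2 * k"
      using elim(1) unfolding p k_def by (simp add: mult_ac)
    have d: "cmod (rescaled i t \<xi> - spec i t \<xi>) \<le> k" for i
      unfolding k_def by (rule rescaled_minus_spec)
    let ?m = "of_real ((cmod (rescaled (\<not> j) t \<xi>))\<^sup>2) * (rescaled j t \<xi> - spec j t \<xi>)"
    have "cmod (rcubic j \<xi> - ?a - ?m) \<le> 2 * S\<^sup>2 * cmod (rescaled (\<not> j) t \<xi> - spec (\<not> j) t \<xi>)"
      unfolding rcubic_def by (rule cubic_difference_le[OF S(1) S(2) S(2)])
    also have "\<dots> \<le> 2 * S\<^sup>2 * k" by (intro mult_left_mono d) simp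
    finally have 2: "cmod (rcubic j \<xi> - ?a - ?m) \<le> 2 * S\<^sup>2 * k" .
    have 3: "cmod ?m \<le> S\<^sup>2 * k"
      unfolding norm_mult norm_of_real abs_power2 by (intro mult_mono power_mono S d) auto
    have eq: "?U - ?a = (?U - rcubic j \<xi>) + (rcubic j \<xi> - ?a - ?m) + ?m" by simp
    have "cmod (?U - ?a) \<le> 3 * S\<^sup>2 * k + 2 * S\<^sup>2 * k + S\<^sup>2 * k"
      unfolding eq by (intro norm_triangle_le add_mono 1 2 3)
    also have "\<dots> = 24 * chirp_const * weight_const\<^sup>2 * X ^ 3 * t powr (- 1 / 4)"
      by (simp add: S_def k_def power_mult_distrib power2_eq_square power3_eq_cube)
    finally show ?case
      unfolding elim(2,3) chirp_fourier_nonlin[OF st(1)] using tp by simp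
  qed
qed

end

end

end

section \<open>The bootstrap\<close>

text \<open>The \<open>8\<close> is the integral of \<open>s powr (- 9 / 8)\<close> over
  \<open>[1, \<infinity>)\<close>. The bounds on the rate are one-sided, so a sink of unknown size
  is allowed.\<close>

lemma bounded_increment:
  fixes f :: "real \<Rightarrow> real"
  assumes T: "0 \<le> T" and f: "continuous_on {0..T} f" and c: "0 \<le> c0" "0 \<le> c1"
    and d0: "\<And>s. 0 < s \<Longrightarrow> s < T \<Longrightarrow> s < 1 \<Longrightarrow> \<exists>y. (f has_real_derivative y) (at s) \<and> y \<le> c0"
    and d1: "\<And>s. 1 \<le> s \<Longrightarrow> s < T \<Longrightarrow> \<exists>y. (f has_real_derivative y) (at s) \<and> y \<le> c1 * s powr (- 9 / 8)"
  shows "f T \<le> f 0 + c0 + 8 * c1"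
proof -
  have 1: "f r \<le> f 0 + c0" if r: "0 \<le> r" "r \<le> 1" "r \<le> T" for r
  proof -
    have "f r - c0 * r \<le> f 0 - c0 * 0"
    proof (rule DERIV_nonpos_imp_decreasing_open[OF r(1)])
      show "continuous_on {0..r} (\<lambda>s. f s - c0 * s)"
        using r by (intro continuous_intros continuous_on_subset[OF f]) auto
      fix s assume s: "0 < s" "s < r"
      then obtain y where "(f has_real_derivative y) (at s)" "y \<le> c0" using d0[of s] r by auto
      then show "\<exists>y. ((\<lambda>s. f s - c0 * s) has_real_derivative y) (at s) \<and> y \<le> 0"
        by (intro exI[of _ "y - c0"]) (auto intro!: derivative_eq_intros)
    qed
    then show ?thesis using mult_left_mono[OF r(2) c(1)] by simp
  qed
  show ?thesis
  proof (cases "T \<le> 1")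
    case True
    then show ?thesis using 1[of T] T c by simp
  next
    case False
    then have T1: "1 \<le> T" by simp
    \<comment> \<open>\<open>8 * c1 * s powr (- 1 / 8)\<close> is the part of the bound still to
      come after \<open>s\<close>; adding it makes the function nonincreasing.\<close>
    have "f T + 8 * c1 * T powr (- 1 / 8) \<le> f 1 + 8 * c1 * 1 powr (- 1 / 8)"
    proof (rule DERIV_nonpos_imp_decreasing_open[OF T1])
      show "continuous_on {1..T} (\<lambda>s. f s + 8 * c1 * s powr (- 1 / 8))"
        by (intro continuous_intros continuous_on_subset[OF f]) auto
      fix s assume s: "1 < s" "s < T"
      then obtain y where y: "(f has_real_derivative y) (at s)" "y \<le> c1 * s powr (- 9 / 8)" using d1[of s] by auto
      have "((\<lambda>s. f s + 8 * c1 * s powr (- 1 / 8)) has_real_derivative y + 8 * c1 * (- 1 / 8 * s powr (- 1 / 8 - 1))) (at s)"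
        using s y(1) by (auto intro!: derivative_eq_intros)
      moreover have "y + 8 * c1 * (- 1 / 8 * s powr (- 1 / 8 - 1)) \<le> 0" using y(2) by simp
      ultimately show "\<exists>y. ((\<lambda>s. f s + 8 * c1 * s powr (- 1 / 8)) has_real_derivative y) (at s) \<and> y \<le> 0" by blast
    qed
    moreover have "0 \<le> 8 * c1 * T powr (- 1 / 8)" using c by simp
    ultimately show ?thesis using 1[of 1] T1 by simp
  qed
qed

lemma integrable_indicator_Icc: "integrable lborel (\<lambda>x. indicator {a..b::real} x * (c::real))"
  by (intro integrable_mult_left integrable_real_indicator) (auto simp: emeasure_lborel_Icc_eq)

lemma integral_indicator_Icc: "a \<le> b \<Longrightarrow> (LINT x|lborel. indicator {a..b::real} x * (c::real)) = (b - a) * c"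
  by simp

text \<open>If \<open>h\<close> exceeded \<open>c\<close> at a point, it would exceed some larger
  \<open>c'\<close> on a short interval and violate the bound for the average there. Information in
  the mean thus becomes pointwise.\<close>

lemma continuous_le_of_averages:
  fixes h :: "real \<Rightarrow> real"
  assumes h: "continuous_on UNIV h" and int: "\<And>a b. integrable lborel (\<lambda>x. indicator {a..b} x * h x)"
    and le: "\<And>a b. a \<le> b \<Longrightarrow> (LINT x|lborel. indicator {a..b} x * h x) \<le> (b - a) * c"
  shows "h x \<le> c"
proof (rule ccontr)
  assume "\<not> h x \<le> c"
  then obtain c' where c': "c < c'" "c' < h x" using dense[of c "h x"] by auto
  have "isCont h x" using h by (simp add: continuous_on_eq_continuous_at)
  then have "\<forall>\<^sub>F y in at x. c' < h y" using c' unfolding isCont_def by (intro order_tendstoD)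
  then obtain d where d: "0 < d" "\<And>y. y \<noteq> x \<Longrightarrow> dist y x < d \<Longrightarrow> c' < h y"
    unfolding eventually_at by auto
  have hc: "c' \<le> h y" if "y \<in> {x..x + d / 2}" for y
    using that d c' by (cases "y = x") (auto simp: dist_real_def intro: less_imp_le)
  have "(x + d / 2 - x) * c' = (LINT y|lborel. indicator {x..x + d / 2} y * c')"
    using d by (subst integral_indicator_Icc) auto
  also have "\<dots> \<le> (LINT y|lborel. indicator {x..x + d / 2} y * h y)"
    by (rule integral_mono[OF integrable_indicator_Icc int]) (use hc in \<open>auto split: split_indicator\<close>)
  also have "\<dots> \<le> (x + d / 2 - x) * c" using d by (intro le) simp
  finally show False using d c' by simp
qed

text \<open>The bootstrap shows \<open>sqrt (1 + t) * cmod (wave j t x) \<le> wave_const D * \<epsilon>\<close>, and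
  \<open>error_const D * \<epsilon> ^ 4\<close> bounds the time integral of the remainder in the profile equation, where
  \<open>\<epsilon> * D\<close> measures the initial data.\<close>

definition wave_const :: "real \<Rightarrow> real" where
  "wave_const D = 10 * weight_const * D + 2 + 4 * chirp_const * D"

definition error_const :: "real \<Rightarrow> real" where
  "error_const D = 16 * weight_const * wave_const D * D ^ 3 + 12288 * chirp_const * weight_const ^ 3 * D ^ 4"

section \<open>Local masses and the bootstrap argument\<close>

context nls_profile
begin

definition local_mass :: "real \<Rightarrow> real \<Rightarrow> bool \<Rightarrow> real \<Rightarrow> real" where
  "local_mass a b j t = (L2_norm (\<lambda>\<xi>. indicator {a..b} \<xi> * prof j t \<xi>))\<^sup>2"

lemma local_mass_continuous: "continuous_on {0..} (local_mass a b j)"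
  unfolding local_mass_def[abs_def] by (rule energy_continuous[OF L2_operator_indicator])

lemma local_mass_eq: "local_mass a b j t = (LINT \<xi>|lborel. indicator {a..b} \<xi> * (cmod (prof j t \<xi>))\<^sup>2)"
  unfolding local_mass_def L2_norm_power2
  by (rule Bochner_Integration.integral_cong) (auto split: split_indicator)

text \<open>\<open>m\<close> is the leading part of the dissipation density and \<open>E\<close>
  bounds the rest. Before time \<open>1\<close> it is applied with \<open>m = 0\<close>, afterwards
  with the product of the squared moduli over \<open>t\<close>.\<close>

lemma local_mass_derivative:
  assumes t: "0 < t" and ab: "a \<le> b" and m: "integrable lborel (\<lambda>\<xi>. indicator {a..b} \<xi> * m \<xi>)"
    and le: "AE \<xi> in lborel. \<bar>Re (cnj (prof j t \<xi>) * (chirp t \<xi> * fourier (nonlin j t) \<xi>)) - m \<xi>\<bar> \<le> E"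
  obtains y where "(local_mass a b j has_real_derivative y) (at t)"
    "\<bar>y + 2 * (LINT \<xi>|lborel. indicator {a..b} \<xi> * m \<xi>)\<bar> \<le> 2 * (b - a) * E"
proof -
  have t0: "0 \<le> t" using t by simp
  let ?P = "\<lambda>\<xi>. chirp t \<xi> * fourier (nonlin j t) \<xi>"
  let ?i = "\<lambda>\<xi>. indicator {a..b} \<xi> :: real"
  have P: "?P \<in> L2" by (intro chirp_L2 plancherel_L1 nonlin_L2 t0)
  obtain C where C: "\<And>f. f \<in> L2 \<Longrightarrow> (\<lambda>\<xi>. indicator {a..b} \<xi> * f \<xi>) \<in> L2"
    using L2_operator_indicator[of a b] unfolding L2_operator_def by blast
  have int: "integrable lborel (\<lambda>\<xi>. cnj (indicator {a..b} \<xi> * prof j t \<xi>) * (indicator {a..b} \<xi> * ?P \<xi>))"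
    by (rule L2_mult_integrable(3)[OF C[OF prof_L2(1)[OF t0]] C[OF P]])
  let ?f = "\<lambda>\<xi>. Re (cnj (indicator {a..b} \<xi> * prof j t \<xi>) * (indicator {a..b} \<xi> * ?P \<xi>))"
  let ?y = "- 2 * Re (L2_inner (\<lambda>\<xi>. indicator {a..b} \<xi> * prof j t \<xi>) (\<lambda>\<xi>. indicator {a..b} \<xi> * ?P \<xi>))"
  have "Re (L2_inner (\<lambda>\<xi>. indicator {a..b} \<xi> * prof j t \<xi>) (\<lambda>\<xi>. indicator {a..b} \<xi> * ?P \<xi>)) = (LINT \<xi>|lborel. ?f \<xi>)"
    unfolding L2_inner_def by (rule integral_Re[OF int, symmetric])
  then have "?y + 2 * (LINT \<xi>|lborel. ?i \<xi> * m \<xi>) = - 2 * (LINT \<xi>|lborel. ?f \<xi> - ?i \<xi> * m \<xi>)"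
    using integrable_Re[OF int] m by (simp only: Bochner_Integration.integral_diff) simp
  moreover have "\<bar>LINT \<xi>|lborel. ?f \<xi> - ?i \<xi> * m \<xi>\<bar> \<le> (LINT \<xi>|lborel. \<bar>?f \<xi> - ?i \<xi> * m \<xi>\<bar>)"
    using integral_norm_bound[of lborel "\<lambda>\<xi>. ?f \<xi> - ?i \<xi> * m \<xi>"] by simp
  moreover have "(LINT \<xi>|lborel. \<bar>?f \<xi> - ?i \<xi> * m \<xi>\<bar>) \<le> (LINT \<xi>|lborel. ?i \<xi> * E)"
  proof (rule integral_mono_AE)
    show "integrable lborel (\<lambda>\<xi>. \<bar>?f \<xi> - ?i \<xi> * m \<xi>\<bar>)"
      by (intro integrable_abs Bochner_Integration.integrable_diff integrable_Re int m)
    show "AE \<xi> in lborel. \<bar>?f \<xi> - ?i \<xi> * m \<xi>\<bar> \<le> ?i \<xi> * E"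
      using le by eventually_elim (simp split: split_indicator)
  qed (rule integrable_indicator_Icc)
  moreover have "(LINT \<xi>|lborel. ?i \<xi> * E) = (b - a) * E" by (rule integral_indicator_Icc[OF ab])
  ultimately have "\<bar>?y + 2 * (LINT \<xi>|lborel. ?i \<xi> * m \<xi>)\<bar> \<le> 2 * (b - a) * E" by linarith
  moreover have "(local_mass a b j has_real_derivative ?y) (at t)"
    unfolding local_mass_def[abs_def] by (rule energy_derivative[OF L2_operator_indicator t])
  ultimately show ?thesis by (rule that[rotated])
qed

text \<open>\<open>small1\<close> keeps the growth exponent of the moments at \<open>1 / 32\<close>;
  \<open>small2\<close> keeps the time integral of the remainder below
  \<open>\<epsilon>\<^sup>2\<close>.\<close>

context
  fixes \<epsilon> D :: real
  assumes eps: "0 < \<epsilon>" and D: "1 \<le> D"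
    and init_weyl: "\<And>a b. sqrt (weyl_energy a b 0) \<le> \<epsilon> * D * (\<bar>a\<bar> + \<bar>b\<bar>)"
    and init_mass: "\<And>j. L2_norm (prof j 0) \<le> \<epsilon> * D"
    and small1: "8 * (wave_const D)\<^sup>2 * \<epsilon>\<^sup>2 \<le> 1 / 32"
    and small2: "error_const D * \<epsilon>\<^sup>2 \<le> 1"
begin

lemma wave_const_ge: "2 \<le> wave_const D" "0 \<le> wave_const D"
  using D weight_const_nonneg chirp_const_nonneg by (simp_all add: wave_const_def)

section \<open>Estimates under the bootstrap hypothesis, which allows twice the constant to be
  proved\<close>

context
  fixes T :: real
  assumes T: "0 \<le> T" and bd: "\<And>s j x. 0 < s \<Longrightarrow> s < T \<Longrightarrow> cmod (wave j s x) \<le> 2 * wave_const D * \<epsilon> / sqrt (1 + s)"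
begin

text \<open>The energy grows with exponent \<open>4 * K\<^sup>2\<close> for
  \<open>K = 2 * wave_const D * \<epsilon>\<close>, which \<open>small1\<close> bounds by
  \<open>1 / 16\<close>; taking the square root of the energy leaves \<open>1 / 32\<close>.\<close>

lemma moment_growth:
  assumes t: "0 \<le> t" "t \<le> T"
  shows "(\<lambda>\<xi>. of_real \<xi> * prof j t \<xi>) \<in> L2" "L2_norm (\<lambda>\<xi>. of_real \<xi> * prof j t \<xi>) \<le> \<epsilon> * D * (1 + t) powr (1 / 32)"
    "(\<lambda>x. of_real x * profx j t x) \<in> L2" "L2_norm (\<lambda>x. of_real x * profx j t x) \<le> \<epsilon> * D * (1 + t) powr (1 / 32)"
    "L2_norm (prof j t) \<le> \<epsilon> * D * (1 + t) powr (1 / 32)"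
proof -
  let ?K = "2 * wave_const D * \<epsilon>"
  have g: "sqrt (weyl_energy a b t) \<le> \<epsilon> * D * (1 + t) powr (1 / 32) * (\<bar>a\<bar> + \<bar>b\<bar>)" for a b
  proof -
    have "weyl_energy a b t \<le> weyl_energy a b 0 * (1 + t) powr (4 * ?K\<^sup>2)"
      by (rule weyl_energy_growth[OF t(1)]) (use bd t in auto)
    also have "\<dots> \<le> (\<epsilon> * D * (\<bar>a\<bar> + \<bar>b\<bar>))\<^sup>2 * ((1 + t) powr (1 / 32))\<^sup>2"
    proof (rule mult_mono)
      have n: "0 \<le> weyl_energy a b 0" by (simp add: weyl_energy_def)
      show "weyl_energy a b 0 \<le> (\<epsilon> * D * (\<bar>a\<bar> + \<bar>b\<bar>))\<^sup>2"
        using power_mono[OF init_weyl[of a b] real_sqrt_ge_zero[OF n], of 2] n by simp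
      have "4 * ?K\<^sup>2 \<le> 1 / 16" using small1 by (simp add: power_mult_distrib)
      then have "(1 + t) powr (4 * ?K\<^sup>2) \<le> (1 + t) powr (1 / 16)" using t by (intro powr_mono) auto
      also have "\<dots> = ((1 + t) powr (1 / 32))\<^sup>2" using t by (simp add: power2_eq_square flip: powr_add)
      finally show "(1 + t) powr (4 * ?K\<^sup>2) \<le> ((1 + t) powr (1 / 32))\<^sup>2" .
    qed auto
    also have "\<dots> = (\<epsilon> * D * (1 + t) powr (1 / 32) * (\<bar>a\<bar> + \<bar>b\<bar>))\<^sup>2" by (simp add: power_mult_distrib mult_ac)
    finally show ?thesis using eps D by (intro real_le_lsqrt) auto
  qed
  show "(\<lambda>\<xi>. of_real \<xi> * prof j t \<xi>) \<in> L2" "L2_norm (\<lambda>\<xi>. of_real \<xi> * prof j t \<xi>) \<le> \<epsilon> * D * (1 + t) powr (1 / 32)"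
    "(\<lambda>x. of_real x * profx j t x) \<in> L2" "L2_norm (\<lambda>x. of_real x * profx j t x) \<le> \<epsilon> * D * (1 + t) powr (1 / 32)"
    using prof_moments[OF t(1) g] by auto
  have "1 \<le> (1 + t) powr (1 / 32)" using t by (intro ge_one_powr_ge_zero) auto
  then have "\<epsilon> * D * 1 \<le> \<epsilon> * D * (1 + t) powr (1 / 32)" using eps D by (intro mult_left_mono) auto
  then show "L2_norm (prof j t) \<le> \<epsilon> * D * (1 + t) powr (1 / 32)"
    using order_trans[OF mass_nonincreasing[OF t(1)] init_mass[of j]] by simp
qed

lemmas moment_facts = moment_growth(3-5)

lemma prof_le: assumes t: "0 \<le> t" "t \<le> T"
  shows "AE \<xi> in lborel. cmod (prof j t \<xi>) \<le> 2 * weight_const * (\<epsilon> * D * (1 + t) powr (1 / 32))"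
  using spec_eq_prof[OF t(1) moment_facts[OF t], of j] 
  by eventually_elim (simp only: spec_le[OF t(1) moment_facts[OF t]])

text \<open>The sup bound on one factor and the mass of the other bound the nonlinearity in L1,
  hence its transform pointwise. No negative power of \<open>t\<close> appears.\<close>

lemma error_early:
  assumes t: "0 < t" "t < T" "t < 1"
  shows "AE \<xi> in lborel. \<bar>Re (cnj (prof j t \<xi>) * (chirp t \<xi> * fourier (nonlin j t) \<xi>)) - 0\<bar>
    \<le> 8 * weight_const * wave_const D * D ^ 3 * \<epsilon> ^ 4"
proof -
  have t0: "0 \<le> t" "t \<le> T" using t by auto
  let ?M = "2 * wave_const D * \<epsilon>"
  have M: "cmod (wave j t x) \<le> ?M" for j x
  proof -
    have "cmod (wave j t x) \<le> ?M / sqrt (1 + t)" by (rule bd[OF t(1,2)])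
    also have "\<dots> \<le> ?M / 1" using t wave_const_ge eps by (intro divide_left_mono) auto
    finally show ?thesis by simp
  qed
  have "(LINT x|lborel. cmod (nonlin j t x)) \<le> (LINT x|lborel. ?M * (cmod (wave (\<not> j) t x))\<^sup>2)"
  proof (rule integral_mono)
    show "integrable lborel (\<lambda>x. cmod (nonlin j t x))" by (intro integrable_norm nonlin_L2 t0)
    show "integrable lborel (\<lambda>x. ?M * (cmod (wave (\<not> j) t x))\<^sup>2)"
      by (intro integrable_mult_right L2_integrable wave_L2 t0)
    show "cmod (nonlin j t x) \<le> ?M * (cmod (wave (\<not> j) t x))\<^sup>2" for x
      using mult_right_mono[OF M[of j x], of "(cmod (wave (\<not> j) t x))\<^sup>2"]
      by (simp add: nonlin_def norm_mult norm_power mult.commute)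
  qed
  also have "\<dots> = ?M * (L2_norm (wave (\<not> j) t))\<^sup>2" by (simp add: L2_norm_power2)
  also have "L2_norm (wave (\<not> j) t) = L2_norm (prof (\<not> j) t)" using t0 by (simp add: wave_L2 prof_L2)
  also have "?M * (L2_norm (prof (\<not> j) t))\<^sup>2 \<le> ?M * (\<epsilon> * D)\<^sup>2"
    using order_trans[OF mass_nonincreasing[OF t0(1)] init_mass] wave_const_ge eps
    by (intro mult_left_mono power_mono) auto
  finally have N: "(LINT x|lborel. cmod (nonlin j t x)) \<le> ?M * (\<epsilon> * D)\<^sup>2" .
  have s: "2 \<le> sqrt (2 * pi)" using pi_gt3 by (intro real_le_rsqrt) simp
  have F: "cmod (fourier (nonlin j t) \<xi>) \<le> ?M * (\<epsilon> * D)\<^sup>2 / 2" for \<xi>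
  proof -
    have "cmod (fourier (nonlin j t) \<xi>) \<le> (LINT x|lborel. cmod (nonlin j t x)) / sqrt (2 * pi)" by (rule cmod_fourier_le)
    also have "\<dots> \<le> (LINT x|lborel. cmod (nonlin j t x)) / 2" using s by (intro divide_left_mono) auto
    finally show ?thesis using N by simp
  qed
  show ?thesis
    using prof_le[OF t0, of j]
  proof eventually_elim
    case (elim \<xi>)
    have ed: "0 \<le> \<epsilon> * D" using eps D by simp
    have "\<epsilon> * D * (1 + t) powr (1 / 32) \<le> \<epsilon> * D * 2"
      using powr_small[of t] t ed by (intro mult_left_mono) auto
    then have p: "cmod (prof j t \<xi>) \<le> 2 * weight_const * (\<epsilon> * D * 2)"
      using elim weight_const_nonneg by (meson mult_left_mono mult_nonneg_nonneg order_trans zero_le_numeral)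
    have "\<bar>Re (cnj (prof j t \<xi>) * (chirp t \<xi> * fourier (nonlin j t) \<xi>))\<bar> \<le> cmod (prof j t \<xi>) * cmod (fourier (nonlin j t) \<xi>)"
      using abs_Re_le_cmod[of "cnj (prof j t \<xi>) * (chirp t \<xi> * fourier (nonlin j t) \<xi>)"] by (simp only: norm_mult complex_mod_cnj cmod_chirp mult_1)
    also have "\<dots> \<le> (2 * weight_const * (\<epsilon> * D * 2)) * (?M * (\<epsilon> * D)\<^sup>2 / 2)"
      using weight_const_nonneg ed by (intro mult_mono p F) auto
    also have "\<dots> = 4 * weight_const * wave_const D * D ^ 3 * \<epsilon> ^ 4"
      by (simp add: power_mult_distrib power2_eq_square power3_eq_cube power4_eq_xxxx)
    also have "\<dots> \<le> 8 * weight_const * wave_const D * D ^ 3 * \<epsilon> ^ 4"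
      using weight_const_nonneg wave_const_ge D eps by (intro mult_right_mono) auto
    finally show ?case by simp
  qed
qed

text \<open>Pairing \<open>profile_error\<close> with \<open>cnj (prof j t \<xi>)\<close> gives the
  constant \<open>48\<close> and four growth factors. By \<open>powr_large\<close> these are at most
  \<open>16 * t powr (1 / 8)\<close>, whence \<open>768\<close>, and after division by
  \<open>t\<close> the exponent is \<open>1 / 8 - 1 / 4 - 1 = - 9 / 8\<close>.\<close>

lemma error_late:
  assumes t: "1 \<le> t" "t < T"
  shows "AE \<xi> in lborel. \<bar>Re (cnj (prof j t \<xi>) * (chirp t \<xi> * fourier (nonlin j t) \<xi>))
      - (cmod (prof j t \<xi>))\<^sup>2 * (cmod (prof (\<not> j) t \<xi>))\<^sup>2 / t\<bar>
    \<le> 768 * chirp_const * weight_const ^ 3 * D ^ 4 * \<epsilon> ^ 4 * t powr (- 9 / 8)"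
proof -
  have t0: "0 \<le> t" "t \<le> T" "0 < t" using t by auto
  let ?X = "\<epsilon> * D * (1 + t) powr (1 / 32)"
  let ?P = "\<lambda>\<xi>. chirp t \<xi> * fourier (nonlin j t) \<xi>"
  show ?thesis
    using prof_le[OF t0(1,2), of j] profile_error[OF t0(1) moment_facts[OF t0(1,2)] t0(3), of j]
  proof eventually_elim
    case (elim \<xi>)
    let ?R = "of_real t * ?P \<xi> - of_real ((cmod (prof (\<not> j) t \<xi>))\<^sup>2) * prof j t \<xi>"
    have "cnj (prof j t \<xi>) * (of_real t * ?P \<xi>)
        = of_real ((cmod (prof (\<not> j) t \<xi>))\<^sup>2) * (prof j t \<xi> * cnj (prof j t \<xi>)) + cnj (prof j t \<xi>) * ?R"
      by (simp add: algebra_simps)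
    also have "prof j t \<xi> * cnj (prof j t \<xi>) = of_real ((cmod (prof j t \<xi>))\<^sup>2)" by (simp only: complex_norm_square)
    finally have "of_real t * (cnj (prof j t \<xi>) * ?P \<xi>)
        = of_real ((cmod (prof (\<not> j) t \<xi>))\<^sup>2 * (cmod (prof j t \<xi>))\<^sup>2) + cnj (prof j t \<xi>) * ?R"
      by (simp only: of_real_mult mult.left_commute[of "of_real t"])
    from arg_cong[OF this, of Re]
    have "t * Re (cnj (prof j t \<xi>) * ?P \<xi>) - (cmod (prof j t \<xi>))\<^sup>2 * (cmod (prof (\<not> j) t \<xi>))\<^sup>2
        = Re (cnj (prof j t \<xi>) * ?R)"
      by (simp only: Re_complex_of_real plus_complex.sel times_complex.sel Im_complex_of_real) simp
    then have "\<bar>t * Re (cnj (prof j t \<xi>) * ?P \<xi>) - (cmod (prof j t \<xi>))\<^sup>2 * (cmod (prof (\<not> j) t \<xi>))\<^sup>2\<bar>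
        \<le> cmod (prof j t \<xi>) * cmod ?R"
      using abs_Re_le_cmod[of "cnj (prof j t \<xi>) * ?R"] by (simp only: norm_mult complex_mod_cnj)
    also have "\<dots> \<le> (2 * weight_const * ?X) * (24 * chirp_const * weight_const\<^sup>2 * ?X ^ 3 * t powr (- 1 / 4))"
      using weight_const_nonneg eps D by (intro mult_mono elim) auto
    also have "\<dots> = 48 * chirp_const * weight_const ^ 3 * D ^ 4 * \<epsilon> ^ 4 * ((1 + t) powr (1 / 32)) ^ 4 * t powr (- 1 / 4)"
      by (simp add: power_mult_distrib power2_eq_square power3_eq_cube power4_eq_xxxx)
    also have "\<dots> \<le> 48 * chirp_const * weight_const ^ 3 * D ^ 4 * \<epsilon> ^ 4 * (2 ^ 4 * t powr (4 / 32)) * t powr (- 1 / 4)"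
      using powr_large[OF t(1), of 4] weight_const_nonneg chirp_const_nonneg D eps
      by (intro mult_right_mono mult_left_mono) auto
    also have "\<dots> = 768 * chirp_const * weight_const ^ 3 * D ^ 4 * \<epsilon> ^ 4 * (t powr (4 / 32) * t powr (- 1 / 4))" by simp
    also have "t powr (4 / 32) * t powr (- 1 / 4) = t powr (- 9 / 8) * t"
    proof -
      have "t powr (- 9 / 8) * t powr 1 = t powr (4 / 32) * t powr (- 1 / 4)"
        unfolding powr_add[symmetric] by simp
      moreover have "t powr 1 = t" using t by simp
      ultimately show ?thesis by (simp only:)
    qed
    finally have "\<bar>t * Re (cnj (prof j t \<xi>) * ?P \<xi>) - (cmod (prof j t \<xi>))\<^sup>2 * (cmod (prof (\<not> j) t \<xi>))\<^sup>2\<bar>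
      \<le> (768 * chirp_const * weight_const ^ 3 * D ^ 4 * \<epsilon> ^ 4 * t powr (- 9 / 8)) * t" by simp
    moreover have "\<bar>Re (cnj (prof j t \<xi>) * ?P \<xi>) - (cmod (prof j t \<xi>))\<^sup>2 * (cmod (prof (\<not> j) t \<xi>))\<^sup>2 / t\<bar> * t
        = \<bar>t * Re (cnj (prof j t \<xi>) * ?P \<xi>) - (cmod (prof j t \<xi>))\<^sup>2 * (cmod (prof (\<not> j) t \<xi>))\<^sup>2\<bar>"
    proof -
      have "(r - w / t) * t = t * r - w" for r w :: real using t by (simp add: field_simps)
      moreover have "\<bar>r\<bar> * t = \<bar>r * t\<bar>" for r using t by (simp add: abs_mult)
      ultimately show ?thesis by (simp only:)
    qed
    ultimately have "\<bar>Re (cnj (prof j t \<xi>) * ?P \<xi>) - (cmod (prof j t \<xi>))\<^sup>2 * (cmod (prof (\<not> j) t \<xi>))\<^sup>2 / t\<bar> * t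
      \<le> (768 * chirp_const * weight_const ^ 3 * D ^ 4 * \<epsilon> ^ 4 * t powr (- 9 / 8)) * t" by (simp only:)
    then show ?case using t by (simp only: mult_le_cancel_right)
  qed
qed

lemma product_integrable:
  assumes t: "0 \<le> t" "t \<le> T"
  shows "integrable lborel (\<lambda>\<xi>. indicator {a..b} \<xi> * ((cmod (prof j t \<xi>))\<^sup>2 * (cmod (prof (\<not> j) t \<xi>))\<^sup>2 / r))"
proof (rule Bochner_Integration.integrable_bound[rotated])
  note [measurable] = L2_measurable[OF prof_L2(1)[OF t(1), of j]] L2_measurable[OF prof_L2(1)[OF t(1), of "\<not> j"]]
  show "(\<lambda>\<xi>. indicator {a..b} \<xi> * ((cmod (prof j t \<xi>))\<^sup>2 * (cmod (prof (\<not> j) t \<xi>))\<^sup>2 / r)) \<in> borel_measurable lborel"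
    by measurable
  let ?S = "2 * weight_const * (\<epsilon> * D * (1 + t) powr (1 / 32))"
  show "integrable lborel (\<lambda>\<xi>. indicator {a..b} \<xi> * (?S\<^sup>2 * ?S\<^sup>2 / \<bar>r\<bar>))" by (rule integrable_indicator_Icc)
  show "AE \<xi> in lborel. norm (indicator {a..b} \<xi> * ((cmod (prof j t \<xi>))\<^sup>2 * (cmod (prof (\<not> j) t \<xi>))\<^sup>2 / r))
      \<le> norm (indicator {a..b} \<xi> * (?S\<^sup>2 * ?S\<^sup>2 / \<bar>r\<bar>))"
    using prof_le[OF t, of j] prof_le[OF t, of "\<not> j"]
  proof eventually_elim
    case (elim \<xi>)
    have "(cmod (prof j t \<xi>))\<^sup>2 * (cmod (prof (\<not> j) t \<xi>))\<^sup>2 / \<bar>r\<bar> \<le> ?S\<^sup>2 * ?S\<^sup>2 / \<bar>r\<bar>"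
      by (intro divide_right_mono mult_mono power_mono elim) auto
    then show ?case by (simp add: abs_mult split: split_indicator)
  qed
qed

text \<open>The sink \<open>p\<close> is the same for both components, so it cancels in the difference of the local masses.\<close>

lemma local_mass_rate:
  assumes t: "0 < t" "t < T" and ab: "a \<le> b"
  obtains y p where "\<And>j. (local_mass a b j has_real_derivative y j) (at t)" "0 \<le> p"
    "\<And>j. \<bar>y j + p\<bar> \<le> (if t < 1 then 16 * weight_const * wave_const D * D ^ 3 * \<epsilon> ^ 4 * (b - a)
       else 1536 * chirp_const * weight_const ^ 3 * D ^ 4 * \<epsilon> ^ 4 * (b - a) * t powr (- 9 / 8))"
proof (cases "t < 1")
  case True
  have "\<exists>y. (local_mass a b j has_real_derivative y) (at t) \<and>
      \<bar>y + 0\<bar> \<le> 16 * weight_const * wave_const D * D ^ 3 * \<epsilon> ^ 4 * (b - a)" for j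
  proof -
    obtain y where "(local_mass a b j has_real_derivative y) (at t)"
      "\<bar>y + 2 * (LINT \<xi>|lborel. indicator {a..b} \<xi> * 0)\<bar> \<le> 2 * (b - a) * (8 * weight_const * wave_const D * D ^ 3 * \<epsilon> ^ 4)"
      by (rule local_mass_derivative[OF t(1) ab _ error_early[OF t True]]) simp_all
    then show ?thesis by (intro exI[of _ y]) (simp add: algebra_simps)
  qed
  then obtain y where "\<And>j. (local_mass a b j has_real_derivative y j) (at t)"
    "\<And>j. \<bar>y j + 0\<bar> \<le> 16 * weight_const * wave_const D * D ^ 3 * \<epsilon> ^ 4 * (b - a)" by metis
  then show ?thesis using that[of y 0] True by simp
next
  case False
  then have t1: "1 \<le> t" by simp
  let ?m = "\<lambda>j \<xi>. (cmod (prof j t \<xi>))\<^sup>2 * (cmod (prof (\<not> j) t \<xi>))\<^sup>2 / t"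
  define p where "p = 2 * (LINT \<xi>|lborel. indicator {a..b} \<xi> * ?m True \<xi>)"
  have "0 \<le> p" unfolding p_def using t by simp
  have sym: "2 * (LINT \<xi>|lborel. indicator {a..b} \<xi> * ?m j \<xi>) = p" for j
    by (cases j) (simp_all add: p_def mult.commute)
  have "\<exists>y. (local_mass a b j has_real_derivative y) (at t) \<and>
      \<bar>y + p\<bar> \<le> 1536 * chirp_const * weight_const ^ 3 * D ^ 4 * \<epsilon> ^ 4 * (b - a) * t powr (- 9 / 8)" for j
  proof -
    obtain y where "(local_mass a b j has_real_derivative y) (at t)"
      "\<bar>y + 2 * (LINT \<xi>|lborel. indicator {a..b} \<xi> * ?m j \<xi>)\<bar>
        \<le> 2 * (b - a) * (768 * chirp_const * weight_const ^ 3 * D ^ 4 * \<epsilon> ^ 4 * t powr (- 9 / 8))"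
      by (rule local_mass_derivative[OF t(1) ab product_integrable error_late[OF t1 t(2)]]) (use t in auto)
    then show ?thesis unfolding sym[of j] by (intro exI[of _ y]) (simp add: algebra_simps)
  qed
  then obtain y where "\<And>j. (local_mass a b j has_real_derivative y j) (at t)"
    "\<And>j. \<bar>y j + p\<bar> \<le> 1536 * chirp_const * weight_const ^ 3 * D ^ 4 * \<epsilon> ^ 4 * (b - a) * t powr (- 9 / 8)" by metis
  then show ?thesis using that[of y p] False \<open>0 \<le> p\<close> by simp
qed

text \<open>For a single component the nonnegative sink is dropped; in the difference it cancels and
  the errors add up. Integration in time produces \<open>c0 + 8 * c1\<close>, which is where
  \<open>12288 = 8 * 1536\<close> in \<open>error_const\<close> comes from.\<close>

lemma local_mass_increment:
  assumes ab: "a \<le> b"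
  shows "local_mass a b j T \<le> local_mass a b j 0 + (b - a) * (error_const D * \<epsilon> ^ 4)"
    and "local_mass a b j T - local_mass a b (\<not> j) T
      \<le> local_mass a b j 0 - local_mass a b (\<not> j) 0 + 2 * ((b - a) * (error_const D * \<epsilon> ^ 4))"
proof -
  define c0 where "c0 = 16 * weight_const * wave_const D * D ^ 3 * \<epsilon> ^ 4 * (b - a)"
  define c1 where "c1 = 1536 * chirp_const * weight_const ^ 3 * D ^ 4 * \<epsilon> ^ 4 * (b - a)"
  have c: "0 \<le> c0" "0 \<le> c1"
    using weight_const_nonneg chirp_const_nonneg wave_const_ge D eps ab by (auto simp: c0_def c1_def)
  have e: "c0 + 8 * c1 = (b - a) * (error_const D * \<epsilon> ^ 4)"
    by (simp add: c0_def c1_def error_const_def algebra_simps)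
  have cont: "continuous_on {0..T} (local_mass a b j)" for j
    by (rule continuous_on_subset[OF local_mass_continuous]) auto
  have r: "\<exists>y p. (\<forall>j. (local_mass a b j has_real_derivative y j) (at s)) \<and> 0 \<le> p \<and>
      (\<forall>j. \<bar>y j + p\<bar> \<le> (if s < 1 then c0 else c1 * s powr (- 9 / 8)))" if s: "0 < s" "s < T" for s
  proof -
    obtain y p where "\<And>j. (local_mass a b j has_real_derivative y j) (at s)" "0 \<le> p"
      "\<And>j. \<bar>y j + p\<bar> \<le> (if s < 1 then 16 * weight_const * wave_const D * D ^ 3 * \<epsilon> ^ 4 * (b - a)
       else 1536 * chirp_const * weight_const ^ 3 * D ^ 4 * \<epsilon> ^ 4 * (b - a) * s powr (- 9 / 8))"
      using local_mass_rate[OF s ab] by blast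
    then show ?thesis unfolding c0_def c1_def by blast
  qed
  have "local_mass a b j T \<le> local_mass a b j 0 + c0 + 8 * c1"
  proof (rule bounded_increment[OF T cont c])
    fix s assume s: "0 < s" "s < T" "s < 1"
    from r[OF s(1,2)] s(3) show "\<exists>y. (local_mass a b j has_real_derivative y) (at s) \<and> y \<le> c0"
      by (smt (verit))
  next
    fix s assume s: "1 \<le> s" "s < T"
    from r[of s] s show "\<exists>y. (local_mass a b j has_real_derivative y) (at s) \<and> y \<le> c1 * s powr (- 9 / 8)"
      by (smt (verit))
  qed
  then show "local_mass a b j T \<le> local_mass a b j 0 + (b - a) * (error_const D * \<epsilon> ^ 4)" using e by simp
  let ?f = "\<lambda>s. local_mass a b j s - local_mass a b (\<not> j) s"
  have "?f T \<le> ?f 0 + 2 * c0 + 8 * (2 * c1)"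
  proof (rule bounded_increment[OF T])
    show "continuous_on {0..T} ?f" by (intro continuous_intros cont)
    fix s assume s: "0 < s" "s < T" "s < 1"
    from r[OF s(1,2)] s(3) obtain y p where y: "\<And>j. (local_mass a b j has_real_derivative y j) (at s)"
      "\<And>j. \<bar>y j + p\<bar> \<le> c0" by auto
    show "\<exists>y. (?f has_real_derivative y) (at s) \<and> y \<le> 2 * c0"
      using y(2)[of j] y(2)[of "\<not> j"] by (intro exI[of _ "y j - y (\<not> j)"] conjI DERIV_diff y(1)) linarith
  next
    fix s assume s: "1 \<le> s" "s < T"
    from r[of s] s obtain y p where y: "\<And>j. (local_mass a b j has_real_derivative y j) (at s)"
      "\<And>j. \<bar>y j + p\<bar> \<le> c1 * s powr (- 9 / 8)" by auto
    show "\<exists>y. (?f has_real_derivative y) (at s) \<and> y \<le> 2 * c1 * s powr (- 9 / 8)"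
      using y(2)[of j] y(2)[of "\<not> j"] by (intro exI[of _ "y j - y (\<not> j)"] conjI DERIV_diff y(1)) linarith
  qed (use c in auto)
  then show "local_mass a b j T - local_mass a b (\<not> j) T
      \<le> local_mass a b j 0 - local_mass a b (\<not> j) 0 + 2 * ((b - a) * (error_const D * \<epsilon> ^ 4))"
    using e by simp
qed

text \<open>Pointwise bounds through the moments would carry the factor
  \<open>(1 + T) powr (1 / 32)\<close>. Instead, the local masses on all intervals are compared with
  their initial values, and continuity of \<open>spec\<close> turns the bound on averages into a
  pointwise bound without growth.\<close>

lemma spec_uniform: "cmod (spec j T \<xi>) \<le> \<epsilon> * (2 * weight_const * D + 1)"
proof -
  note mT = moment_facts[OF T order_refl]
  let ?h = "\<lambda>\<xi>. (cmod (spec j T \<xi>))\<^sup>2"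
  have [measurable]: "spec j T \<in> borel_measurable borel" by (rule spec_measurable[OF T mT])
  have "?h \<xi> \<le> (2 * weight_const * (\<epsilon> * D))\<^sup>2 + \<epsilon>\<^sup>2"
  proof (rule continuous_le_of_averages[where h="?h" and x=\<xi>])
    show "continuous_on UNIV ?h" by (intro continuous_intros spec_continuous[OF T mT])
    let ?S = "2 * weight_const * (\<epsilon> * D * (1 + T) powr (1 / 32))"
    fix a b :: real
    show "integrable lborel (\<lambda>\<xi>. indicator {a..b} \<xi> * ?h \<xi>)"
    proof (rule Bochner_Integration.integrable_bound[rotated])
      show "(\<lambda>\<xi>. indicator {a..b} \<xi> * ?h \<xi>) \<in> borel_measurable lborel" by measurable
      show "integrable lborel (\<lambda>\<xi>. indicator {a..b} \<xi> * ?S\<^sup>2)" by (rule integrable_indicator_Icc)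
      show "AE \<xi> in lborel. norm (indicator {a..b} \<xi> * ?h \<xi>) \<le> norm (indicator {a..b} \<xi> * ?S\<^sup>2)"
        using power_mono[OF spec_le[OF T mT] norm_ge_zero, of _ _ 2]
        by (intro AE_I2) (simp split: split_indicator)
    qed
    assume ab: "a \<le> b"
    have "(LINT \<xi>|lborel. indicator {a..b} \<xi> * ?h \<xi>) = local_mass a b j T"
      unfolding local_mass_eq
    proof (rule integral_cong_AE)
      note [measurable] = L2_measurable[OF prof_L2(1)[OF T, of j]]
      show "(\<lambda>\<xi>. indicator {a..b} \<xi> * ?h \<xi>) \<in> borel_measurable lborel" by measurable
      show "(\<lambda>\<xi>. indicator {a..b} \<xi> * (cmod (prof j T \<xi>))\<^sup>2) \<in> borel_measurable lborel" by measurable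
      show "AE \<xi> in lborel. indicator {a..b} \<xi> * ?h \<xi> = indicator {a..b} \<xi> * (cmod (prof j T \<xi>))\<^sup>2"
        using spec_eq_prof[OF T mT, of j] by eventually_elim simp
    qed
    also have "\<dots> \<le> local_mass a b j 0 + (b - a) * (error_const D * \<epsilon> ^ 4)"
      by (rule local_mass_increment[OF ab])
    also have "local_mass a b j 0 \<le> (b - a) * (2 * weight_const * (\<epsilon> * D))\<^sup>2"
    proof -
      have "local_mass a b j 0 \<le> (LINT \<xi>|lborel. indicator {a..b} \<xi> * (2 * weight_const * (\<epsilon> * D))\<^sup>2)"
        unfolding local_mass_eq
      proof (rule integral_mono_AE')
        show "integrable lborel (\<lambda>\<xi>. indicator {a..b} \<xi> * (2 * weight_const * (\<epsilon> * D))\<^sup>2)" by (rule integrable_indicator_Icc)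
        show "AE \<xi> in lborel. indicator {a..b} \<xi> * (cmod (prof j 0 \<xi>))\<^sup>2 \<le> indicator {a..b} \<xi> * (2 * weight_const * (\<epsilon> * D))\<^sup>2"
          using prof_le[OF order_refl T, of j]
        proof eventually_elim
          case (elim \<xi>)
          then have "(cmod (prof j 0 \<xi>))\<^sup>2 \<le> (2 * weight_const * (\<epsilon> * D))\<^sup>2" by (intro power_mono) simp_all
          then show ?case by (simp split: split_indicator)
        qed
      qed simp
      then show ?thesis by (simp only: integral_indicator_Icc[OF ab])
    qed
    also have "error_const D * \<epsilon> ^ 4 \<le> \<epsilon>\<^sup>2"
    proof -
      have "error_const D * \<epsilon> ^ 4 = (error_const D * \<epsilon>\<^sup>2) * \<epsilon>\<^sup>2" by (simp add: power2_eq_square power4_eq_xxxx)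
      also have "\<dots> \<le> 1 * \<epsilon>\<^sup>2" by (intro mult_right_mono small2) simp
      finally show ?thesis by simp
    qed
    finally show "(LINT \<xi>|lborel. indicator {a..b} \<xi> * ?h \<xi>) \<le> (b - a) * ((2 * weight_const * (\<epsilon> * D))\<^sup>2 + \<epsilon>\<^sup>2)"
      using ab by (simp add: distrib_left mult_left_mono)
  qed
  also have "\<dots> \<le> (\<epsilon> * (2 * weight_const * D + 1))\<^sup>2"
  proof -
    \<comment> \<open>This is the cross term of the square on the right.\<close>
    have "0 \<le> \<epsilon>\<^sup>2 * (4 * weight_const * D)" using weight_const_nonneg D by simp
    then show ?thesis by (simp add: power2_eq_square algebra_simps)
  qed
  finally show ?thesis by (rule power2_le_imp_le) (use eps weight_const_nonneg D in auto)
qed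

text \<open>Up to time \<open>1\<close> the L1 norm of the transform suffices. Afterwards the wave
  is \<open>rescaled\<close> over \<open>sqrt T\<close>; \<open>spec\<close> is bounded without
  growth, and in the difference the decay \<open>T powr (- 1 / 4)\<close> beats the growth of the
  moments.\<close>

lemma wave_improved: "cmod (wave j T x) \<le> wave_const D * \<epsilon> / sqrt (1 + T)"
proof (cases "T \<le> 1")
  case True
  have ed: "0 \<le> \<epsilon> * D" using eps D by simp
  let ?X = "\<epsilon> * D * (1 + T) powr (1 / 32)"
  have X: "?X \<le> \<epsilon> * D * 2" using powr_small[OF T True] ed by (intro mult_left_mono) auto
  have s: "2 \<le> sqrt (2 * pi)" using pi_gt3 by (intro real_le_rsqrt) simp
  have "cmod (wave j T x) \<le> (LINT \<xi>|lborel. cmod (U j T \<xi>)) / sqrt (2 * pi)"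
    unfolding wave_def by (rule cmod_fourier_le)
  also have "(LINT \<xi>|lborel. cmod (U j T \<xi>)) = (LINT \<xi>|lborel. cmod (prof j T \<xi>))" by (simp add: prof_def norm_mult)
  also have "\<dots> / sqrt (2 * pi) \<le> (LINT \<xi>|lborel. cmod (prof j T \<xi>)) / 2" using s by (intro divide_left_mono) auto
  also have "\<dots> \<le> weight_const * (L2_norm (prof j T) + L2_norm (\<lambda>\<xi>. of_real \<xi> * prof j T \<xi>)) / 2"
    by (intro divide_right_mono weighted_L2_imp_L1(2) prof_L2 T moment_growth(1)[OF T order_refl]) simp_all
  also have "\<dots> \<le> weight_const * (?X + ?X) / 2"
    by (intro divide_right_mono mult_left_mono add_mono moment_facts(3)[OF T order_refl] moment_growth(2)[OF T order_refl]
        weight_const_nonneg) simp_all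
  also have "\<dots> \<le> weight_const * (\<epsilon> * D * 2 + \<epsilon> * D * 2) / 2"
    by (intro divide_right_mono mult_left_mono add_mono X weight_const_nonneg) simp_all
  also have "\<dots> = 4 * weight_const * (\<epsilon> * D) / 2" by simp
  also have "\<dots> \<le> 4 * weight_const * (\<epsilon> * D) / sqrt (1 + T)"
    using T True ed weight_const_nonneg by (intro divide_left_mono real_le_lsqrt) auto
  also have "\<dots> \<le> wave_const D * \<epsilon> / sqrt (1 + T)"
  proof (rule divide_right_mono)
    have "0 \<le> \<epsilon> * (6 * weight_const * D + 2 + 4 * chirp_const * D)"
      using eps D weight_const_nonneg chirp_const_nonneg by simp
    then show "4 * weight_const * (\<epsilon> * D) \<le> wave_const D * \<epsilon>" by (simp add: wave_const_def algebra_simps)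
  qed (use T in simp)
  finally show ?thesis .
next
  case False
  then have T1: "1 \<le> T" "0 < T" by auto
  note mT = moment_facts[OF T order_refl]
  let ?X = "\<epsilon> * D * (1 + T) powr (1 / 32)"
  have "cmod (rescaled j T (x / T)) \<le> cmod (spec j T (x / T)) + cmod (rescaled j T (x / T) - spec j T (x / T))"
    by norm
  also have "\<dots> \<le> \<epsilon> * (2 * weight_const * D + 1) + chirp_const * T powr (- 1 / 4) * ?X"
    by (intro add_mono spec_uniform rescaled_minus_spec[OF T mT T1(2)])
  also have "chirp_const * T powr (- 1 / 4) * ?X \<le> chirp_const * (2 * \<epsilon> * D)"
  proof -
    have "T powr (- 1 / 4) * (1 + T) powr (1 / 32) \<le> T powr (- 1 / 4) * (2 * T powr (1 / 32))"
      using powr_large[OF T1(1), of 1] by (intro mult_left_mono) auto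
    also have "\<dots> = 2 * T powr (- 7 / 32)" by (simp add: powr_add[symmetric])
    also have "\<dots> \<le> 2 * T powr 0" using T1 by (intro mult_left_mono powr_mono) auto
    finally have "T powr (- 1 / 4) * (1 + T) powr (1 / 32) \<le> 2" using T1 by simp
    then have "(chirp_const * \<epsilon> * D) * (T powr (- 1 / 4) * (1 + T) powr (1 / 32)) \<le> (chirp_const * \<epsilon> * D) * 2"
      using chirp_const_nonneg eps D by (intro mult_left_mono) auto
    then show ?thesis by (simp add: mult_ac)
  qed
  finally have r: "cmod (rescaled j T (x / T)) \<le> \<epsilon> * (2 * weight_const * D + 1) + chirp_const * (2 * \<epsilon> * D)" by simp
  have "cmod (wave j T x) = cmod (rescaled j T (x / T)) / sqrt T"
    by (rule cmod_wave_rescaled[OF T mT T1(2)])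
  also have "\<dots> \<le> (\<epsilon> * (2 * weight_const * D + 1) + chirp_const * (2 * \<epsilon> * D)) / sqrt T"
    using T by (intro divide_right_mono r) simp
  also have "\<dots> \<le> (\<epsilon> * (2 * weight_const * D + 1) + chirp_const * (2 * \<epsilon> * D)) / (sqrt (1 + T) / 2)"
  proof (rule divide_left_mono)
    have "sqrt (1 + T) \<le> sqrt (4 * T)" using T1 by (intro real_sqrt_le_mono) simp
    then show "sqrt (1 + T) / 2 \<le> sqrt T" by (simp add: real_sqrt_mult)
  qed (use T1 eps D weight_const_nonneg chirp_const_nonneg in auto)
  also have "\<dots> = 2 * (\<epsilon> * (2 * weight_const * D + 1) + chirp_const * (2 * \<epsilon> * D)) / sqrt (1 + T)" by simp
  also have "\<dots> \<le> wave_const D * \<epsilon> / sqrt (1 + T)"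
  proof (rule divide_right_mono)
    have "0 \<le> \<epsilon> * (6 * weight_const * D)" using eps D weight_const_nonneg by simp
    then show "2 * (\<epsilon> * (2 * weight_const * D + 1) + chirp_const * (2 * \<epsilon> * D)) \<le> wave_const D * \<epsilon>"
      by (simp add: wave_const_def algebra_simps)
  qed (use T in simp)
  finally show ?thesis .
qed

end

text \<open>Continuity argument at the infimum \<open>s0\<close> of the times at which the bound
  fails. The hypothesis of \<open>wave_improved\<close> concerns earlier positive times only, so the
  bound holds at \<open>s0\<close> as well, vacuously supported if \<open>s0 = 0\<close>. By
  continuity the doubled bound persists for a while after \<open>s0\<close>, where
  \<open>wave_improved\<close> restores the bound, a contradiction.\<close>

lemma wave_decay:
  assumes T: "0 \<le> T" shows "cmod (wave j T x) \<le> wave_const D * \<epsilon> / sqrt (1 + T)"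
proof (rule ccontr)
  define b where "b s = wave_const D * \<epsilon> / sqrt (1 + s)" for s
  define bad where "bad = {s. 0 \<le> s \<and> (\<exists>j x. b s < cmod (wave j s x))}"
  have w: "0 < wave_const D * \<epsilon>"
    using wave_const_ge eps by simp
  have bpos: "0 < b s" if "0 \<le> s" for s using w that by (simp add: b_def)
  have b2: "2 * wave_const D * \<epsilon> / sqrt (1 + s) = 2 * b s" for s by (simp add: b_def)
  have improve: "cmod (wave j s x) \<le> b s"
    if "0 \<le> s" "\<And>r j x. 0 < r \<Longrightarrow> r < s \<Longrightarrow> cmod (wave j r x) \<le> 2 * b r" for s j x
    unfolding b_def by (rule wave_improved[OF that(1)]) (unfold b2, rule that(2))
  assume "\<not> cmod (wave j T x) \<le> wave_const D * \<epsilon> / sqrt (1 + T)"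
  then have "T \<in> bad" using T unfolding bad_def b_def not_le by blast
  then have ne: "bad \<noteq> {}" by blast
  have bb: "bdd_below bad" by (rule bdd_belowI[of _ 0]) (auto simp: bad_def)
  define s0 where "s0 = Inf bad"
  have s0: "0 \<le> s0" unfolding s0_def by (rule cInf_greatest[OF ne]) (auto simp: bad_def)
  have before: "cmod (wave j s x) \<le> b s" if "0 \<le> s" "s < s0" for s j x
  proof (rule ccontr)
    assume "\<not> cmod (wave j s x) \<le> b s"
    then have "s \<in> bad" using that(1) unfolding bad_def not_le by blast
    then show False using cInf_lower[OF _ bb, of s] that(2) by (simp add: s0_def)
  qed
  have at0: "cmod (wave j s0 x) \<le> b s0" for j x
  proof (rule improve[OF s0])
    fix r j x assume "0 < r" "r < s0"
    then show "cmod (wave j r x) \<le> 2 * b r" using before[of r j x] bpos[of r] by simp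
  qed
  \<comment> \<open>With this tolerance the waves near \<open>s0\<close> stay below
    \<open>3 / 2 * b s0\<close>, which continuity of \<open>b\<close> keeps below
    \<open>2 * b s\<close>.\<close>
  have e: "0 < b s0 / 2" using bpos[OF s0] by simp
  have "continuous_on {0..} b"
    unfolding b_def by (intro continuous_intros) auto
  then have "((\<lambda>s. 2 * b s) \<longlongrightarrow> 2 * b s0) (at s0 within {0..})"
    using s0 by (intro tendsto_intros) (simp add: continuous_on)
  then have "\<forall>\<^sub>F s in at s0 within {0..}. 3 / 2 * b s0 < 2 * b s"
    by (rule order_tendstoD) (use bpos[OF s0] in simp)
  then have "\<forall>\<^sub>F s in at s0 within {0..}. (\<forall>x. cmod (wave True s x) \<le> 2 * b s) \<and> (\<forall>x. cmod (wave False s x) \<le> 2 * b s)"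
    using wave_continuous[OF s0 e, of True] wave_continuous[OF s0 e, of False]
  proof eventually_elim
    case (elim s)
    have "cmod (wave j s x) \<le> 2 * b s" if "cmod (wave j s x - wave j s0 x) < b s0 / 2" for j x
    proof -
      have "cmod (wave j s x) \<le> cmod (wave j s0 x) + cmod (wave j s x - wave j s0 x)" by norm
      then show ?thesis using at0[of j x] that elim(1) by linarith
    qed
    then show ?case using elim(2,3) by blast
  qed
  then obtain d where d: "0 < d" "\<And>s j x. 0 \<le> s \<Longrightarrow> s \<noteq> s0 \<Longrightarrow> dist s s0 < d \<Longrightarrow> cmod (wave j s x) \<le> 2 * b s"
    unfolding eventually_at by (metis (full_types) atLeast_iff)
  have "s0 + d \<le> s" if sb: "s \<in> bad" for s
  proof (rule ccontr)
    assume "\<not> s0 + d \<le> s"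
    then have s: "0 \<le> s" "s < s0 + d" using that by (auto simp: bad_def)
    have le: "cmod (wave j s x) \<le> b s" for j x
    proof (rule improve[OF s(1)])
      fix r j x assume r: "0 < r" "r < s"
      consider "r < s0" | "r = s0" | "s0 < r" by linarith
      then show "cmod (wave j r x) \<le> 2 * b r"
      proof cases
        case 1
        then show ?thesis using before[of r j x] bpos[of r] r by simp
      next
        case 2
        then show ?thesis using at0[of j x] bpos[OF s0] by simp
      next
        case 3
        then show ?thesis using d(2)[of r j x] r s by (simp add: dist_real_def)
      qed
    qed
    obtain j x where "b s < cmod (wave j s x)" using sb unfolding bad_def by blast
    then show False using le[of j x] by linarith
  qed
  then have "s0 + d \<le> s0" unfolding s0_def by (intro cInf_greatest[OF ne])
  then show False using d by simp
qed

theorem local_mass_difference: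
  assumes T: "0 \<le> T" and ab: "a \<le> b"
  shows "local_mass a b j T - local_mass a b (\<not> j) T
      \<le> local_mass a b j 0 - local_mass a b (\<not> j) 0 + 2 * ((b - a) * (error_const D * \<epsilon> ^ 4))"
proof (rule local_mass_increment(2)[OF T _ ab])
  fix s j x assume "0 < s" "s < T"
  then have "cmod (wave j s x) \<le> wave_const D * \<epsilon> / sqrt (1 + s)" by (intro wave_decay) simp
  also have "\<dots> \<le> 2 * wave_const D * \<epsilon> / sqrt (1 + s)"
    using wave_const_ge eps \<open>0 < s\<close> by (intro divide_right_mono) auto
  finally show "cmod (wave j s x) \<le> 2 * wave_const D * \<epsilon> / sqrt (1 + s)" .
qed

end

end

section \<open>Sobolev spaces and multipliers on the Fourier side\<close>

text \<open>\<open>multiplier\<close> is defined by choice, but uniqueness of the transform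
  determines the result up to null sets; \<open>g\<close> witnesses that there is something to
  choose.\<close>

lemma multiplier_transform:
  assumes F: "is_fourier_L2 f F" and G: "is_fourier_L2 g (\<lambda>\<xi>. m \<xi> * F \<xi>)"
  shows "is_fourier_L2 (multiplier m f) (\<lambda>\<xi>. m \<xi> * F \<xi>)"
proof -
  have "is_multiplier m f g" unfolding is_multiplier_def using F G by (intro exI conjI AE_I2) auto
  then have "is_multiplier m f (multiplier m f)" unfolding multiplier_def by (rule someI[where P="is_multiplier m f"])
  then obtain F' G' where F': "is_fourier_L2 f F'" and G': "is_fourier_L2 (multiplier m f) G'"
    and eq: "AE \<xi> in lborel. G' \<xi> = m \<xi> * F' \<xi>" unfolding is_multiplier_def by blast
  show ?thesis
  proof (rule is_fourier_L2_cong[OF G'])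
    show "multiplier m f \<in> borel_measurable borel" "(\<lambda>\<xi>. m \<xi> * F \<xi>) \<in> borel_measurable borel"
      using is_fourier_L2_D(1)[OF G'] is_fourier_L2_D(2)[OF G] by (auto intro: L2_measurable)
    show "AE \<xi> in lborel. G' \<xi> = m \<xi> * F \<xi>"
      using eq is_fourier_L2_unique[OF F' F AE_I2[OF refl]] by eventually_elim simp
  qed simp
qed

text \<open>Asking for a preimage \<open>g\<close> of the weighted transform supplies the witness
  for applying multipliers such as \<open>dxx\<close> and the Bessel potential.\<close>

definition H2_transform :: "(real \<Rightarrow> complex) \<Rightarrow> (real \<Rightarrow> complex) \<Rightarrow> bool" where
  "H2_transform f F \<longleftrightarrow> is_fourier_L2 f F \<and> (\<exists>g. is_fourier_L2 g (\<lambda>\<xi>. of_real (1 + \<xi>\<^sup>2) * F \<xi>))"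

lemma H2_transform_D:
  assumes "H2_transform f F"
  shows "is_fourier_L2 f F" "F \<in> borel_measurable borel" "(\<lambda>\<xi>. of_real (1 + \<xi>\<^sup>2) * F \<xi>) \<in> L2" "integrable lborel F"
proof -
  show F: "is_fourier_L2 f F" using assms by (simp add: H2_transform_def)
  show m: "F \<in> borel_measurable borel" by (rule L2_measurable[OF is_fourier_L2_D(2)[OF F]])
  show w: "(\<lambda>\<xi>. of_real (1 + \<xi>\<^sup>2) * F \<xi>) \<in> L2"
    using assms is_fourier_L2_D(2) unfolding H2_transform_def by blast
  show "integrable lborel F" by (rule weighted_L2(3)[OF m w])
qed

lemma H2_transform_cong:
  assumes F: "H2_transform f F" and G: "is_fourier_L2 f' G" and eq: "AE x in lborel. f x = f' x"
  shows "H2_transform f' G"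
proof -
  obtain g where g: "is_fourier_L2 g (\<lambda>\<xi>. of_real (1 + \<xi>\<^sup>2) * F \<xi>)" using F by (auto simp: H2_transform_def)
  have [measurable]: "g \<in> borel_measurable borel" "G \<in> borel_measurable borel"
    using is_fourier_L2_D[OF g] is_fourier_L2_D[OF G] by (auto intro: L2_measurable)
  have "is_fourier_L2 g (\<lambda>\<xi>. of_real (1 + \<xi>\<^sup>2) * G \<xi>)"
  proof (rule is_fourier_L2_cong[OF g])
    show "AE \<xi> in lborel. of_real (1 + \<xi>\<^sup>2) * F \<xi> = of_real (1 + \<xi>\<^sup>2) * G \<xi>"
      using is_fourier_L2_unique[OF H2_transform_D(1)[OF F] G eq] by eventually_elim simp
  qed simp_all
  then show ?thesis using G by (auto simp: H2_transform_def)
qed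

lemma H2_transform_lin:
  assumes F: "H2_transform f F" and G: "H2_transform g G"
  shows "H2_transform (\<lambda>x. f x - g x) (\<lambda>\<xi>. F \<xi> - G \<xi>)" "H2_transform (\<lambda>x. c * f x) (\<lambda>\<xi>. c * F \<xi>)"
proof -
  obtain f' g' where f': "is_fourier_L2 f' (\<lambda>\<xi>. of_real (1 + \<xi>\<^sup>2) * F \<xi>)"
    and g': "is_fourier_L2 g' (\<lambda>\<xi>. of_real (1 + \<xi>\<^sup>2) * G \<xi>)" using F G by (auto simp: H2_transform_def)
  show "H2_transform (\<lambda>x. f x - g x) (\<lambda>\<xi>. F \<xi> - G \<xi>)"
    using is_fourier_L2_diff[OF H2_transform_D(1)[OF F] H2_transform_D(1)[OF G]] is_fourier_L2_diff[OF f' g']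
    unfolding H2_transform_def right_diff_distrib by blast
  show "H2_transform (\<lambda>x. c * f x) (\<lambda>\<xi>. c * F \<xi>)"
    using is_fourier_L2_cmult[OF H2_transform_D(1)[OF F], of c] is_fourier_L2_cmult[OF f', of c]
    unfolding H2_transform_def mult.left_commute[of _ c] by blast
qed

lemma bessel_symbol_2: "bessel_symbol 2 \<xi> = of_real (1 + \<xi>\<^sup>2)"
  by (simp add: bessel_symbol_def add_nonneg_nonneg)

lemma sobolev_2_0_transform:
  assumes "f \<in> sobolev 2 0" obtains F where "H2_transform f F"
proof -
  obtain g F G where F: "is_fourier_L2 f F" and G: "is_fourier_L2 g G"
    and eq: "AE \<xi> in lborel. G \<xi> = of_real (1 + \<xi>\<^sup>2) * F \<xi>"
    using assms unfolding sobolev_def is_multiplier_def bessel_symbol_2 by blast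
  have [measurable]: "g \<in> borel_measurable borel" "F \<in> borel_measurable borel"
    using is_fourier_L2_D[OF G] is_fourier_L2_D[OF F] by (auto intro: L2_measurable)
  have "is_fourier_L2 g (\<lambda>\<xi>. of_real (1 + \<xi>\<^sup>2) * F \<xi>)"
    by (rule is_fourier_L2_cong[OF G _ _ _ eq]) simp_all
  then show ?thesis using F that by (auto simp: H2_transform_def)
qed

lemma sobolev_norm_2_0:
  assumes F: "H2_transform f F" shows "sobolev_norm 2 0 f = L2_norm (\<lambda>\<xi>. of_real (1 + \<xi>\<^sup>2) * F \<xi>)"
proof -
  obtain g where "is_fourier_L2 g (\<lambda>\<xi>. bessel_symbol 2 \<xi> * F \<xi>)"
    using F by (auto simp: H2_transform_def bessel_symbol_2)
  then have "is_fourier_L2 (multiplier (bessel_symbol 2) f) (\<lambda>\<xi>. bessel_symbol 2 \<xi> * F \<xi>)"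
    by (rule multiplier_transform[OF H2_transform_D(1)[OF F]])
  moreover have "1 + x\<^sup>2 \<noteq> 0" for x :: real by (metis add_pos_nonneg less_irrefl zero_le_power2 zero_less_one)
  then have "weight 0 h = h" for h by (simp add: weight_def[abs_def])
  ultimately show ?thesis using plancherel_L2 by (simp add: sobolev_norm_def bessel_symbol_2)
qed

text \<open>With \<open>g\<close> the preimage for the weight \<open>1 + \<xi>\<^sup>2\<close>, the
  function \<open>f - g\<close> is the second derivative, since
  \<open>1 - (1 + \<xi>\<^sup>2) = - \<xi>\<^sup>2\<close>.\<close>

lemma dxx_transform:
  assumes F: "H2_transform f F" shows "is_fourier_L2 (dxx f) (\<lambda>\<xi>. - of_real (\<xi>\<^sup>2) * F \<xi>)"
proof -
  obtain g where g: "is_fourier_L2 g (\<lambda>\<xi>. of_real (1 + \<xi>\<^sup>2) * F \<xi>)" using F by (auto simp: H2_transform_def)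
  have "is_fourier_L2 (\<lambda>x. f x - g x) (\<lambda>\<xi>. - of_real (\<xi>\<^sup>2) * F \<xi>)"
    using is_fourier_L2_diff[OF H2_transform_D(1)[OF F] g] by (simp add: algebra_simps)
  then show ?thesis unfolding dxx_def by (rule multiplier_transform[OF H2_transform_D(1)[OF F]])
qed

text \<open>The symbol is unimodular, and integrability of \<open>F\<close> provides a preimage of
  the multiplied transform by inversion.\<close>

lemma L2_norm_schroedinger:
  assumes F: "H2_transform f F" shows "L2_norm (schroedinger t f) = L2_norm F"
proof -
  note D = H2_transform_D[OF F]
  have FL: "F \<in> L2" by (rule is_fourier_L2_D(2)[OF D(1)])
  have m: "exp (- \<i> * of_real (t / 2) * of_real (\<xi>\<^sup>2)) = chirp (- t) \<xi>" for \<xi>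
    by (simp add: chirp_def mult_ac)
  note [measurable] = D(2)
  have c: "(\<lambda>\<xi>. chirp (- t) \<xi> * F \<xi>) \<in> L2"
    by (rule L2_dominated(1)[OF FL, of _ 1]) (auto simp: norm_mult)
  have "is_fourier_L2 (schroedinger t f) (\<lambda>\<xi>. chirp (- t) \<xi> * F \<xi>)"
    unfolding schroedinger_def m
    by (rule multiplier_transform[OF D(1) is_fourier_L2_inverse[OF c integrable_mult_bounded[where C=1, OF D(4)]]]) auto
  from plancherel_L2[OF this] show ?thesis by (simp add: L2_norm_def norm_mult)
qed

text \<open>For \<open>f \<in> H\<^bsup>1,1\<^esup>\<close> the transform is \<open>G / sqrt (1 + \<xi>\<^sup>2)\<close> with \<open>G\<close> shift-Lipschitz in \<open>L\<^sup>2\<close>.\<close>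

lemma sobolev_1_1_shift:
  assumes f: "f \<in> sobolev 1 1"
  obtains K F where "is_fourier_L2 f F" "\<And>h. L2_norm (\<lambda>\<xi>. F (\<xi> + h) - F \<xi>) \<le> K * \<bar>h\<bar>"
proof -
  obtain g F G where F: "is_fourier_L2 f F" and G: "is_fourier_L2 g G"
    and eq: "AE \<xi> in lborel. G \<xi> = bessel_symbol 1 \<xi> * F \<xi>" and wg: "weight 1 g \<in> L2"
    using f unfolding sobolev_def is_multiplier_def by blast
  define r where "r \<xi> = sqrt (1 + \<xi>\<^sup>2)" for \<xi> :: real
  have r1: "1 \<le> r \<xi>" for \<xi> by (simp add: r_def)
  \<comment> \<open>\<open>r \<xi>\<close> is the modulus of \<open>1 + \<i> \<xi>\<close>, so the
    reverse triangle inequality gives Lipschitz constant \<open>1\<close>.\<close>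
  have rd: "\<bar>r \<xi> - r \<eta>\<bar> \<le> \<bar>\<xi> - \<eta>\<bar>" for \<xi> \<eta>
    using norm_triangle_ineq3[of "Complex 1 \<xi>" "Complex 1 \<eta>"] by (simp add: r_def cmod_def)
  have pr: "(1 + \<xi>\<^sup>2) powr (1 / 2) = r \<xi>" for \<xi> by (simp add: r_def powr_half_sqrt)
  note gG = is_fourier_L2_D(1,2)[OF G]
  note [measurable] = gG[THEN L2_measurable] is_fourier_L2_D(1)[OF F, THEN L2_measurable]
  have [measurable]: "r \<in> borel_measurable borel" unfolding r_def by measurable
  let ?F = "\<lambda>\<xi>. of_real (1 / r \<xi>) * G \<xi>"
  have Fm: "?F \<in> borel_measurable borel" by measurable
  have FF: "is_fourier_L2 f ?F"
  proof (rule is_fourier_L2_cong[OF F _ Fm])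
    show "AE \<xi> in lborel. F \<xi> = ?F \<xi>"
      using eq
    proof eventually_elim
      case (elim \<xi>)
      have "r \<xi> \<noteq> 0" using r1[of \<xi>] by linarith
      then show ?case using elim by (simp add: bessel_symbol_def pr)
    qed
  qed simp_all
  have xg: "(\<lambda>x. of_real x * g x) \<in> L2"
  proof (rule L2_dominated(1)[OF wg, of _ 1])
    have "\<bar>x\<bar> \<le> r x" for x unfolding r_def by (rule real_le_rsqrt) simp
    then show "AE x in lborel. cmod (of_real x * g x) \<le> 1 * cmod (weight 1 g x)"
      using r1 by (intro AE_I2) (simp add: weight_def pr norm_mult mult_right_mono order_trans[OF _ abs_ge_self])
  qed simp_all
  let ?K = "L2_norm (\<lambda>x. of_real x * g x) + L2_norm G"
  have "L2_norm (\<lambda>\<xi>. ?F (\<xi> + h) - ?F \<xi>) \<le> ?K * \<bar>h\<bar>" for h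
  proof -
    let ?a = "\<lambda>\<xi>. of_real (1 / r (\<xi> + h)) * (G (\<xi> + h) - G \<xi>)"
    let ?b = "\<lambda>\<xi>. of_real (1 / r (\<xi> + h) - 1 / r \<xi>) * G \<xi>"
    have dG: "(\<lambda>\<xi>. G (\<xi> + h) - G \<xi>) \<in> L2" by (intro L2_diff L2_translate gG)
    have am: "?a \<in> borel_measurable borel" and bm: "?b \<in> borel_measurable borel" by measurable
    have "AE \<xi> in lborel. cmod (?a \<xi>) \<le> 1 * cmod (G (\<xi> + h) - G \<xi>)"
    proof (rule AE_I2)
      fix \<xi>
      have "\<bar>1 / r (\<xi> + h)\<bar> \<le> 1" using r1[of "\<xi> + h"] by simp
      then show "cmod (?a \<xi>) \<le> 1 * cmod (G (\<xi> + h) - G \<xi>)"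
        unfolding norm_mult norm_of_real by (rule mult_right_mono) simp
    qed
    note a = L2_dominated[OF dG am this]
    have "AE \<xi> in lborel. cmod (?b \<xi>) \<le> \<bar>h\<bar> * cmod (G \<xi>)"
    proof (rule AE_I2)
      fix \<xi>
      have rr: "1 \<le> r (\<xi> + h) * r \<xi>" using mult_mono[OF r1 r1, of "\<xi> + h" \<xi>] r1[of "\<xi> + h"] by simp
      have "1 / r (\<xi> + h) - 1 / r \<xi> = (r \<xi> - r (\<xi> + h)) / (r (\<xi> + h) * r \<xi>)"
        using r1[of \<xi>] r1[of "\<xi> + h"] by (intro diff_frac_eq[THEN trans]) (auto simp: field_simps)
      then have "\<bar>1 / r (\<xi> + h) - 1 / r \<xi>\<bar> = \<bar>r \<xi> - r (\<xi> + h)\<bar> / (r (\<xi> + h) * r \<xi>)"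
        using rr by (simp add: abs_divide)
      also have "\<dots> \<le> \<bar>r \<xi> - r (\<xi> + h)\<bar> / 1" using rr by (intro divide_left_mono) auto
      also have "\<dots> \<le> \<bar>h\<bar>" using rd[of \<xi> "\<xi> + h"] by simp
      finally show "cmod (?b \<xi>) \<le> \<bar>h\<bar> * cmod (G \<xi>)"
        unfolding norm_mult norm_of_real by (rule mult_right_mono) simp
    qed
    note b = L2_dominated[OF gG(2) bm this]
    \<comment> \<open>The discrete product rule separates the shift of \<open>G\<close> from the
      shift of the weight \<open>1 / r\<close>.\<close>
    have "p * x - q * y = p * (x - y) + (p - q) * y" for p q x y :: complex by (simp add: algebra_simps)
    then have "?F (\<xi> + h) - ?F \<xi> = ?a \<xi> + ?b \<xi>" for \<xi> unfolding of_real_diff .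
    then have "L2_norm (\<lambda>\<xi>. ?F (\<xi> + h) - ?F \<xi>) = L2_norm (\<lambda>\<xi>. ?a \<xi> + ?b \<xi>)" by (simp only:)
    also have "\<dots> \<le> L2_norm ?a + L2_norm ?b" by (rule L2_norm_triangle) (use a b in auto)
    also have "\<dots> \<le> L2_norm (\<lambda>\<xi>. G (\<xi> + h) - G \<xi>) + \<bar>h\<bar> * L2_norm G"
      using a(2) b(2) by simp
    also have "L2_norm (\<lambda>\<xi>. G (\<xi> + h) - G \<xi>) \<le> \<bar>- h\<bar> * L2_norm (\<lambda>x. of_real x * g x)"
      unfolding is_fourier_L2_shift_diff[OF G] by (rule moment_imp_modulation_bound(2)[OF _ xg]) measurable
    finally show ?thesis by (simp add: algebra_simps)
  qed
  with FF show ?thesis by (rule that)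
qed

text \<open>The moment in space makes \<open>f\<close> integrable, so its Fourier integral is a
  pointwise meaningful transform. The Weyl bound is the regularity that the evolution
  propagates.\<close>

lemma sobolev_data:
  assumes f: "f \<in> sobolev 2 0 \<inter> sobolev 1 1"
  obtains K where "integrable lborel f" "H2_transform f (fourier f)"
    "\<And>a b. L2_norm (weyl_diff a b (fourier f)) \<le> K * (\<bar>a\<bar> + \<bar>b\<bar>)" "0 \<le> K"
proof -
  obtain F where F: "H2_transform f F" using f by (auto intro: sobolev_2_0_transform)
  obtain K F' where F': "is_fourier_L2 f F'" and K: "\<And>h. L2_norm (\<lambda>\<xi>. F' (\<xi> + h) - F' \<xi>) \<le> K * \<bar>h\<bar>"
    using f by (auto intro: sobolev_1_1_shift)
  have fL: "f \<in> L2" by (rule is_fourier_L2_D(1)[OF F'])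
  have int: "integrable lborel f"
    by (rule weighted_L2_imp_L1(1)[OF fL shift_bound_imp_moment(1)[OF F' K]])
  have H: "H2_transform f (fourier f)"
    by (rule H2_transform_cong[OF F is_fourier_L2_L1[OF fL int]]) simp
  note D = H2_transform_D[OF H]
  let ?F = "fourier f"
  have FL: "?F \<in> L2" and xF: "(\<lambda>\<xi>. of_real \<xi> * ?F \<xi>) \<in> L2" using weighted_L2[OF D(2,3)] by auto
  have K': "L2_norm (\<lambda>\<xi>. ?F (\<xi> + h) - ?F \<xi>) \<le> K * \<bar>h\<bar>" for h
    using K[of h] unfolding is_fourier_L2_shift_diff[OF F'] is_fourier_L2_shift_diff[OF D(1)] .
  have K0: "0 \<le> K" using order_trans[OF L2_norm_nonneg K[of 1]] by simp
  let ?L = "L2_norm (\<lambda>\<xi>. of_real \<xi> * ?F \<xi>)"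
  have "L2_norm (weyl_diff a b ?F) \<le> (K + ?L) * (\<bar>a\<bar> + \<bar>b\<bar>)" for a b
  proof -
    \<comment> \<open>A Weyl difference splits into a phase times a shift difference and a pure
      modulation difference.\<close>
    let ?p = "\<lambda>\<xi>. exp (\<i> * of_real (a * \<xi>)) * (?F (\<xi> + b) - ?F \<xi>)"
    let ?q = "\<lambda>\<xi>. (exp (\<i> * of_real (a * \<xi>)) - 1) * ?F \<xi>"
    note [measurable] = D(2)
    have dF: "(\<lambda>\<xi>. ?F (\<xi> + b) - ?F \<xi>) \<in> L2" by (intro L2_diff L2_translate FL)
    have pm: "?p \<in> borel_measurable borel" by measurable
    have "AE \<xi> in lborel. cmod (?p \<xi>) \<le> 1 * cmod (?F (\<xi> + b) - ?F \<xi>)" by (simp add: norm_mult)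
    note p = L2_dominated[OF dF pm this]
    note q = moment_imp_modulation_bound[OF D(2) xF, of a]
    have "L2_norm (weyl_diff a b ?F) = L2_norm (\<lambda>\<xi>. ?p \<xi> + ?q \<xi>)"
      by (simp add: weyl_diff_def[abs_def] algebra_simps)
    also have "\<dots> \<le> L2_norm ?p + L2_norm ?q" by (rule L2_norm_triangle) (use p q in auto)
    also have "\<dots> \<le> K * \<bar>b\<bar> + \<bar>a\<bar> * ?L" using p(2) K'[of b] q(2) by simp
    also have "\<dots> \<le> (K + ?L) * (\<bar>a\<bar> + \<bar>b\<bar>)" using K0 by (simp add: algebra_simps)
    finally show ?thesis .
  qed
  moreover have "0 \<le> K + ?L" using K0 by simp
  ultimately show ?thesis using that[of "K + ?L"] int H by blast
qed

section \<open>From solutions to profiles\<close>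

text \<open>The bound \<open>\<xi>\<^sup>2 / 2\<close> is dominated by the H2 weight, which permits
  differentiating the chirp in \<open>t\<close> under the L2 norm.\<close>

lemma chirp_shift_quotient:
  "((\<lambda>h. (chirp (t + h) \<xi> - chirp t \<xi>) / of_real h) \<longlongrightarrow> \<i> * of_real (\<xi>\<^sup>2 / 2) * chirp t \<xi>) (at 0)"
  "cmod ((chirp (t + h) \<xi> - chirp t \<xi>) / of_real h) \<le> \<xi>\<^sup>2 / 2"
proof -
  have eq: "chirp (t + h) \<xi> - chirp t \<xi> = (exp (\<i> * of_real (h * (\<xi>\<^sup>2 / 2))) - 1) * chirp t \<xi>" for h
    unfolding chirp_def left_diff_distrib mult_exp_exp
    by (intro arg_cong2[of _ _ _ _ "(-)"] arg_cong[of _ _ exp]) (simp_all add: algebra_simps add_divide_distrib)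
  have "((\<lambda>h. (exp (\<i> * of_real (h * (\<xi>\<^sup>2 / 2))) - 1) / of_real h * chirp t \<xi>) \<longlongrightarrow> \<i> * of_real (\<xi>\<^sup>2 / 2) * chirp t \<xi>) (at 0)"
    by (intro tendsto_mult tendsto_const modulation_quotient_tendsto)
  then show "((\<lambda>h. (chirp (t + h) \<xi> - chirp t \<xi>) / of_real h) \<longlongrightarrow> \<i> * of_real (\<xi>\<^sup>2 / 2) * chirp t \<xi>) (at 0)"
    unfolding eq by simp
  have "cmod (exp (\<i> * of_real (h * (\<xi>\<^sup>2 / 2))) - 1) \<le> \<bar>h\<bar> * (\<xi>\<^sup>2 / 2)"
    using cmod_exp_minus_one_le[of "h * (\<xi>\<^sup>2 / 2)"] by (simp add: abs_mult)
  then show "cmod ((chirp (t + h) \<xi> - chirp t \<xi>) / of_real h) \<le> \<xi>\<^sup>2 / 2"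
    unfolding eq norm_divide norm_mult by (cases "h = 0") (simp_all add: divide_le_eq mult.commute)
qed

text \<open>The product rule in L2. The error consists of the error for \<open>V\<close>, the change
  of the chirp acting on \<open>X\<close>, and the error of the chirp quotient acting on
  \<open>V t\<close>; the last two vanish by dominated convergence.\<close>

lemma profile_derivative:
  assumes t: "0 < t" and V: "\<And>s. 0 \<le> s \<Longrightarrow> V s \<in> L2" and W: "(\<lambda>\<xi>. of_real (1 + \<xi>\<^sup>2) * V t \<xi>) \<in> L2"
    and X: "X \<in> L2" and lim: "((\<lambda>h. L2_norm (\<lambda>\<xi>. (V (t + h) \<xi> - V t \<xi>) / of_real h - X \<xi>)) \<longlongrightarrow> 0) (at 0)"
  shows "((\<lambda>h. L2_norm (\<lambda>\<xi>. (chirp (t + h) \<xi> * V (t + h) \<xi> - chirp t \<xi> * V t \<xi>) / of_real h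
      - chirp t \<xi> * (X \<xi> + \<i> * of_real (\<xi>\<^sup>2 / 2) * V t \<xi>))) \<longlongrightarrow> 0) (at 0)"
proof -
  have t0: "0 \<le> t" using t by simp
  note [measurable] = X[THEN L2_measurable] V[OF t0, THEN L2_measurable]
  let ?a = "\<lambda>h \<xi>. chirp (t + h) \<xi> * ((V (t + h) \<xi> - V t \<xi>) / of_real h - X \<xi>)"
  let ?b = "\<lambda>h \<xi>. (chirp (t + h) \<xi> - chirp t \<xi>) * X \<xi>"
  let ?c = "\<lambda>h \<xi>. ((chirp (t + h) \<xi> - chirp t \<xi>) / of_real h - \<i> * of_real (\<xi>\<^sup>2 / 2) * chirp t \<xi>) * V t \<xi>"
  have bm: "?b h \<in> borel_measurable borel" and cm: "?c h \<in> borel_measurable borel" for h by measurable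
  have ble: "AE \<xi> in lborel. cmod (?b h \<xi>) \<le> cmod (2 * X \<xi>)" for h
  proof (rule AE_I2)
    fix \<xi>
    have "cmod (chirp (t + h) \<xi> - chirp t \<xi>) \<le> 2"
      using norm_triangle_ineq4[of "chirp (t + h) \<xi>" "chirp t \<xi>"] by simp
    then show "cmod (?b h \<xi>) \<le> cmod (2 * X \<xi>)" by (simp add: norm_mult mult_right_mono)
  qed
  have cle: "AE \<xi> in lborel. cmod (?c h \<xi>) \<le> cmod (of_real (1 + \<xi>\<^sup>2) * V t \<xi>)" for h
  proof (rule AE_I2)
    fix \<xi>
    have "cmod (\<i> * of_real (\<xi>\<^sup>2 / 2) * chirp t \<xi>) = \<xi>\<^sup>2 / 2"
      unfolding norm_mult norm_of_real cmod_chirp by simp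
    then have "cmod ((chirp (t + h) \<xi> - chirp t \<xi>) / of_real h - \<i> * of_real (\<xi>\<^sup>2 / 2) * chirp t \<xi>) \<le> \<xi>\<^sup>2 / 2 + \<xi>\<^sup>2 / 2"
      using norm_triangle_ineq4[of "(chirp (t + h) \<xi> - chirp t \<xi>) / of_real h" "\<i> * of_real (\<xi>\<^sup>2 / 2) * chirp t \<xi>"]
        chirp_shift_quotient(2)[of t h \<xi>] by linarith
    also have "\<dots> \<le> \<bar>1 + \<xi>\<^sup>2\<bar>" by (simp add: abs_of_nonneg add_nonneg_nonneg)
    finally show "cmod (?c h \<xi>) \<le> cmod (of_real (1 + \<xi>\<^sup>2) * V t \<xi>)"
      unfolding norm_mult[of _ "V t \<xi>"] norm_of_real by (rule mult_right_mono) simp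
  qed
  have blim: "((\<lambda>h. L2_norm (?b h)) \<longlongrightarrow> 0) (at 0)"
  proof (rule L2_norm_dominated_convergence_at[OF bm L2_cmult[OF X, of 2] ble])
    have "((\<lambda>h. ?b h \<xi>) \<longlongrightarrow> (chirp (t + 0) \<xi> - chirp t \<xi>) * X \<xi>) (at 0)" for \<xi>
      unfolding chirp_def by (intro tendsto_intros) auto
    then show "AE \<xi> in lborel. ((\<lambda>h. ?b h \<xi>) \<longlongrightarrow> 0) (at 0)" by simp
  qed
  have clim: "((\<lambda>h. L2_norm (?c h)) \<longlongrightarrow> 0) (at 0)"
  proof (rule L2_norm_dominated_convergence_at[OF cm W cle])
    have "((\<lambda>h. ?c h \<xi>) \<longlongrightarrow> (\<i> * of_real (\<xi>\<^sup>2 / 2) * chirp t \<xi> - \<i> * of_real (\<xi>\<^sup>2 / 2) * chirp t \<xi>) * V t \<xi>) (at 0)" for \<xi>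
      by (intro tendsto_mult tendsto_diff tendsto_const chirp_shift_quotient)
    then show "AE \<xi> in lborel. ((\<lambda>h. ?c h \<xi>) \<longlongrightarrow> 0) (at 0)" by simp
  qed
  let ?d = "\<lambda>h. L2_norm (\<lambda>\<xi>. (V (t + h) \<xi> - V t \<xi>) / of_real h - X \<xi>)"
  show ?thesis
  proof (rule Lim_null_comparison)
    show "((\<lambda>h. ?d h + L2_norm (?b h) + L2_norm (?c h)) \<longlongrightarrow> 0) (at 0)"
      using tendsto_add[OF tendsto_add[OF lim blim] clim] by simp
    have "\<forall>\<^sub>F h in at 0. - t < (h :: real)"
      using t by (intro order_tendstoD(1)[OF tendsto_ident_at]) auto
    then show "\<forall>\<^sub>F h in at 0. norm (L2_norm (\<lambda>\<xi>. (chirp (t + h) \<xi> * V (t + h) \<xi> - chirp t \<xi> * V t \<xi>) / of_real h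
        - chirp t \<xi> * (X \<xi> + \<i> * of_real (\<xi>\<^sup>2 / 2) * V t \<xi>))) \<le> ?d h + L2_norm (?b h) + L2_norm (?c h)"
    proof eventually_elim
      case (elim h)
      then have h: "0 \<le> t + h" by simp
      note [measurable] = V[OF h, THEN L2_measurable]
      have d: "(\<lambda>\<xi>. (V (t + h) \<xi> - V t \<xi>) / of_real h - X \<xi>) \<in> L2"
        using L2_diff[OF L2_cmult[OF L2_diff[OF V[OF h] V[OF t0]], of "1 / of_real h"] X] by simp
      have a: "?a h \<in> L2" "L2_norm (?a h) = ?d h"
      proof -
        show "?a h \<in> L2" by (rule L2_dominated(1)[OF d, of _ 1]) (auto simp: norm_mult)
        show "L2_norm (?a h) = ?d h" by (simp add: L2_norm_def norm_mult)
      qed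
      have b: "?b h \<in> L2" by (rule L2_dominated(1)[where C=1, OF L2_cmult[OF X, of 2] bm]) (use ble in auto)
      have c: "?c h \<in> L2" by (rule L2_dominated(1)[where C=1, OF W cm]) (use cle in auto)
      have "(\<lambda>\<xi>. (chirp (t + h) \<xi> * V (t + h) \<xi> - chirp t \<xi> * V t \<xi>) / of_real h
          - chirp t \<xi> * (X \<xi> + \<i> * of_real (\<xi>\<^sup>2 / 2) * V t \<xi>)) = (\<lambda>\<xi>. ?a h \<xi> + ?b h \<xi> + ?c h \<xi>)"
      proof (rule ext)
        fix \<xi>
        \<comment> \<open>Here \<open>p\<close>, \<open>q\<close> stand for the chirps at
          \<open>t + h\<close> and \<open>t\<close>, \<open>u\<close>, \<open>v\<close> for the
          values of \<open>V\<close>, \<open>k\<close> for \<open>h\<close>, and \<open>z\<close>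
          for \<open>\<i> * \<xi>\<^sup>2 / 2\<close>.\<close>
        have "(p * u - q * v) / k - q * (x + z * v) = p * ((u - v) / k - x) + (p - q) * x + ((p - q) / k - z * q) * v"
          for p q u v k x z :: complex
          by (simp add: algebra_simps diff_divide_distrib)
        then show "(chirp (t + h) \<xi> * V (t + h) \<xi> - chirp t \<xi> * V t \<xi>) / of_real h
          - chirp t \<xi> * (X \<xi> + \<i> * of_real (\<xi>\<^sup>2 / 2) * V t \<xi>) = ?a h \<xi> + ?b h \<xi> + ?c h \<xi>" .
      qed
      then have "L2_norm (\<lambda>\<xi>. (chirp (t + h) \<xi> * V (t + h) \<xi> - chirp t \<xi> * V t \<xi>) / of_real h
          - chirp t \<xi> * (X \<xi> + \<i> * of_real (\<xi>\<^sup>2 / 2) * V t \<xi>)) = L2_norm (\<lambda>\<xi>. ?a h \<xi> + ?b h \<xi> + ?c h \<xi>)"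
        by (rule arg_cong)
      also have "\<dots> \<le> L2_norm (\<lambda>\<xi>. ?a h \<xi> + ?b h \<xi>) + L2_norm (?c h)"
        by (rule L2_norm_triangle[OF L2_add[OF a(1) b] c])
      also have "L2_norm (\<lambda>\<xi>. ?a h \<xi> + ?b h \<xi>) \<le> ?d h + L2_norm (?b h)"
        using L2_norm_triangle[OF a(1) b] by (simp only: a(2))
      finally show ?case by simp
    qed
  qed
qed

text \<open>After transforming the equation, the term of \<open>dxx\<close> is cancelled exactly by
  the time derivative of the chirp, so only the nonlinearity drives the profile.\<close>

lemma nls_profile_of_solution:
  assumes cont: "\<And>j. continuous_H2_H11 (u j)" and eqn: "\<And>j. solves_equation (u j) (u (\<not> j))"
    and U: "\<And>j t. 0 \<le> t \<Longrightarrow> H2_transform (u j t) (U j t)"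
  shows "nls_profile U"
proof
  fix j :: bool and t :: real
  assume t: "0 \<le> t"
  note D = H2_transform_D[OF U[OF t]]
  show "U j t \<in> borel_measurable borel" "(\<lambda>\<xi>. of_real (1 + \<xi>\<^sup>2) * U j t \<xi>) \<in> L2" by (rule D)+
  have lim: "((\<lambda>\<tau>. sobolev_norm 2 0 (\<lambda>x. u j \<tau> x - u j t x) + sobolev_norm 1 1 (\<lambda>x. u j \<tau> x - u j t x)) \<longlongrightarrow> 0) (at t within {0..})"
    using cont[of j] t by (simp add: continuous_H2_H11_def)
  show "((\<lambda>\<tau>. L2_norm (\<lambda>\<xi>. of_real (1 + \<xi>\<^sup>2) * (U j \<tau> \<xi> - U j t \<xi>))) \<longlongrightarrow> 0) (at t within {0..})"
  proof (rule Lim_null_comparison[OF _ lim])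
    have "\<forall>\<^sub>F \<tau> in at t within {0..}. 0 \<le> \<tau>" by (simp add: eventually_at_filter)
    then show "\<forall>\<^sub>F \<tau> in at t within {0..}. norm (L2_norm (\<lambda>\<xi>. of_real (1 + \<xi>\<^sup>2) * (U j \<tau> \<xi> - U j t \<xi>)))
        \<le> sobolev_norm 2 0 (\<lambda>x. u j \<tau> x - u j t x) + sobolev_norm 1 1 (\<lambda>x. u j \<tau> x - u j t x)"
    proof eventually_elim
      case (elim \<tau>)
      have "0 \<le> sobolev_norm 1 1 (\<lambda>x. u j \<tau> x - u j t x)" by (simp add: sobolev_norm_def)
      then show ?case using sobolev_norm_2_0[OF H2_transform_lin(1)[OF U[OF elim] U[OF t]], of j j] by simp
    qed
  qed
next
  fix j :: bool and t :: real
  assume t: "0 < t"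
  then have t0: "0 \<le> t" by simp
  let ?w = "\<lambda>j x. fourier (U j t) (- x)"
  let ?N = "\<lambda>x. of_real ((cmod (?w (\<not> j) x))\<^sup>2) * ?w j x"
  note D = H2_transform_D[OF U[OF t0]]
  have UL: "U j s \<in> L2" if "0 \<le> s" for j s
    using is_fourier_L2_D(2)[OF H2_transform_D(1)[OF U[OF that]]] .
  have w: "?w j \<in> L2" for j by (rule fourier_inverse_L2[OF UL[OF t0] D(4)])
  let ?M = "weight_const * L2_norm (\<lambda>\<xi>. of_real (1 + \<xi>\<^sup>2) * U True t \<xi>)
    + weight_const * L2_norm (\<lambda>\<xi>. of_real (1 + \<xi>\<^sup>2) * U False t \<xi>)"
  have wM: "cmod (?w j x) \<le> ?M" for j x
    using weighted_L2(5)[OF D(2,3), of j "- x"] weight_const_nonneg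
    by (cases j) (simp_all add: add_increasing add_increasing2)
  note N = cubic_L2[OF w wM w wM, of "\<not> j" j]
  obtain du where du: "du \<in> L2" "((\<lambda>h. L2_norm (\<lambda>x. (u j (t + h) x - u j t x) / of_real h - du x)) \<longlongrightarrow> 0) (at 0)"
    and eq: "AE x in lborel. \<i> * du x + 1 / 2 * dxx (u j t) x = - \<i> * of_real ((cmod (u (\<not> j) t x))\<^sup>2) * u j t x"
    using eqn[of j] t unfolding solves_equation_def has_L2_derivative_def tendsto_L2_def by blast
  let ?X = "\<lambda>\<xi>. \<i> / 2 * (- of_real (\<xi>\<^sup>2) * U j t \<xi>) - fourier ?N \<xi>"
  have X: "is_fourier_L2 (\<lambda>x. \<i> / 2 * dxx (u j t) x - ?N x) ?X"
    using is_fourier_L2_diff[OF is_fourier_L2_cmult[OF dxx_transform[OF U[OF t0, of j]], of "\<i> / 2"] is_fourier_L2_L1[OF N]] .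
  have duX: "is_fourier_L2 du ?X"
  proof (rule is_fourier_L2_cong[OF X])
    \<comment> \<open>By inversion \<open>u\<close> agrees almost everywhere with the waves, so the
      nonlinearity of the equation may be computed from the waves.\<close>
    show "AE x in lborel. \<i> / 2 * dxx (u j t) x - ?N x = du x"
      using eq fourier_inversion[OF D(1,4), of j] fourier_inversion[OF D(1,4), of "\<not> j"]
    proof eventually_elim
      case (elim x)
      have "du x = - \<i> * (\<i> * du x)" by simp
      also have "\<i> * du x = - \<i> * of_real ((cmod (u (\<not> j) t x))\<^sup>2) * u j t x - 1 / 2 * dxx (u j t) x"
        using elim(1) by (simp add: eq_diff_eq)
      finally show ?case using elim(2,3) by (simp add: algebra_simps)
    qed
  qed (use du is_fourier_L2_D(2)[OF X] in \<open>auto intro: L2_measurable\<close>)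
  have lim: "((\<lambda>h. L2_norm (\<lambda>\<xi>. (U j (t + h) \<xi> - U j t \<xi>) / of_real h - ?X \<xi>)) \<longlongrightarrow> 0) (at 0)"
  proof (rule Lim_null_comparison[OF _ du(2)])
    have "\<forall>\<^sub>F h in at 0. - t < (h :: real)"
      using t by (intro order_tendstoD(1)[OF tendsto_ident_at]) auto
    then show "\<forall>\<^sub>F h in at 0. norm (L2_norm (\<lambda>\<xi>. (U j (t + h) \<xi> - U j t \<xi>) / of_real h - ?X \<xi>))
        \<le> L2_norm (\<lambda>x. (u j (t + h) x - u j t x) / of_real h - du x)"
    proof eventually_elim
      case (elim h)
      then have h: "0 \<le> t + h" by simp
      have "is_fourier_L2 (\<lambda>x. 1 / of_real h * (u j (t + h) x - u j t x) - du x)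
          (\<lambda>\<xi>. 1 / of_real h * (U j (t + h) \<xi> - U j t \<xi>) - ?X \<xi>)"
        by (intro is_fourier_L2_diff is_fourier_L2_cmult duX H2_transform_D(1)[OF U] h t0)
      from plancherel_L2[OF this] show ?case by simp
    qed
  qed
  have "((\<lambda>h. L2_norm (\<lambda>\<xi>. (chirp (t + h) \<xi> * U j (t + h) \<xi> - chirp t \<xi> * U j t \<xi>) / of_real h
      - chirp t \<xi> * (?X \<xi> + \<i> * of_real (\<xi>\<^sup>2 / 2) * U j t \<xi>))) \<longlongrightarrow> 0) (at 0)"
    by (rule profile_derivative[OF t UL D(3) is_fourier_L2_D(2)[OF X] lim])
  moreover have "chirp t \<xi> * (?X \<xi> + \<i> * of_real (\<xi>\<^sup>2 / 2) * U j t \<xi>) = - (chirp t \<xi> * fourier ?N \<xi>)" for \<xi>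
    by (simp add: algebra_simps)
  ultimately show "((\<lambda>h. L2_norm (\<lambda>\<xi>. (chirp (t + h) \<xi> * U j (t + h) \<xi> - chirp t \<xi> * U j t \<xi>) / of_real h
         - (- (chirp t \<xi> * fourier ?N \<xi>)))) \<longlongrightarrow> 0) (at 0)" by (simp only:)
qed

section \<open>The scattering states\<close>

text \<open>The free group is isometric, so convergence of the profiles in L2 passes to the norms of
  \<open>U t\<close>.\<close>

lemma scattering_state_norm:
  assumes U: "\<And>t. 0 \<le> t \<Longrightarrow> H2_transform (u t) (U t)" and s: "scattering_state u \<phi>"
  shows "((\<lambda>t. L2_norm (U t)) \<longlongrightarrow> L2_norm \<phi>) at_top"
proof -
  have "((\<lambda>t. L2_norm (schroedinger (- t) (u t))) \<longlongrightarrow> L2_norm \<phi>) at_top"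
    using s unfolding scattering_state_def tendsto_L2_def by (intro tendsto_L2_norm) auto
  moreover have "\<forall>\<^sub>F t in at_top. L2_norm (schroedinger (- t) (u t)) = L2_norm (U t)"
    using eventually_ge_at_top[of 0] by eventually_elim (rule L2_norm_schroedinger[OF U])
  ultimately show ?thesis by (rule Lim_transform_eventually)
qed

text \<open>The difference of the local masses is almost conserved, so the one that dominates on
  \<open>[a, b]\<close> initially cannot vanish asymptotically.\<close>

lemma scattering_state_nonzero:
  fixes \<psi> :: "bool \<Rightarrow> real \<Rightarrow> complex" and K \<epsilon> :: real
  defines "D \<equiv> 1 + 2 * K"
  assumes \<psi>: "\<And>j. H2_transform (\<psi> j) (fourier (\<psi> j))"
    and K: "\<And>j a b. L2_norm (weyl_diff a b (fourier (\<psi> j))) \<le> K * (\<bar>a\<bar> + \<bar>b\<bar>)" "\<And>j. L2_norm (fourier (\<psi> j)) \<le> K"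
    and ab: "a \<le> b"
    and mass: "0 < \<gamma>" "(LINT \<xi>|lborel. indicator {a..b} \<xi> * ((cmod (fourier (\<psi> j) \<xi>))\<^sup>2 - (cmod (fourier (\<psi> (\<not> j)) \<xi>))\<^sup>2)) \<ge> \<gamma>"
    and eps: "0 < \<epsilon>" "8 * (wave_const D)\<^sup>2 * \<epsilon>\<^sup>2 \<le> 1 / 32" "error_const D * \<epsilon>\<^sup>2 \<le> 1"
      "4 * (b - a) * error_const D * \<epsilon>\<^sup>2 \<le> \<gamma>"
    and cont: "\<And>i. continuous_H2_H11 (u i)" and eqn: "\<And>i. solves_equation (u i) (u (\<not> i))"
    and init: "\<And>i. AE x in lborel. u i 0 x = of_real \<epsilon> * \<psi> i x"
    and scat: "scattering_state (u j) \<phi>"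
  shows "0 < L2_norm \<phi>"
proof -
  \<comment> \<open>At time \<open>0\<close> the choice is pinned to the Fourier integral of the
    data, so that the formula for \<open>prof i 0\<close> is an identity of functions and not only
    almost everywhere.\<close>
  let ?P = "\<lambda>i t V. H2_transform (u i t) V \<and> (t = 0 \<longrightarrow> V = (\<lambda>\<xi>. of_real \<epsilon> * fourier (\<psi> i) \<xi>))"
  have ex: "\<exists>V. H2_transform (u i t) V \<and> (t = 0 \<longrightarrow> V = (\<lambda>\<xi>. of_real \<epsilon> * fourier (\<psi> i) \<xi>))" if t: "0 \<le> t" for i t
  proof (cases "t = 0")
    case False
    have "u i t \<in> sobolev 2 0" using cont[of i] t by (simp add: continuous_H2_H11_def)
    then show ?thesis using False by (auto elim: sobolev_2_0_transform)
  next
    case True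
    have "u i 0 \<in> sobolev 2 0" using cont[of i] by (simp add: continuous_H2_H11_def)
    then obtain V where V: "H2_transform (u i 0) V" by (rule sobolev_2_0_transform)
    note e = H2_transform_lin(2)[OF \<psi>[of i] \<psi>[of i], of "of_real \<epsilon>"]
    have "is_fourier_L2 (u i 0) (\<lambda>\<xi>. of_real \<epsilon> * fourier (\<psi> i) \<xi>)"
    proof (rule is_fourier_L2_cong[OF H2_transform_D(1)[OF e]])
      show "u i 0 \<in> borel_measurable borel"
        by (rule L2_measurable[OF is_fourier_L2_D(1)[OF H2_transform_D(1)[OF V]]])
      show "AE x in lborel. of_real \<epsilon> * \<psi> i x = u i 0 x"
        using init[of i] by eventually_elim simp
    qed (use H2_transform_D(2)[OF e] in simp_all)
    then have "H2_transform (u i 0) (\<lambda>\<xi>. of_real \<epsilon> * fourier (\<psi> i) \<xi>)"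
      by (rule H2_transform_cong[OF V]) simp
    then show ?thesis using True by blast
  qed
  define U where "U i t = (SOME V. ?P i t V)" for i t
  have PU: "?P i t (U i t)" if "0 \<le> t" for i t
    unfolding U_def by (rule someI_ex[OF ex[OF that]])
  then have U: "\<And>i t. 0 \<le> t \<Longrightarrow> H2_transform (u i t) (U i t)" by blast
  have U0: "\<And>i. U i 0 = (\<lambda>\<xi>. of_real \<epsilon> * fourier (\<psi> i) \<xi>)" using PU[of 0] by simp
  interpret nls_profile U by (rule nls_profile_of_solution[where u=u and U=U, OF cont eqn U])
  have p0: "prof i 0 = (\<lambda>\<xi>. of_real \<epsilon> * fourier (\<psi> i) \<xi>)" for i
    by (simp add: prof_def[abs_def] U0 chirp_def)
  have K0: "0 \<le> K" using K(2) L2_norm_nonneg order_trans by blast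
  have D1: "1 \<le> D" using K0 by (simp add: D_def)
  have weyl: "sqrt (weyl_energy c d 0) \<le> \<epsilon> * D * (\<bar>c\<bar> + \<bar>d\<bar>)" for c d
  proof -
    have "weyl_diff c d (prof i 0) = (\<lambda>\<xi>. of_real \<epsilon> * weyl_diff c d (fourier (\<psi> i)) \<xi>)" for i
      unfolding p0 by (auto simp: weyl_diff_def algebra_simps)
    then have w: "L2_norm (weyl_diff c d (prof i 0)) \<le> \<epsilon> * (K * (\<bar>c\<bar> + \<bar>d\<bar>))" for i
      using K(1)[of c d i] eps(1) by (simp add: L2_norm_cmult)
    \<comment> \<open>The sum over the two components is the origin of \<open>2 * K\<close> in
      \<open>D\<close>.\<close>
    have "sqrt (weyl_energy c d 0) \<le> L2_norm (weyl_diff c d (prof True 0)) + L2_norm (weyl_diff c d (prof False 0))"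
      unfolding weyl_energy_def by (rule sqrt_sum_squares_le_sum) simp_all
    also have "\<dots> \<le> \<epsilon> * (2 * K) * (\<bar>c\<bar> + \<bar>d\<bar>)" using w[of True] w[of False] by simp
    also have "\<dots> \<le> \<epsilon> * D * (\<bar>c\<bar> + \<bar>d\<bar>)"
      using eps(1) by (intro mult_right_mono mult_left_mono) (auto simp: D_def)
    finally show ?thesis .
  qed
  have m0: "L2_norm (prof i 0) \<le> \<epsilon> * D" for i
  proof -
    have "L2_norm (prof i 0) = \<epsilon> * L2_norm (fourier (\<psi> i))" unfolding p0 L2_norm_cmult using eps(1) by simp
    also have "\<dots> \<le> \<epsilon> * D" using K(2)[of i] K0 eps(1) by (intro mult_left_mono) (auto simp: D_def)
    finally show ?thesis .
  qed
  let ?c = "\<epsilon>\<^sup>2 * \<gamma> / 2"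
  have F: "fourier (\<psi> i) \<in> L2" for i by (rule is_fourier_L2_D(2)[OF H2_transform_D(1)[OF \<psi>]])
  have lint: "integrable lborel (\<lambda>\<xi>. indicator {a..b} \<xi> * (cmod (fourier (\<psi> i) \<xi>))\<^sup>2)" for i
    using integrable_mult_indicator[OF _ L2_integrable[OF F[of i]], of "{a..b}"] by simp
  have l0: "local_mass a b i 0 = \<epsilon>\<^sup>2 * (LINT \<xi>|lborel. indicator {a..b} \<xi> * (cmod (fourier (\<psi> i) \<xi>))\<^sup>2)" for i
    unfolding local_mass_eq p0
    by (subst integral_mult_right_zero[symmetric], rule Bochner_Integration.integral_cong)
      (auto simp: norm_mult power_mult_distrib)
  have "\<epsilon>\<^sup>2 * \<gamma> \<le> \<epsilon>\<^sup>2 * (LINT \<xi>|lborel. indicator {a..b} \<xi> * (cmod (fourier (\<psi> j) \<xi>))\<^sup>2 - indicator {a..b} \<xi> * (cmod (fourier (\<psi> (\<not> j)) \<xi>))\<^sup>2)"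
    using mass(2) by (intro mult_left_mono) (simp_all add: right_diff_distrib)
  then have d0: "\<epsilon>\<^sup>2 * \<gamma> \<le> local_mass a b j 0 - local_mass a b (\<not> j) 0"
    unfolding l0 using lint by (simp add: right_diff_distrib)
  \<comment> \<open>The accumulated error uses up at most half of the initial gap
    \<open>\<epsilon>\<^sup>2 * \<gamma>\<close>; the factor \<open>4\<close> in the smallness
    assumption is chosen for this.\<close>
  have e4: "2 * ((b - a) * (error_const D * \<epsilon> ^ 4)) \<le> ?c"
  proof -
    have "2 * ((b - a) * (error_const D * \<epsilon> ^ 4)) = \<epsilon>\<^sup>2 * (4 * (b - a) * error_const D * \<epsilon>\<^sup>2) / 2"
      by (simp add: power2_eq_square power4_eq_xxxx)
    also have "\<dots> \<le> ?c" by (intro divide_right_mono mult_left_mono eps) simp_all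
    finally show ?thesis .
  qed
  have "?c \<le> (L2_norm (U j t))\<^sup>2" if t: "0 \<le> t" for t
  proof -
    \<comment> \<open>The conservation estimate is an upper bound, so it is applied to the other
      component, whose mass at time \<open>t\<close> is then discarded as nonnegative.\<close>
    have "local_mass a b (\<not> j) t - local_mass a b (\<not> \<not> j) t
        \<le> local_mass a b (\<not> j) 0 - local_mass a b (\<not> \<not> j) 0 + 2 * ((b - a) * (error_const D * \<epsilon> ^ 4))"
      by (rule local_mass_difference[OF eps(1) D1 weyl m0 eps(2,3) t ab])
    moreover have "0 \<le> local_mass a b (\<not> j) t" by (simp add: local_mass_def)
    ultimately have "?c \<le> local_mass a b j t" using d0 e4 by simp
    also have "\<dots> \<le> (L2_norm (prof j t))\<^sup>2"
      unfolding local_mass_eq L2_norm_power2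
    proof (rule integral_mono_AE')
      show "AE \<xi> in lborel. indicator {a..b} \<xi> * (cmod (prof j t \<xi>))\<^sup>2 \<le> (cmod (prof j t \<xi>))\<^sup>2"
        by (intro AE_I2) (simp split: split_indicator)
    qed (use L2_integrable[OF prof_L2(1)[OF t]] in simp_all)
    finally show ?thesis using prof_L2(2)[OF t] by simp
  qed
  note lower = this
  have "\<forall>\<^sub>F t in at_top. ?c \<le> (L2_norm (U j t))\<^sup>2"
    by (rule eventually_mono[OF eventually_ge_at_top[of 0]]) (rule lower)
  moreover have "((\<lambda>t. (L2_norm (U j t))\<^sup>2) \<longlongrightarrow> (L2_norm \<phi>)\<^sup>2) at_top"
    by (intro tendsto_intros scattering_state_norm[OF U scat])
  ultimately have "?c \<le> (L2_norm \<phi>)\<^sup>2"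
    by (intro tendsto_lowerbound) auto
  moreover have "0 < ?c" using eps(1) mass(1) by simp
  ultimately have "L2_norm \<phi> \<noteq> 0" by auto
  then show ?thesis using L2_norm_nonneg[of \<phi>] by linarith
qed

text \<open>If no interval carried a positive integral, \<open>continuous_le_of_averages\<close>
  with \<open>c = 0\<close> would make the continuous difference nonpositive at
  \<open>\<xi>\<close>.\<close>

lemma local_mass_gap:
  assumes f: "integrable lborel f" "fourier f \<in> L2" and g: "integrable lborel g" "fourier g \<in> L2"
    and gt: "cmod (fourier f \<xi>) > cmod (fourier g \<xi>)"
  obtains a b \<gamma> where "a \<le> b" "0 < \<gamma>"
    "\<gamma> \<le> (LINT \<eta>|lborel. indicator {a..b} \<eta> * ((cmod (fourier f \<eta>))\<^sup>2 - (cmod (fourier g \<eta>))\<^sup>2))"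
proof -
  let ?h = "\<lambda>\<eta>. (cmod (fourier f \<eta>))\<^sup>2 - (cmod (fourier g \<eta>))\<^sup>2"
  have "\<exists>a b. a \<le> b \<and> 0 < (LINT \<eta>|lborel. indicator {a..b} \<eta> * ?h \<eta>)"
  proof (rule ccontr)
    assume n: "\<nexists>a b. a \<le> b \<and> 0 < (LINT \<eta>|lborel. indicator {a..b} \<eta> * ?h \<eta>)"
    have "?h \<xi> \<le> 0"
    proof (rule continuous_le_of_averages[where h="?h" and x=\<xi> and c=0])
      show "continuous_on UNIV ?h" by (intro continuous_intros continuous_on_fourier f g)
      show "integrable lborel (\<lambda>x. indicator {a..b} x * ?h x)" for a b
        using integrable_mult_indicator[of "{a..b}" lborel ?h] L2_integrable[OF f(2)] L2_integrable[OF g(2)] by simp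
      show "(LINT x|lborel. indicator {a..b} x * ?h x) \<le> (b - a) * 0" if "a \<le> b" for a b
        using n that by (simp add: not_less)
    qed
    moreover have "(cmod (fourier g \<xi>))\<^sup>2 < (cmod (fourier f \<xi>))\<^sup>2" using gt by (intro power_strict_mono) auto
    ultimately show False by linarith
  qed
  then show ?thesis using that by blast
qed

lemma small_parameter:
  fixes c \<gamma> :: real
  assumes "0 < \<gamma>" shows "\<forall>\<^sub>F \<epsilon> in at_right 0. c * \<epsilon>\<^sup>2 \<le> \<gamma>"
proof -
  have "((\<lambda>\<epsilon>. c * \<epsilon>\<^sup>2) \<longlongrightarrow> c * 0\<^sup>2) (at_right 0)" by (intro tendsto_intros)
  then have "\<forall>\<^sub>F \<epsilon> in at_right 0. c * \<epsilon>\<^sup>2 < \<gamma>" using assms by (intro order_tendstoD) auto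
  then show ?thesis by eventually_elim simp
qed

theorem corollary2p1:
  fixes \<psi>1 \<psi>2 :: "real \<Rightarrow> complex"
  assumes "\<psi>1 \<in> sobolev 2 0 \<inter> sobolev 1 1"
    and "\<psi>2 \<in> sobolev 2 0 \<inter> sobolev 1 1"
    and "\<exists>\<xi>. cmod (fourier \<psi>1 \<xi>) > cmod (fourier \<psi>2 \<xi>)"
    and "\<exists>\<xi>. cmod (fourier \<psi>1 \<xi>) < cmod (fourier \<psi>2 \<xi>)"
  shows "\<exists>\<epsilon>0>0. \<forall>\<epsilon>::real. 0 < \<epsilon> \<and> \<epsilon> < \<epsilon>0 \<longrightarrow>
    (\<forall>u1 u2 \<phi>1 \<phi>2.
       global_solution (\<lambda>x. of_real \<epsilon> * \<psi>1 x) (\<lambda>x. of_real \<epsilon> * \<psi>2 x) u1 u2 \<and>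
       scattering_state u1 \<phi>1 \<and> scattering_state u2 \<phi>2 \<longrightarrow>
       L2_norm \<phi>1 > 0 \<and> L2_norm \<phi>2 > 0)"
proof -
  define \<psi> where "\<psi> j = (if j then \<psi>1 else \<psi>2)" for j
  obtain K1 where K1: "integrable lborel \<psi>1" "H2_transform \<psi>1 (fourier \<psi>1)"
    "\<And>a b. L2_norm (weyl_diff a b (fourier \<psi>1)) \<le> K1 * (\<bar>a\<bar> + \<bar>b\<bar>)" "0 \<le> K1"
    using sobolev_data[OF assms(1)] by blast
  obtain K2 where K2: "integrable lborel \<psi>2" "H2_transform \<psi>2 (fourier \<psi>2)"
    "\<And>a b. L2_norm (weyl_diff a b (fourier \<psi>2)) \<le> K2 * (\<bar>a\<bar> + \<bar>b\<bar>)" "0 \<le> K2"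
    using sobolev_data[OF assms(2)] by blast
  \<comment> \<open>A single constant that dominates the Weyl bounds and the norms of both
    data.\<close>
  define K where "K = K1 + K2 + L2_norm (fourier \<psi>1) + L2_norm (fourier \<psi>2)"
  define D where "D = 1 + 2 * K"
  have H: "H2_transform (\<psi> j) (fourier (\<psi> j))" for j using K1(2) K2(2) by (simp add: \<psi>_def)
  have KK: "K1 \<le> K" "K2 \<le> K" "L2_norm (fourier \<psi>1) \<le> K" "L2_norm (fourier \<psi>2) \<le> K"
    using K1(4) K2(4) L2_norm_nonneg[of "fourier \<psi>1"] L2_norm_nonneg[of "fourier \<psi>2"] unfolding K_def by linarith+
  have w: "L2_norm (weyl_diff a b (fourier (\<psi> j))) \<le> K * (\<bar>a\<bar> + \<bar>b\<bar>)" for j a b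
    using order_trans[OF K1(3) mult_right_mono[OF KK(1)]] order_trans[OF K2(3) mult_right_mono[OF KK(2)]]
    by (simp add: \<psi>_def)
  have n: "L2_norm (fourier (\<psi> j)) \<le> K" for j using KK by (simp add: \<psi>_def)
  have F: "fourier \<psi>1 \<in> L2" "fourier \<psi>2 \<in> L2"
    using is_fourier_L2_D(2)[OF H2_transform_D(1)] K1(2) K2(2) by blast+
  have ex: "\<exists>a b \<gamma>. a \<le> b \<and> 0 < \<gamma> \<and> \<gamma> \<le> (LINT \<xi>|lborel. indicator {a..b} \<xi> *
      ((cmod (fourier (\<psi> j) \<xi>))\<^sup>2 - (cmod (fourier (\<psi> (\<not> j)) \<xi>))\<^sup>2))" for j
  proof (cases j)
    case True
    obtain \<xi> where "cmod (fourier \<psi>1 \<xi>) > cmod (fourier \<psi>2 \<xi>)" using assms(3) by blast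
    from local_mass_gap[OF K1(1) F(1) K2(1) F(2) this] obtain a b \<gamma> where "a \<le> b" "0 < \<gamma>"
      "\<gamma> \<le> (LINT \<eta>|lborel. indicator {a..b} \<eta> * ((cmod (fourier \<psi>1 \<eta>))\<^sup>2 - (cmod (fourier \<psi>2 \<eta>))\<^sup>2))" .
    then show ?thesis using True by (intro exI[of _ a] exI[of _ b] exI[of _ \<gamma>]) (simp add: \<psi>_def)
  next
    case False
    obtain \<xi> where "cmod (fourier \<psi>2 \<xi>) > cmod (fourier \<psi>1 \<xi>)" using assms(4) by blast
    from local_mass_gap[OF K2(1) F(2) K1(1) F(1) this] obtain a b \<gamma> where "a \<le> b" "0 < \<gamma>"
      "\<gamma> \<le> (LINT \<eta>|lborel. indicator {a..b} \<eta> * ((cmod (fourier \<psi>2 \<eta>))\<^sup>2 - (cmod (fourier \<psi>1 \<eta>))\<^sup>2))" .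
    then show ?thesis using False by (intro exI[of _ a] exI[of _ b] exI[of _ \<gamma>]) (simp add: \<psi>_def)
  qed
  let ?gap = "\<lambda>j a b \<gamma>. a \<le> b \<and> 0 < \<gamma> \<and> \<gamma> \<le> (LINT \<xi>|lborel. indicator {a..b} \<xi> *
      ((cmod (fourier (\<psi> j) \<xi>))\<^sup>2 - (cmod (fourier (\<psi> (\<not> j)) \<xi>))\<^sup>2))"
  obtain aT bT \<gamma>T aF bF \<gamma>F where T: "?gap True aT bT \<gamma>T" and F: "?gap False aF bF \<gamma>F"
    using ex[of True] ex[of False] by blast
  define a b \<gamma> where "a j = (if j then aT else aF)" and "b j = (if j then bT else bF)"
    and "\<gamma> j = (if j then \<gamma>T else \<gamma>F)" for j
  have gap: "a j \<le> b j" "0 < \<gamma> j" "\<gamma> j \<le> (LINT \<xi>|lborel. indicator {a j..b j} \<xi> *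
      ((cmod (fourier (\<psi> j) \<xi>))\<^sup>2 - (cmod (fourier (\<psi> (\<not> j)) \<xi>))\<^sup>2))" for j
    using T F unfolding a_def b_def \<gamma>_def by (cases j; simp)+
  \<comment> \<open>Every smallness condition has the form constant times
    \<open>\<epsilon>\<^sup>2\<close> below a positive number, so one threshold serves both
    components and their intervals.\<close>
  have "\<forall>\<^sub>F \<epsilon> in at_right 0. 8 * (wave_const D)\<^sup>2 * \<epsilon>\<^sup>2 \<le> 1 / 32 \<and> error_const D * \<epsilon>\<^sup>2 \<le> 1 \<and>
      4 * (b True - a True) * error_const D * \<epsilon>\<^sup>2 \<le> \<gamma> True \<and>
      4 * (b False - a False) * error_const D * \<epsilon>\<^sup>2 \<le> \<gamma> False"
    by (intro eventually_conj small_parameter gap) simp_all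
  then obtain \<epsilon>0 where \<epsilon>0: "0 < \<epsilon>0" and small: "\<And>\<epsilon>. 0 < \<epsilon> \<Longrightarrow> \<epsilon> < \<epsilon>0 \<Longrightarrow>
      8 * (wave_const D)\<^sup>2 * \<epsilon>\<^sup>2 \<le> 1 / 32 \<and> error_const D * \<epsilon>\<^sup>2 \<le> 1 \<and>
      4 * (b True - a True) * error_const D * \<epsilon>\<^sup>2 \<le> \<gamma> True \<and>
      4 * (b False - a False) * error_const D * \<epsilon>\<^sup>2 \<le> \<gamma> False"
    unfolding eventually_at_right_field by blast
  have "0 < L2_norm \<phi>1 \<and> 0 < L2_norm \<phi>2" if \<epsilon>: "0 < \<epsilon>" "\<epsilon> < \<epsilon>0"
    and sol: "global_solution (\<lambda>x. of_real \<epsilon> * \<psi>1 x) (\<lambda>x. of_real \<epsilon> * \<psi>2 x) u1 u2"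
    and scat: "scattering_state u1 \<phi>1" "scattering_state u2 \<phi>2" for \<epsilon> u1 u2 \<phi>1 \<phi>2
  proof -
    define u where "u j = (if j then u1 else u2)" for j
    have cont: "continuous_H2_H11 (u i)" and eqn: "solves_equation (u i) (u (\<not> i))"
      and init: "AE x in lborel. u i 0 x = of_real \<epsilon> * \<psi> i x" for i
      using sol by (auto simp: u_def \<psi>_def global_solution_def)
    have e: "8 * (wave_const D)\<^sup>2 * \<epsilon>\<^sup>2 \<le> 1 / 32" "error_const D * \<epsilon>\<^sup>2 \<le> 1"
      "4 * (b j - a j) * error_const D * \<epsilon>\<^sup>2 \<le> \<gamma> j" for j
      using small[OF \<epsilon>] by (cases j; simp)+
    have "0 < L2_norm \<phi>" if "scattering_state (u j) \<phi>" for j \<phi>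
      by (rule scattering_state_nonzero[OF H w n gap(1) gap(2) gap(3) \<epsilon>(1) e[unfolded D_def] cont eqn init that])
    from this[of True \<phi>1] this[of False \<phi>2] show ?thesis using scat by (simp add: u_def)
  qed
  then show ?thesis using \<epsilon>0 by blast
qed

end
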